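(* Fix a set $\tilde\Omega$ with $\Omega\subseteq\tilde\Omega\subseteq C([0,T],H)$. Let $u$ be a minimax subsolution and let $v$ be a minimax supersolution of (TVP) on $[0,T]\times\tilde\Omega$. Then $u\le v$ on $[0,T]\times\tilde\Omega$.
   Context: Spaces. Let $T>0$. $H$ is a real Hilbert space with inner product $(\cdot,\cdot)$ and norm $|\cdot|$; $V$ is a separable reflexive Banach space with norm $\|\cdot\|$, continuously, densely and compactly embedded into $H$; $V^\ast$ is its dual with norm $\|\cdot\|_\ast$ and duality pairing $\langle x^\ast,x\rangle=x^\ast(x)$. With the usual identifications, $V\subseteq H\subseteq V^\ast$ and $\langle x,y\rangle=(x,y)$ for $x\in H$, $y\in V$. Fix $p\ge 2$, $q>1$ with $1/p+1/q=1$. For $t_0\in[0,T)$, $W_{pq}(t_0,T)$ is the space of all $\mathbf{x}\in L^p(t_0,T;V)$ possessing a generalized derivative $\mathbf{x}'\in L^q(t_0,T;V^\ast)$. Operator. $A:[0,T]\times V\to V^\ast$ is fixed and satisfies: (i) $t\mapsto\langle A(t,x),v\rangle$ is measurable for all $x,v\in V$; (ii) for a.e. $t$ and all $x,y\in V$, $\langle A(t,x)-A(t,y),x-y\rangle\ge 0$; (iii) for a.e. $t$ and all $x,y,v\in V$, $s\mapsto\langle A(t,x+sy),v\rangle$ is continuous on $[0,1]$; (iv) there are $a_1\in L^q(0,T)$, $c_1\ge0$ with $\|A(t,x)\|_\ast\le a_1(t)+c_1\|x\|^{p-1}$ for all $x\in V$ and a.e. $t$; (v) there is $c_2>0$ with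 $\langle A(t,x),x\rangle\ge c_2\|x\|^p$ for all $x\in V$ and a.e. $t$. Paths and continuity. $C([0,T],H)$ carries the sup norm. On $[0,T]\times C([0,T],H)$ and its subsets use the pseudo-metric $\mathbf{d}_\infty((t,x),(s,y))=|t-s|+\sup_{r\in[0,T]}|x(r\wedge t)-y(r\wedge s)|$; (semi-)continuity in $(t,x)$ is meant with respect to $\mathbf{d}_\infty$ (so such functions are non-anticipating, i.e. their value at time $t$ depends only on the path up to time $t$). USC and LSC denote real-valued upper and lower semicontinuous functions. Trajectories. For $L\ge 0$ and $(t_0,x_0)\in[0,T)\times C([0,T],H)$, $\mathcal{X}^L(t_0,x_0)$ is the set of all $x\in C([0,T],H)$ with $x=x_0$ on $[0,t_0]$ for which there exist $\mathbf{x}\in W_{pq}(t_0,T)$ and $f^x\in L^2(t_0,T;H)$ with $x=\mathbf{x}$ a.e. on $(t_0,T)$, $\mathbf{x}'(t)+A(t,\mathbf{x}(t))=f^x(t)$ a.e. on $(t_0,T)$, and $|f^x(t)|\le L(1+\sup_{0\le s\le t}|x(s)|)$ a.e. on $(t_0,T)$ ($\mathbf{x}$, $f^x$ are uniquely determined by $x$). Fix $x_\ast\in H$, regarded as a constant path, and put $\Omega^L:=\mathcal{X}^L(0,x_\ast)$, $\Omega:=\bigcup_{L\ge0}\Omega^L$. Data. $h:C([0,T],H)\to\mathbb{R}$ is continuous. $F:[0,T]\times C([0,T],H)\times H\to\mathbb{R}$ satisfies: (i) $F$ is continuous; (ii) there is $L_0\ge0$ with $|F(t,x,z)-F(t,x,\tilde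 z)|\le L_0(1+\sup_{0\le s\le t}|x(s)|)|z-\tilde z|$ for all $t,x,z,\tilde z$; (iii) for every $L\ge0$ and $(t_0,x_0)\in[0,T)\times C([0,T],H)$ there is a modulus of continuity $m_{L,t_0,x_0}$ such that for all $\varepsilon>0$, $t\in[t_0,T]$, $x,y\in\mathcal{X}^L(t_0,x_0)$: $F(t,x,\varepsilon^{-1}[x(t)-y(t)])-F(t,y,\varepsilon^{-1}[x(t)-y(t)])\le m_{L,t_0,x_0}(\varepsilon^{-1}|x(t)-y(t)|^2+\sup_{s\le t}|x(s)-y(s)|)$. (TVP) denotes the terminal-value problem $\partial_tu-\langle A(t,x(t)),\partial_xu\rangle+F(t,x,\partial_xu)=0$ on $[0,T)\times C([0,T],H)$, $u(T,x)=h(x)$. Minimax semisolutions. For $L\ge0$, $u:[0,T]\times\tilde\Omega\to\mathbb{R}$ is a minimax $L$-subsolution (resp. $L$-supersolution) of (TVP) on $[0,T]\times\tilde\Omega$ if $u\in\mathrm{USC}([0,T]\times\tilde\Omega)$ (resp. $\mathrm{LSC}$), $u(T,\cdot)\le h$ (resp. $\ge h$) on $\tilde\Omega$, and for every $(t_0,x_0,z)\in[0,T)\times\tilde\Omega\times H$ there is $x\in\mathcal{X}^L(t_0,x_0)\cap\tilde\Omega$ such that for every $t\in[t_0,T]$: $u(t_0,x_0)\le$ (resp. $\ge$) $\int_{t_0}^t[(-f^x(s),z)+F(s,x,z)]\,ds+u(t,x)$. $u$ is a minimax subsolution (resp. supersolution) of (TVP) on $[0,T]\times\tilde\Omega$ if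 it is a minimax $L$-subsolution (resp. $L$-supersolution) for some $L\ge0$. *)

theory Defs
  imports "HOL-Analysis.Analysis"
begin

section \<open>The spaces\<close>

text \<open>
  The triple \<open>V \<subseteq> H \<subseteq> V\<^sup>*\<close> is given by an explicit embedding \<open>j\<close> of the type \<open>'v\<close> of \<open>V\<close> into the
  type \<open>'h\<close> of \<open>H\<close>, and \<open>V\<^sup>*\<close> is the type \<open>'v \<Rightarrow>\<^sub>L real\<close> with the operator norm. Separability of
  \<open>V\<close> is the class \<open>second_countable_topology\<close>, to which it is equivalent in metric spaces.
\<close>

definition reflexive_space :: "'v::real_normed_vector itself \<Rightarrow> bool" where
  "reflexive_space _ \<longleftrightarrow>
     (\<forall>\<xi> :: ('v \<Rightarrow>\<^sub>L real) \<Rightarrow>\<^sub>L real. \<exists>x::'v. \<forall>\<phi>. blinfun_apply \<xi> \<phi> = blinfun_apply \<phi> x)"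

definition evolution_triple ::
    "('v::{banach,second_countable_topology} \<Rightarrow>\<^sub>L 'h::{real_inner,banach}) \<Rightarrow> bool" where
  "evolution_triple j \<longleftrightarrow>
     reflexive_space TYPE('v) \<and>
     inj (blinfun_apply j) \<and>
     closure (range (blinfun_apply j)) = UNIV \<and>
     (\<forall>B. bounded B \<longrightarrow> compact (closure (blinfun_apply j ` B)))"

text \<open>The inclusion of \<open>H\<close> into \<open>V\<^sup>*\<close>: the functional \<open>y \<mapsto> (f, y)\<close>.\<close>

definition to_dual ::
    "('v::real_normed_vector \<Rightarrow>\<^sub>L 'h::real_inner) \<Rightarrow> 'h \<Rightarrow> ('v \<Rightarrow>\<^sub>L real)" where
  "to_dual j f = blinfun_inner_right f o\<^sub>L j"

text \<open>
  Lebesgue-Bochner spaces over an interval. All three of \<open>V\<close>, \<open>H\<close>, \<open>V\<^sup>*\<close> are separable in an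
  evolution triple, so that Borel and strong measurability coincide. The endpoints of the interval
  are included, which is irrelevant for Lebesgue measure.
\<close>

definition Lp_fun :: "real \<Rightarrow> real set \<Rightarrow> (real \<Rightarrow> 'b::real_normed_vector) \<Rightarrow> bool" where
  "Lp_fun p S g \<longleftrightarrow>
     g \<in> borel_measurable (lebesgue_on S) \<and>
     integrable (lebesgue_on S) (\<lambda>t. norm (g t) powr p)"

definition test_function :: "real \<Rightarrow> real \<Rightarrow> (real \<Rightarrow> real) \<Rightarrow> bool" where
  "test_function a b \<phi> \<longleftrightarrow>
     (\<forall>n. (deriv ^^ n) \<phi> differentiable_on UNIV) \<and>
     (\<exists>K. compact K \<and> K \<subseteq> {a<..<b} \<and> (\<forall>t. t \<notin> K \<longrightarrow> \<phi> t = 0))"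

text \<open>
  \<open>X'\<close> is the generalized derivative of \<open>X\<close> on \<open>(a,b)\<close>. The identity
  \<open>\<integral> \<phi>' X dt = - \<integral> \<phi> X' dt\<close> between elements of \<open>V\<^sup>*\<close> is stated by pairing both sides with
  every \<open>v \<in> V\<close> (the library's Bochner integral needs a second countable range type,
  which \<open>'v \<Rightarrow>\<^sub>L real\<close> is not known to be).
\<close>

definition generalized_derivative ::
    "('v::real_normed_vector \<Rightarrow>\<^sub>L 'h::real_inner) \<Rightarrow> real \<Rightarrow> real \<Rightarrow>
     (real \<Rightarrow> 'v) \<Rightarrow> (real \<Rightarrow> ('v \<Rightarrow>\<^sub>L real)) \<Rightarrow> bool" where
  "generalized_derivative j a b X X' \<longleftrightarrow>
     (\<forall>\<phi> v. test_function a b \<phi> \<longrightarrow>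
        (LINT t:{a..b}|lebesgue. deriv \<phi> t * blinfun_apply (to_dual j (blinfun_apply j (X t))) v)
        = - (LINT t:{a..b}|lebesgue. \<phi> t * blinfun_apply (X' t) v))"

text \<open>\<open>X \<in> W\<^sub>p\<^sub>q(a,b)\<close> with generalized derivative \<open>X'\<close>.\<close>

definition W_pq ::
    "real \<Rightarrow> real \<Rightarrow> ('v::real_normed_vector \<Rightarrow>\<^sub>L 'h::real_inner) \<Rightarrow> real \<Rightarrow> real \<Rightarrow>
     (real \<Rightarrow> 'v) \<Rightarrow> (real \<Rightarrow> ('v \<Rightarrow>\<^sub>L real)) \<Rightarrow> bool" where
  "W_pq p q j a b X X' \<longleftrightarrow>
     Lp_fun p {a..b} X \<and> Lp_fun q {a..b} X' \<and> generalized_derivative j a b X X'"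


section \<open>The operator\<close>

definition admissible_operator ::
    "real \<Rightarrow> real \<Rightarrow> real \<Rightarrow> (real \<Rightarrow> 'v::real_normed_vector \<Rightarrow> ('v \<Rightarrow>\<^sub>L real)) \<Rightarrow> bool" where
  "admissible_operator T p q A \<longleftrightarrow>
     (\<forall>x v. (\<lambda>t. blinfun_apply (A t x) v) \<in> borel_measurable (lebesgue_on {0..T})) \<and>
     (AE t in lebesgue_on {0..T}. \<forall>x y. blinfun_apply (A t x - A t y) (x - y) \<ge> 0) \<and>
     (AE t in lebesgue_on {0..T}. \<forall>x y v.
        continuous_on {0..1} (\<lambda>s. blinfun_apply (A t (x + s *\<^sub>R y)) v)) \<and>
     (\<exists>a\<^sub>1 :: real \<Rightarrow> real. \<exists>c\<^sub>1\<ge>0. Lp_fun q {0..T} a\<^sub>1 \<and>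
        (AE t in lebesgue_on {0..T}. \<forall>x. norm (A t x) \<le> a\<^sub>1 t + c\<^sub>1 * norm x powr (p - 1))) \<and>
     (\<exists>c\<^sub>2>0. AE t in lebesgue_on {0..T}. \<forall>x. blinfun_apply (A t x) x \<ge> c\<^sub>2 * norm x powr p)"


section \<open>Paths and continuity\<close>

text \<open>
  Elements of \<open>C([0,T],H)\<close> are extensional functions, so that paths agreeing on \<open>[0,T]\<close> are equal.
\<close>

definition C_paths :: "real \<Rightarrow> (real \<Rightarrow> 'h::real_normed_vector) set" where
  "C_paths T = {x \<in> extensional {0..T}. continuous_on {0..T} x}"

definition const_path :: "real \<Rightarrow> 'h \<Rightarrow> (real \<Rightarrow> 'h)" where
  "const_path T a = restrict (\<lambda>_. a) {0..T}"

definition sup_upto :: "real \<Rightarrow> (real \<Rightarrow> 'h::real_normed_vector) \<Rightarrow> real" where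
  "sup_upto t x = (SUP s\<in>{0..t}. norm (x s))"

definition d_sup :: "real \<Rightarrow> (real \<Rightarrow> 'h::real_normed_vector) \<Rightarrow> (real \<Rightarrow> 'h) \<Rightarrow> real" where
  "d_sup T x y = (SUP r\<in>{0..T}. norm (x r - y r))"

definition d_inf ::
    "real \<Rightarrow> real \<times> (real \<Rightarrow> 'h::real_normed_vector) \<Rightarrow> real \<times> (real \<Rightarrow> 'h) \<Rightarrow> real" where
  "d_inf T = (\<lambda>(t, x) (s, y).
     \<bar>t - s\<bar> + (SUP r\<in>{0..T}. norm (x (min r t) - y (min r s))))"

definition d_inf_H ::
    "real \<Rightarrow> real \<times> (real \<Rightarrow> 'h::real_normed_vector) \<times> 'h \<Rightarrow>
     real \<times> (real \<Rightarrow> 'h) \<times> 'h \<Rightarrow> real" where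
  "d_inf_H T = (\<lambda>(t, x, z) (s, y, w). d_inf T (t, x) (s, y) + norm (z - w))"

text \<open>
  (Semi)continuity of real-valued functions on \<open>S\<close> with respect to a pseudo-metric \<open>d\<close>; the library
  only treats metrics.
\<close>

definition continuous_wrt :: "('a \<Rightarrow> 'a \<Rightarrow> real) \<Rightarrow> 'a set \<Rightarrow> ('a \<Rightarrow> real) \<Rightarrow> bool" where
  "continuous_wrt d S g \<longleftrightarrow>
     (\<forall>a\<in>S. \<forall>e>0. \<exists>\<delta>>0. \<forall>b\<in>S. d a b < \<delta> \<longrightarrow> \<bar>g b - g a\<bar> < e)"

definition USC_wrt :: "('a \<Rightarrow> 'a \<Rightarrow> real) \<Rightarrow> 'a set \<Rightarrow> ('a \<Rightarrow> real) \<Rightarrow> bool" where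
  "USC_wrt d S g \<longleftrightarrow>
     (\<forall>a\<in>S. \<forall>e>0. \<exists>\<delta>>0. \<forall>b\<in>S. d a b < \<delta> \<longrightarrow> g b < g a + e)"

definition LSC_wrt :: "('a \<Rightarrow> 'a \<Rightarrow> real) \<Rightarrow> 'a set \<Rightarrow> ('a \<Rightarrow> real) \<Rightarrow> bool" where
  "LSC_wrt d S g \<longleftrightarrow>
     (\<forall>a\<in>S. \<forall>e>0. \<exists>\<delta>>0. \<forall>b\<in>S. d a b < \<delta> \<longrightarrow> g b > g a - e)"


section \<open>Trajectories\<close>

text \<open>
  \<open>f\<close> is a version of \<open>f\<^sup>x\<close>, i.e.\ \<open>x\<close> solves the evolution equation on \<open>(t\<^sub>0,T)\<close> with right-hand
  side \<open>f\<close>. Being determined by \<open>x\<close> only up to null sets, \<open>f\<^sup>x\<close> is kept as a relation.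
\<close>

definition is_forcing ::
    "real \<Rightarrow> real \<Rightarrow> real \<Rightarrow> ('v::{banach,second_countable_topology} \<Rightarrow>\<^sub>L 'h::{real_inner,banach}) \<Rightarrow>
     (real \<Rightarrow> 'v \<Rightarrow> ('v \<Rightarrow>\<^sub>L real)) \<Rightarrow> real \<Rightarrow> (real \<Rightarrow> 'h) \<Rightarrow> (real \<Rightarrow> 'h) \<Rightarrow> bool" where
  "is_forcing T p q j A t\<^sub>0 x f \<longleftrightarrow>
     Lp_fun 2 {t\<^sub>0..T} f \<and>
     (\<exists>X X'. W_pq p q j t\<^sub>0 T X X' \<and>
        (AE t in lebesgue_on {t\<^sub>0..T}. x t = blinfun_apply j (X t)) \<and>
        (AE t in lebesgue_on {t\<^sub>0..T}. X' t + A t (X t) = to_dual j (f t)))"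

definition trajectories ::
    "real \<Rightarrow> real \<Rightarrow> real \<Rightarrow> ('v::{banach,second_countable_topology} \<Rightarrow>\<^sub>L 'h::{real_inner,banach}) \<Rightarrow>
     (real \<Rightarrow> 'v \<Rightarrow> ('v \<Rightarrow>\<^sub>L real)) \<Rightarrow> real \<Rightarrow> real \<Rightarrow> (real \<Rightarrow> 'h) \<Rightarrow> (real \<Rightarrow> 'h) set" where
  "trajectories T p q j A L t\<^sub>0 x\<^sub>0 =
     {x \<in> C_paths T. (\<forall>t\<in>{0..t\<^sub>0}. x t = x\<^sub>0 t) \<and>
        (\<exists>f. is_forcing T p q j A t\<^sub>0 x f \<and>
           (AE t in lebesgue_on {t\<^sub>0..T}. norm (f t) \<le> L * (1 + sup_upto t x)))}"

definition Omega ::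
    "real \<Rightarrow> real \<Rightarrow> real \<Rightarrow> ('v::{banach,second_countable_topology} \<Rightarrow>\<^sub>L 'h::{real_inner,banach}) \<Rightarrow>
     (real \<Rightarrow> 'v \<Rightarrow> ('v \<Rightarrow>\<^sub>L real)) \<Rightarrow> 'h \<Rightarrow> (real \<Rightarrow> 'h) set" where
  "Omega T p q j A xstar = (\<Union>L\<in>{0..}. trajectories T p q j A L 0 (const_path T xstar))"


section \<open>The Hamiltonian\<close>

definition modulus_of_continuity :: "(real \<Rightarrow> real) \<Rightarrow> bool" where
  "modulus_of_continuity m \<longleftrightarrow> m 0 = 0 \<and> mono_on {0..} m \<and> (m \<longlongrightarrow> 0) (at_right 0)"

definition admissible_Hamiltonian ::
    "real \<Rightarrow> real \<Rightarrow> real \<Rightarrow> ('v::{banach,second_countable_topology} \<Rightarrow>\<^sub>L 'h::{real_inner,banach}) \<Rightarrow>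
     (real \<Rightarrow> 'v \<Rightarrow> ('v \<Rightarrow>\<^sub>L real)) \<Rightarrow> (real \<Rightarrow> (real \<Rightarrow> 'h) \<Rightarrow> 'h \<Rightarrow> real) \<Rightarrow> bool" where
  "admissible_Hamiltonian T p q j A F \<longleftrightarrow>
     continuous_wrt (d_inf_H T) ({0..T} \<times> C_paths T \<times> UNIV) (\<lambda>(t, x, z). F t x z) \<and>
     (\<exists>L\<^sub>0\<ge>0. \<forall>t\<in>{0..T}. \<forall>x\<in>C_paths T. \<forall>z z'.
        \<bar>F t x z - F t x z'\<bar> \<le> L\<^sub>0 * (1 + sup_upto t x) * norm (z - z')) \<and>
     (\<forall>L\<ge>0. \<forall>t\<^sub>0\<in>{0..<T}. \<forall>x\<^sub>0\<in>C_paths T. \<exists>m. modulus_of_continuity m \<and>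
        (\<forall>\<epsilon>>0. \<forall>t\<in>{t\<^sub>0..T}. \<forall>x\<in>trajectories T p q j A L t\<^sub>0 x\<^sub>0. \<forall>y\<in>trajectories T p q j A L t\<^sub>0 x\<^sub>0.
           F t x ((1 / \<epsilon>) *\<^sub>R (x t - y t)) - F t y ((1 / \<epsilon>) *\<^sub>R (x t - y t))
           \<le> m ((1 / \<epsilon>) * (norm (x t - y t))\<^sup>2 + (SUP s\<in>{0..t}. norm (x s - y s)))))"


section \<open>Minimax semisolutions of the terminal-value problem\<close>

definition minimax_L_subsolution ::
    "real \<Rightarrow> real \<Rightarrow> real \<Rightarrow> ('v::{banach,second_countable_topology} \<Rightarrow>\<^sub>L 'h::{real_inner,banach}) \<Rightarrow>
     (real \<Rightarrow> 'v \<Rightarrow> ('v \<Rightarrow>\<^sub>L real)) \<Rightarrow> (real \<Rightarrow> (real \<Rightarrow> 'h) \<Rightarrow> 'h \<Rightarrow> real) \<Rightarrow> ((real \<Rightarrow> 'h) \<Rightarrow> real) \<Rightarrow>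
     (real \<Rightarrow> 'h) set \<Rightarrow> real \<Rightarrow> (real \<Rightarrow> (real \<Rightarrow> 'h) \<Rightarrow> real) \<Rightarrow> bool" where
  "minimax_L_subsolution T p q j A F h \<Omega>' L u \<longleftrightarrow>
     USC_wrt (d_inf T) ({0..T} \<times> \<Omega>') (\<lambda>(t, x). u t x) \<and>
     (\<forall>x\<in>\<Omega>'. u T x \<le> h x) \<and>
     (\<forall>t\<^sub>0\<in>{0..<T}. \<forall>x\<^sub>0\<in>\<Omega>'. \<forall>z.
        \<exists>x \<in> trajectories T p q j A L t\<^sub>0 x\<^sub>0 \<inter> \<Omega>'. \<exists>f. is_forcing T p q j A t\<^sub>0 x f \<and>
          (\<forall>t\<in>{t\<^sub>0..T}.
             u t\<^sub>0 x\<^sub>0 \<le> (LINT s:{t\<^sub>0..t}|lebesgue. (- f s) \<bullet> z + F s x z) + u t x))"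

definition minimax_L_supersolution ::
    "real \<Rightarrow> real \<Rightarrow> real \<Rightarrow> ('v::{banach,second_countable_topology} \<Rightarrow>\<^sub>L 'h::{real_inner,banach}) \<Rightarrow>
     (real \<Rightarrow> 'v \<Rightarrow> ('v \<Rightarrow>\<^sub>L real)) \<Rightarrow> (real \<Rightarrow> (real \<Rightarrow> 'h) \<Rightarrow> 'h \<Rightarrow> real) \<Rightarrow> ((real \<Rightarrow> 'h) \<Rightarrow> real) \<Rightarrow>
     (real \<Rightarrow> 'h) set \<Rightarrow> real \<Rightarrow> (real \<Rightarrow> (real \<Rightarrow> 'h) \<Rightarrow> real) \<Rightarrow> bool" where
  "minimax_L_supersolution T p q j A F h \<Omega>' L u \<longleftrightarrow>
     LSC_wrt (d_inf T) ({0..T} \<times> \<Omega>') (\<lambda>(t, x). u t x) \<and>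
     (\<forall>x\<in>\<Omega>'. u T x \<ge> h x) \<and>
     (\<forall>t\<^sub>0\<in>{0..<T}. \<forall>x\<^sub>0\<in>\<Omega>'. \<forall>z.
        \<exists>x \<in> trajectories T p q j A L t\<^sub>0 x\<^sub>0 \<inter> \<Omega>'. \<exists>f. is_forcing T p q j A t\<^sub>0 x f \<and>
          (\<forall>t\<in>{t\<^sub>0..T}.
             u t\<^sub>0 x\<^sub>0 \<ge> (LINT s:{t\<^sub>0..t}|lebesgue. (- f s) \<bullet> z + F s x z) + u t x))"

definition minimax_subsolution ::
    "real \<Rightarrow> real \<Rightarrow> real \<Rightarrow> ('v::{banach,second_countable_topology} \<Rightarrow>\<^sub>L 'h::{real_inner,banach}) \<Rightarrow>
     (real \<Rightarrow> 'v \<Rightarrow> ('v \<Rightarrow>\<^sub>L real)) \<Rightarrow> (real \<Rightarrow> (real \<Rightarrow> 'h) \<Rightarrow> 'h \<Rightarrow> real) \<Rightarrow> ((real \<Rightarrow> 'h) \<Rightarrow> real) \<Rightarrow>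
     (real \<Rightarrow> 'h) set \<Rightarrow> (real \<Rightarrow> (real \<Rightarrow> 'h) \<Rightarrow> real) \<Rightarrow> bool" where
  "minimax_subsolution T p q j A F h \<Omega>' u \<longleftrightarrow>
     (\<exists>L\<ge>0. minimax_L_subsolution T p q j A F h \<Omega>' L u)"

definition minimax_supersolution ::
    "real \<Rightarrow> real \<Rightarrow> real \<Rightarrow> ('v::{banach,second_countable_topology} \<Rightarrow>\<^sub>L 'h::{real_inner,banach}) \<Rightarrow>
     (real \<Rightarrow> 'v \<Rightarrow> ('v \<Rightarrow>\<^sub>L real)) \<Rightarrow> (real \<Rightarrow> (real \<Rightarrow> 'h) \<Rightarrow> 'h \<Rightarrow> real) \<Rightarrow> ((real \<Rightarrow> 'h) \<Rightarrow> real) \<Rightarrow>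
     (real \<Rightarrow> 'h) set \<Rightarrow> (real \<Rightarrow> (real \<Rightarrow> 'h) \<Rightarrow> real) \<Rightarrow> bool" where
  "minimax_supersolution T p q j A F h \<Omega>' u \<longleftrightarrow>
     (\<exists>L\<ge>0. minimax_L_supersolution T p q j A F h \<Omega>' L u)"

end

theory Submission
  imports Defs "HOL-Computational_Algebra.Polynomial" "HOL-Real_Asymp.Real_Asymp"
begin

text \<open>
  The comparison is proved by doubling variables along trajectories. Suppose that
  \<open>u(t\<^sub>0,x\<^sub>0) > v(t\<^sub>0,x\<^sub>0)\<close>, let \<open>K\<close> be the set of trajectories through \<open>(t\<^sub>0,x\<^sub>0)\<close> for a common growth
  constant, and consider on \<open>[t\<^sub>0,T] \<times> (K \<inter> \<Omega>')\<^sup>2\<close> the functional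
  \<open>u(t,x) - v(t,y) - (|x(t)-y(t)|\<^sup>2 + \<integral>\<^bsub>[t\<^sub>0,t]\<^esub> |x-y|\<^sup>2) / (2\<epsilon>) + \<kappa>(t-t\<^sub>0)\<close>.
  At a nearly maximal point \<open>(t\<^sub>1,x\<^sub>1,y\<^sub>1)\<close> the penalty is small for a suitable \<open>\<epsilon>\<close>; since the
  paths in \<open>K\<close> are equicontinuous and agree up to \<open>t\<^sub>0\<close>, the integral term makes \<open>x\<^sub>1\<close> and \<open>y\<^sub>1\<close>
  uniformly close on all of \<open>[0,t\<^sub>1]\<close>, which is what the modulus of continuity of the Hamiltonian
  asks for. Both semisolutions are then moved forward with the gradient
  \<open>z = (x\<^sub>1(t\<^sub>1)-y\<^sub>1(t\<^sub>1))/\<epsilon>\<close>. By monotonicity of \<open>A\<close>, the growth of \<open>|x-y|\<^sup>2/(2\<epsilon>)\<close> is at most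
  \<open>\<integral> (f\<^sup>x-f\<^sup>y, x-y)/\<epsilon>\<close>, and this cancels the terms \<open>(f\<^sup>x-f\<^sup>y, z)\<close> up to an error controlled by
  equicontinuity. Hence, without the term \<open>\<kappa>(t-t\<^sub>0)\<close>, the functional loses at most \<open>\<kappa>/2\<close> per unit
  of time. This contradicts near maximality when a whole step fits into \<open>[t\<^sub>1,T]\<close>, and the
  terminal inequalities together with the continuity of \<open>h\<close> when \<open>t\<^sub>1\<close> is close to \<open>T\<close> (lemmas
  \<open>doubling_step\<close> and \<open>comparison_at_initial\<close>).

  Only nearly maximal points are used because \<open>K \<inter> \<Omega>'\<close> need not be closed. What is
  needed about \<open>K\<close> is stability under concatenation (\<open>trajectories_concat\<close>) and total
  boundedness in the supremum norm (\<open>trajectories_totally_bounded\<close>). For the latter, the scalar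
  functions \<open>(x(\<cdot>), w)\<close>, \<open>w \<in> V\<close>, are equicontinuous, so by compactness of \<open>V \<subseteq> H\<close> the set \<open>K\<close> is
  totally bounded in \<open>L\<^sup>1(t\<^sub>0,T;H)\<close>, and the energy inequality for the difference of two
  trajectories, \<open>|x(t)-y(t)|\<^sup>2 \<le> 2 \<integral> (f\<^sup>x-f\<^sup>y, x-y)\<close>, upgrades this to uniform closeness.

  The energy inequality for \<open>x \<in> W\<^sub>p\<^sub>q\<close> (\<open>energy_inequality\<close>) comes from the pointwise estimate
  \<open>|x(r)|\<^sup>2 - |x(r-h)|\<^sup>2 \<le> 2 (x(r)-x(r-h), x(r))\<close>. After division by \<open>h\<close> and integration in \<open>r\<close>
  the left side tends to the increment of \<open>|x|\<^sup>2\<close>, and the right side is handled by Lebesgue's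
  differentiation theorem and a dominated convergence argument; no mollification of
  vector-valued functions is required.
\<close>

section \<open>Left differentiation of indefinite integrals\<close>

lemma absolutely_integrable_iff_integrable_lebesgue_on:
  fixes f :: "real \<Rightarrow> real"
  shows "f absolutely_integrable_on {a..b} \<longleftrightarrow> integrable (lebesgue_on {a..b}) f"
  by (simp add: integrable_restrict_space set_integrable_def)

text \<open>
  Lebesgue's differentiation theorem for left difference quotients. At the points where it fails
  there are arbitrarily short intervals on which Henstock's lemma is violated by a fixed
  proportion; a Vitali subfamily of these shows that the exceptional set is negligible.
\<close>
lemma left_Lebesgue_differentiation:
  fixes f :: "real \<Rightarrow> real"
  assumes f: "f integrable_on {a..b}"
  obtains N where "negligible N"
    "\<And>x. x \<in> {a<..b} - N \<Longrightarrow> ((\<lambda>h. integral {x-h..x} f / h) \<longlongrightarrow> f x) (at_right 0)"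
proof -
  define bad where "bad k x h \<longleftrightarrow> a < x \<and> x \<le> b \<and> 0 < h \<and> a \<le> x - h \<and>
      \<bar>h * f x - integral {x-h..x} f\<bar> > h / (real k + 1)" for k :: nat and x h
  define S where "S k = {x. \<forall>d>0. \<exists>h<d. bad k x h}" for k
  have neg: "negligible (S k)" for k
    unfolding negligible_outer_le
  proof (intro allI impI)
    fix e :: real assume e: "e > 0"
    \<comment> \<open>With this accuracy in Henstock's lemma, disjoint bad intervals have total length below \<open>e\<close>.\<close>
    have ek: "e / (real k + 1) > 0" using e by simp
    have fab: "f integrable_on cbox a b" using f by simp
    obtain \<gamma> where g: "gauge \<gamma>"
      and H: "\<And>p. \<lbrakk>p tagged_partial_division_of (cbox a b); \<gamma> fine p\<rbrakk> \<Longrightarrow>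
             sum (\<lambda>(x,k). norm(measure lborel k *\<^sub>R f x - integral k f)) p < e / (real k + 1)"
      by (rule Henstock_lemma[OF fab ek]) (rule that)
    define K where "K = {(x,h). bad k x h \<and> {x-h..x} \<subseteq> \<gamma> x}"
    define c where "c = (\<lambda>(x,h). x - h/2 :: real)"
    define r where "r = (\<lambda>(x::real,h). h/2 :: real)"
    have cb: "cball (c i) (r i) = {fst i - snd i..fst i}" for i
      by (cases i) (simp add: c_def r_def cball_eq_atLeastAtMost)
    obtain C where C: "countable C" "C \<subseteq> K"
      "pairwise (\<lambda>i j. disjnt (cball (c i) (r i)) (cball (c j) (r j))) C"
      "negligible (S k - (\<Union>i\<in>C. cball (c i) (r i)))"
    proof (rule Vitali_covering_theorem_cballs[of K r "S k" c])
      show "0 < r i" if "i \<in> K" for i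
        using that by (auto simp: K_def bad_def r_def)
      show "\<exists>i. i \<in> K \<and> x \<in> cball (c i) (r i) \<and> r i < d" if "x \<in> S k" "0 < d" for x d
      proof -
        have "open (\<gamma> x)" "x \<in> \<gamma> x" using g by (auto simp: gauge_def)
        then obtain d' where d': "d' > 0" "ball x d' \<subseteq> \<gamma> x" using openE by blast
        have "min d d' > 0" using d' \<open>0 < d\<close> by simp
        then obtain h where h: "h < min d d'" "bad k x h"
          using \<open>x \<in> S k\<close> unfolding S_def by blast
        have "{x-h..x} \<subseteq> \<gamma> x" using d' h by (auto simp: dist_real_def subset_iff)
        then have "(x,h) \<in> K" using h by (auto simp: K_def)
        moreover have "r (x,h) < d" using h by (auto simp: r_def bad_def)
        moreover have "x \<in> cball (c (x,h)) (r (x,h))" unfolding cb using h by (auto simp: bad_def)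
        ultimately show ?thesis by blast
      qed
    qed
    have fin: "measure lebesgue (\<Union>i\<in>F. cball (c i) (r i)) \<le> e" if F: "F \<subseteq> C" "finite F" for F
    proof -
      have K: "bad k (fst i) (snd i)" "{fst i - snd i..fst i} \<subseteq> \<gamma> (fst i)" if "i \<in> F" for i
      proof -
        have "(fst i, snd i) \<in> K" using that F C(2) by auto
        then show "bad k (fst i) (snd i)" "{fst i - snd i..fst i} \<subseteq> \<gamma> (fst i)"
          unfolding K_def by blast+
      qed
      have sub: "\<And>i. i \<in> F \<Longrightarrow> {fst i - snd i..fst i} \<subseteq> {a..b}"
      proof -
      fix i assume "i \<in> F"
      then have "fst i \<le> b" "a \<le> fst i - snd i" using K(1) by (auto simp: bad_def)
      then show "{fst i - snd i..fst i} \<subseteq> {a..b}" by auto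
    qed
      define g where "g = (\<lambda>i::real \<times> real. (fst i, cbox (fst i - snd i) (fst i)))"
      have disj: "{fst i - snd i..fst i} \<inter> {fst j - snd j..fst j} = {}"
        if "i \<in> F" "j \<in> F" "i \<noteq> j" for i j
        using C(3) F(1) that unfolding pairwise_def disjnt_def cb by blast
      have inj: "inj_on g F"
      proof (rule inj_onI, rule ccontr)
        fix i j assume ij: "i \<in> F" "j \<in> F" "g i = g j" "i \<noteq> j"
        have "fst i \<in> {fst i - snd i..fst i}" using K(1)[OF ij(1)] by (auto simp: bad_def)
        moreover have "{fst i - snd i..fst i} = {fst j - snd j..fst j}" using ij(3)
            by (metis box_real(2) g_def prod.inject)
        ultimately show False using disj[OF ij(1,2,4)] by auto
      qed
      have tag: "g ` F tagged_partial_division_of (cbox a b)"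
        unfolding tagged_partial_division_of_def
      proof (intro conjI allI impI)
        show "finite (g ` F)" using F by simp
        fix x k assume "(x,k) \<in> g ` F"
        then obtain i where i: "i \<in> F" "(x,k) = g i" by auto
        show "x \<in> k" using i K(1)[of i] by (auto simp: g_def bad_def)
        show "k \<subseteq> cbox a b" using i sub[of i] by (auto simp: g_def)
        show "\<exists>a b. k = cbox a b" using i by (auto simp: g_def)
      next
        fix x1 K1 x2 K2 
        assume h: "(x1, K1) \<in> g ` F \<and> (x2, K2) \<in> g ` F \<and> (x1, K1) \<noteq> (x2, K2)"
        then obtain i j where ij: "i \<in> F" "(x1, K1) = g i" "j \<in> F" "(x2, K2) = g j" by auto
        then have "i \<noteq> j" using h by auto
        then have "K1 \<inter> K2 = {}" using disj[of i j] ij by (auto simp: g_def)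
        then show "interior K1 \<inter> interior K2 = {}" using interior_subset by blast
      qed
      have fine: "\<gamma> fine g ` F" using K(2) by (auto simp: fine_def g_def)
      have "(\<Sum>i\<in>F. snd i / (real k + 1)) \<le> (\<Sum>i\<in>F. norm (measure lborel (cbox (fst i - snd i) (fst i)) *\<^sub>R f (fst i)
          - integral (cbox (fst i - snd i) (fst i)) f))"
      proof (rule sum_mono)
        fix i assume "i \<in> F"
        from K(1)[OF this] show "snd i / (real k + 1) \<le> norm (measure lborel (cbox (fst i - snd i) (fst i)) *\<^sub>R f
            (fst i) - integral (cbox (fst i - snd i) (fst i)) f)"
          by (auto simp: bad_def content_real)
      qed
      also have "\<dots> = sum (\<lambda>(x,k). norm(measure lborel k *\<^sub>R f x - integral k f)) (g ` F)"
        by (subst sum.reindex[OF inj]) (simp add: g_def)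
      also have "\<dots> < e / (real k + 1)" using H[OF tag fine] .
      finally have "(\<Sum>i\<in>F. snd i) < e" by (simp add: sum_divide_distrib[symmetric] divide_less_cancel)
      moreover have "measure lebesgue (\<Union>i\<in>F. cball (c i) (r i)) \<le> (\<Sum>i\<in>F. measure lebesgue (cball (c i) (r i)))"
        by (rule measure_UNION_le) (use F in auto)
      moreover have "(\<Sum>i\<in>F. measure lebesgue (cball (c i) (r i))) = (\<Sum>i\<in>F. snd i)"
        unfolding cb using K(1) by (intro sum.cong) (simp_all add: bad_def less_imp_le)
      ultimately show ?thesis by linarith
    qed
    define U where "U = (\<Union>i\<in>C. cball (c i) (r i))"
    have U: "U \<in> lmeasurable" "measure lebesgue U \<le> e"
      unfolding U_def
       by (rule fmeasurable_UN_bound[OF C(1) _ fin]; simp) (rule measure_UN_bound[OF C(1) _ fin]; simp)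
    define R where "R = S k - U"
    have R: "negligible R" using C(4) by (simp add: R_def U_def)
    show "\<exists>V. S k \<subseteq> V \<and> V \<in> lmeasurable \<and> measure lebesgue V \<le> e"
    proof (intro exI conjI)
      show "S k \<subseteq> U \<union> R" by (auto simp: R_def)
      show "U \<union> R \<in> lmeasurable" using U R by (simp add: fmeasurable.Un negligible_imp_measurable)
      have "measure lebesgue (U \<union> R) \<le> measure lebesgue U + measure lebesgue R"
        using U R by (intro measure_Un_le) (auto simp: negligible_imp_sets)
      then show "measure lebesgue (U \<union> R) \<le> e" using U R by (simp add: negligible_imp_measure0)
    qed
  qed
  show thesis
  proof (rule that[of "\<Union>k. S k"])
    show "negligible (\<Union>k. S k)" using neg by (rule negligible_Union_nat)
    fix x assume x: "x \<in> {a<..b} - (\<Union>k. S k)"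
    show "((\<lambda>h. integral {x-h..x} f / h) \<longlongrightarrow> f x) (at_right 0)"
    proof (rule tendstoI)
      fix e :: real assume "e > 0"
      then obtain k where k: "inverse (real (Suc k)) < e" using reals_Archimedean by blast
      have "x \<notin> S k" using x by auto
      then obtain d where d: "d > 0" "\<And>h. h < d \<Longrightarrow> \<not> bad k x h" by (auto simp: S_def)
      have "dist (integral {x-h..x} f / h) (f x) < e" if h: "h > 0" "h < min d (x - a)" for h
      proof -
        have "\<not> bad k x h" using d h by auto
        then have "\<bar>h * f x - integral {x-h..x} f\<bar> \<le> h / (real k + 1)" using h x by (auto simp: bad_def)
        then have "\<bar>h * f x - integral {x-h..x} f\<bar> / h \<le> inverse (real (Suc k))"
          using h by (simp add: field_simps)
        also have "\<bar>h * f x - integral {x-h..x} f\<bar> / h = \<bar>f x - integral {x-h..x} f / h\<bar>"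
          using h by (simp add: abs_div_pos diff_divide_distrib)
        finally show ?thesis using k by (simp add: dist_real_def)
      qed
      then show "\<forall>\<^sub>F h in at_right 0. dist (integral {x-h..x} f / h) (f x) < e"
        using d x by (auto simp: eventually_at_right_field intro!: exI[of _ "min d (x - a)"])
    qed
  qed
qed

lemma negligible_imp_AE_lebesgue_on:
  fixes N :: "real set"
  assumes "negligible N"
  shows "AE r in lebesgue_on {a..b}. r \<notin> N"
proof -
  have "AE r in lebesgue. r \<notin> N"
    using assms by (simp add: negligible_iff_null_sets AE_not_in)
  then show ?thesis by (simp add: AE_restrict_space_iff) (erule eventually_mono, simp)
qed

lemma AE_lebesgue_on_greater: "AE r in lebesgue_on {a..b}. r > (a::real)"
  using negligible_imp_AE_lebesgue_on[of "{a}" a b, OF negligible_sing] AE_space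
  by eventually_elim (auto simp: space_restrict_space)

lemma integral_difference_quotient_tendsto:
  fixes W :: "real \<Rightarrow> real"
  assumes ab: "a < b" and W: "continuous_on {a..b} W"
  shows "((\<lambda>h. integral {a+h..b} (\<lambda>r. (W r - W (r-h)) / h)) \<longlongrightarrow> W b - W a) (at_right 0)"
proof -
  define G where "G x = integral {a..x} W" for x
  have G: "(G has_real_derivative W x) (at x within {a..b})" if "x \<in> {a..b}" for x
    using integral_has_real_derivative[OF W that] by (simp add: G_def[abs_def])
  have "filterlim (\<lambda>h. b - h) (at b within {a..b}) (at_right 0)"
    unfolding filterlim_at
  proof
    show "((-) b \<longlongrightarrow> b) (at_right 0)" by (auto intro!: tendsto_eq_intros)
    show "\<forall>\<^sub>F h in at_right 0. b - h \<in> {a..b} \<and> b - h \<noteq> b"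
      using ab by (auto simp: eventually_at_right_field intro!: exI[of _ "b - a"])
  qed
  from filterlim_compose[OF G[of b, unfolded has_field_derivative_iff] this]
  have 1: "((\<lambda>h. (G (b-h) - G b) / (b - h - b)) \<longlongrightarrow> W b) (at_right 0)" using ab by simp
  have "filterlim (\<lambda>h. a + h) (at a within {a..b}) (at_right 0)"
    unfolding filterlim_at
  proof
    show "((+) a \<longlongrightarrow> a) (at_right 0)" by (auto intro!: tendsto_eq_intros)
    show "\<forall>\<^sub>F h in at_right 0. a + h \<in> {a..b} \<and> a + h \<noteq> a"
      using ab by (auto simp: eventually_at_right_field intro!: exI[of _ "b - a"])
  qed
  from filterlim_compose[OF G[of a, unfolded has_field_derivative_iff] this]
  have 2: "((\<lambda>h. (G (a+h) - G a) / (a + h - a)) \<longlongrightarrow> W a) (at_right 0)" using ab by simp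
  from tendsto_diff[OF 1 2]
  have lim: "((\<lambda>h. (G (b-h) - G b) / (b - h - b) - (G (a+h) - G a) / (a + h - a)) \<longlongrightarrow> W b - W a) (at_right 0)" .
  have eq: "(G (b-h) - G b) / (b - h - b) - (G (a+h) - G a) / (a + h - a)
      = integral {a+h..b} (\<lambda>r. (W r - W (r-h)) / h)" if h: "0 < h" "h < b - a" for h
  proof -
    have i: "W integrable_on {c..d}" if "{c..d} \<subseteq> {a..b}" for c d
      using W that by (intro integrable_continuous_interval) (rule continuous_on_subset)
    have c2: "continuous_on {a+h..b} (\<lambda>r. W (r-h))"
      using h by (intro continuous_on_compose2[OF W] continuous_intros) auto
    have "integral {a+h..b} (\<lambda>r. (W r - W (r-h)) / h) = (integral {a+h..b} W - integral {a+h..b} (\<lambda>r. W (r-h))) / h"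
      using Henstock_Kurzweil_Integration.integral_diff[OF i[of "a+h" b] integrable_continuous_interval[OF c2]] h
          by simp
    also have "integral {a+h..b} W = G b - G (a+h)"
      unfolding G_def using Henstock_Kurzweil_Integration.integral_combine[of a "a+h" b W] h i[of a b] by simp
    also have "integral {a+h..b} (\<lambda>r. W (r-h)) = G (b-h)"
      unfolding G_def using integral_shift_Icc_real[where a = a and b = "b-h" and c = h and f = "\<lambda>r. W (r-h)"]
      by (simp add: o_def add.commute)
    finally have "integral {a+h..b} (\<lambda>r. (W r - W (r-h)) / h) = (G b - G (a+h) - G (b-h)) / h" .
    moreover have "G a = 0" by (simp add: G_def)
    moreover have "(G (b-h) - G b) / (b - h - b) = (G b - G (b-h)) / h"
      using h by (simp add: field_simps)
    ultimately show ?thesis by (simp add: diff_divide_distrib)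
  qed
  show ?thesis
  proof (rule Lim_transform_eventually[OF lim])
    show "\<forall>\<^sub>F h in at_right 0. (G (b-h) - G b) / (b - h - b) - (G (a+h) - G a) / (a + h - a)
      = integral {a+h..b} (\<lambda>r. (W r - W (r-h)) / h)"
      by (rule eventually_at_rightI[of 0 "b - a"], rule eq) (use ab in auto)
  qed
qed

text \<open>
  A one-sided fundamental theorem of calculus: if the left difference quotients of \<open>W\<close> lie below
  \<open>Q\<close>, \<open>Q h\<close> converges to \<open>w\<close> almost everywhere, and \<open>Q h\<close> is dominated by the mean of an integrable
  \<open>\<mu>\<close> over \<open>[r-h,r]\<close> plus an integrable \<open>k\<close>, then the increment of \<open>W\<close> is at most the integral of
  \<open>w\<close>. The dominating functions depend on \<open>h\<close>, but they converge in \<open>L\<^sup>1\<close> by Scheffe's lemma.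
\<close>
lemma increment_le_integral_left_derivative:
  fixes W w \<mu> k :: "real \<Rightarrow> real" and Q :: "real \<Rightarrow> real \<Rightarrow> real"
  assumes ab: "a < b" and W: "continuous_on {a..b} W"
    and mu: "\<mu> absolutely_integrable_on {a..b}" "\<And>r. \<mu> r \<ge> 0"
    and k: "k absolutely_integrable_on {a..b}" "\<And>r. k r \<ge> 0"
    and Qc: "\<And>h. h > 0 \<Longrightarrow> continuous_on {a+h..b} (Q h)"
    and WQ: "\<And>r h. h > 0 \<Longrightarrow> a \<le> r - h \<Longrightarrow> r \<le> b \<Longrightarrow> W r - W (r-h) \<le> h * Q h r"
    and Qb: "AE r in lebesgue_on {a..b}. \<forall>h>0. a \<le> r - h \<longrightarrow> \<bar>Q h r\<bar> \<le> integral {r-h..r} \<mu> / h + k r"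
    and Qw: "AE r in lebesgue_on {a..b}. r > a \<longrightarrow> ((\<lambda>h. Q h r) \<longlongrightarrow> w r) (at_right 0)"
  shows "w absolutely_integrable_on {a..b}" "W b - W a \<le> integral {a..b} w"
proof -
  let ?M = "lebesgue_on {a..b}"
  define h where "h n = (b - a) / (real n + 2)" for n
  have h: "h n > 0" "h n < b - a" for n
  proof -
    show "h n > 0" using ab by (simp add: h_def)
    have "(b - a) * 1 < (b - a) * (real n + 2)" using ab by (intro mult_strict_left_mono) auto
    then show "h n < b - a" by (simp add: h_def divide_less_eq)
  qed
  have h0: "h \<longlonglongrightarrow> 0" unfolding h_def by real_asymp
  have hr: "filterlim h (at_right 0) sequentially"
    using h0 h(1) unfolding filterlim_at by (auto simp: less_imp_neq[symmetric] intro!: always_eventually)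
  define m where "m r = integral {a..r} \<mu>" for r
  have mui: "\<mu> integrable_on {a..b}" using mu set_lebesgue_integral_eq_integral(1) by blast
  have m: "continuous_on {a..b} m" unfolding m_def by (rule indefinite_integral_continuous_1[OF mui])
  have mi: "integral {r-d..r} \<mu> = m r - m (r-d)" if "a \<le> r - d" "r \<le> b" "d > 0" for r d
    unfolding m_def
    using Henstock_Kurzweil_Integration.integral_combine[of a "r-d" r \<mu>] that integrable_on_subinterval[OF mui, of a
        r] by simp
  define f where "f n r = (if a + h n \<le> r then Q (h n) r else 0)" for n r
  define E where "E n r = (if a + h n \<le> r then (m r - m (r - h n)) / h n else 0)" for n r
  define D where "D n r = E n r + k r" for n r
  have cut: "(\<lambda>r. if a + h n \<le> r then g r else 0) absolutely_integrable_on {a..b}"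
       "integral {a..b} (\<lambda>r. if a + h n \<le> r then g r else 0) = integral {a + h n..b} g"
      if g: "continuous_on {a + h n..b} g" for n and g :: "real \<Rightarrow> real"
  proof -
    have eq: "(\<lambda>r. if r \<in> {a..b} then if a + h n \<le> r then g r else 0 else 0)
        = (\<lambda>r. if r \<in> {a + h n..b} then g r else 0)"
      using h[of n] by (auto simp: fun_eq_iff)
    have "g absolutely_integrable_on {a + h n..b}" using g by (rule absolutely_integrable_continuous_real)
    then have "(\<lambda>r. if r \<in> {a..b} then if a + h n \<le> r then g r else 0 else 0) absolutely_integrable_on UNIV"
      unfolding eq by (simp only: absolutely_integrable_restrict_UNIV)
    then show "(\<lambda>r. if a + h n \<le> r then g r else 0) absolutely_integrable_on {a..b}"
      by (simp only: absolutely_integrable_restrict_UNIV)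
    show "integral {a..b} (\<lambda>r. if a + h n \<le> r then g r else 0) = integral {a + h n..b} g"
      using integral_restrict_UNIV[of "{a..b}" "\<lambda>r. if a + h n \<le> r then g r else 0"]
        integral_restrict_UNIV[of "{a + h n..b}" g] by (simp only: eq)
  qed
  have cm: "continuous_on {a + d..b} (\<lambda>r. (g r - g (r - d)) / d)"
    if "d > 0" "continuous_on {a..b} g" for d and g :: "real \<Rightarrow> real"
    using that(1) by (intro continuous_intros continuous_on_compose2[OF that(2)]) auto
  have fi: "f n absolutely_integrable_on {a..b}" for n
    unfolding f_def[abs_def] by (intro cut Qc h)
  have Ei: "E n absolutely_integrable_on {a..b}" for n
    unfolding E_def[abs_def] by (intro cut cm h m)
  have Di: "D n absolutely_integrable_on {a..b}" for n
    unfolding D_def[abs_def] using Ei k by (intro set_integral_add(1)) auto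
  define D' where "D' r = \<mu> r + k r" for r
  have D'i: "D' absolutely_integrable_on {a..b}"
    unfolding D'_def[abs_def] using mu k by (intro set_integral_add(1)) auto
  note bo = absolutely_integrable_iff_integrable_lebesgue_on
  have int_eq: "integral\<^sup>L ?M g = integral {a..b} g" if "g absolutely_integrable_on {a..b}" for g :: "real \<Rightarrow> real"
    using that by (simp add: bo lebesgue_integral_eq_integral)
  have E0: "E n r \<ge> 0" if "r \<le> b" for n r
  proof (cases "a + h n \<le> r")
    case True
    then have "m r - m (r - h n) = integral {r - h n..r} \<mu>" using mi[of r "h n"] h that by simp
    also have "\<dots> \<ge> 0" using mu by (intro integral_nonneg integrable_on_subinterval[OF mui]) (use True h[of n] that
        in auto)
    finally show ?thesis using h[of n] True by (simp add: E_def)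
  qed (simp add: E_def)
  obtain N where N: "negligible N"
    "\<And>x. x \<in> {a<..b} - N \<Longrightarrow> ((\<lambda>h. integral {x-h..x} \<mu> / h) \<longlongrightarrow> \<mu> x) (at_right 0)"
    using left_Lebesgue_differentiation[OF mui] by blast
  have AE_N: "AE r in ?M. r > a \<longrightarrow> ((\<lambda>h. integral {r-h..r} \<mu> / h) \<longlongrightarrow> \<mu> r) (at_right 0)"
    using negligible_imp_AE_lebesgue_on[OF N(1), of a b] AE_space
    by eventually_elim (use N(2) in \<open>auto simp: space_restrict_space\<close>)
  note AE_a = AE_lebesgue_on_greater[of a b]
  have ev: "\<forall>\<^sub>F n in sequentially. a + h n \<le> r" if "r > a" for r
  proof -
    have "\<forall>\<^sub>F n in sequentially. h n < r - a" using h0 that by (auto simp: order_tendsto_iff)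
    then show ?thesis by eventually_elim simp
  qed
  have Elim: "AE r in ?M. (\<lambda>n. E n r) \<longlonglongrightarrow> \<mu> r"
    using AE_N AE_a AE_space
  proof eventually_elim
    case (elim r)
    have r: "a < r" "r \<le> b" using elim by (auto simp: space_restrict_space)
    have "(\<lambda>n. integral {r - h n..r} \<mu> / h n) \<longlonglongrightarrow> \<mu> r"
      using elim r by (intro filterlim_compose[OF _ hr]) auto
    then show ?case
    proof (rule Lim_transform_eventually)
      show "\<forall>\<^sub>F n in sequentially. integral {r - h n..r} \<mu> / h n = E n r"
        using ev[OF r(1)] by eventually_elim (use r h in \<open>auto simp: E_def mi\<close>)
    qed
  qed
  have Dlim: "AE r in ?M. (\<lambda>n. D n r) \<longlonglongrightarrow> D' r"
    using Elim by eventually_elim (auto simp: D_def D'_def intro!: tendsto_intros)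
  have flim: "AE r in ?M. (\<lambda>n. f n r) \<longlonglongrightarrow> w r"
    using Qw AE_a AE_space
  proof eventually_elim
    case (elim r)
    have "(\<lambda>n. Q (h n) r) \<longlonglongrightarrow> w r" using elim by (intro filterlim_compose[OF _ hr]) auto
    then show ?case
    proof (rule Lim_transform_eventually)
      show "\<forall>\<^sub>F n in sequentially. Q (h n) r = f n r"
        using ev[OF elim(2)] by eventually_elim (auto simp: f_def)
    qed
  qed
  have fD: "AE r in ?M. \<forall>n. \<bar>f n r\<bar> \<le> D n r"
    using Qb AE_space
  proof eventually_elim
    case (elim r)
    show ?case
    proof
      fix n
      show "\<bar>f n r\<bar> \<le> D n r"
      proof (cases "a + h n \<le> r")
        case True
        then have "\<bar>f n r\<bar> \<le> integral {r-h n..r} \<mu> / h n + k r" using elim(1) h[of n] by (simp add: f_def)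
        also have "\<dots> = D n r" using True mi[of r "h n"] h[of n] elim(2) by (simp add: D_def E_def)
        finally show ?thesis .
      qed (simp add: f_def D_def E_def k)
    qed
  qed
  have wD: "AE r in ?M. \<bar>w r\<bar> \<le> D' r"
    using fD flim Dlim
  proof eventually_elim
    case (elim r)
    show ?case by (rule LIMSEQ_le[OF tendsto_rabs[OF elim(2)] elim(3)]) (use elim(1) in auto)
  qed
  have "(\<lambda>n. integral {a..b} (E n)) \<longlonglongrightarrow> m b - m a"
  proof -
    have "integral {a..b} (E n) = integral {a + h n..b} (\<lambda>r. (m r - m (r - h n)) / h n)" for n
      unfolding E_def[abs_def] by (intro cut cm h m)
    then show ?thesis
      using filterlim_compose[OF integral_difference_quotient_tendsto[OF ab m] hr] by simp
  qed
  moreover have "m b - m a = integral {a..b} \<mu>" by (simp add: m_def)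
  ultimately have Eint: "(\<lambda>n. integral {a..b} (E n)) \<longlonglongrightarrow> integral {a..b} \<mu>" by simp
  have "(\<lambda>n. \<integral>\<^sup>+r. norm (E n r - \<mu> r) \<partial>?M) \<longlonglongrightarrow> 0"
  proof (rule Scheffe_lemma1)
    show "integrable ?M (E n)" for n using Ei by (simp add: bo)
    show mui': "integrable ?M \<mu>" using mu by (simp add: bo)
    show "AE r in ?M. (\<lambda>n. E n r) \<longlonglongrightarrow> \<mu> r" by (rule Elim)
    have "(\<integral>\<^sup>+r. norm (E n r) \<partial>?M) = ennreal (integral {a..b} (E n))" for n
    proof -
      have "(\<integral>\<^sup>+r. norm (E n r) \<partial>?M) = (\<integral>\<^sup>+r. E n r \<partial>?M)"
        by (intro nn_integral_cong) (use E0 in \<open>auto simp: space_restrict_space\<close>)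
      also have "\<dots> = ennreal (integral\<^sup>L ?M (E n))"
        using Ei E0 by (intro nn_integral_eq_integral AE_I2) (auto simp: bo space_restrict_space)
      finally show ?thesis using int_eq[OF Ei] by simp
    qed
    moreover have "(\<integral>\<^sup>+r. norm (\<mu> r) \<partial>?M) = ennreal (integral {a..b} \<mu>)"
    proof -
      have "(\<integral>\<^sup>+r. norm (\<mu> r) \<partial>?M) = (\<integral>\<^sup>+r. \<mu> r \<partial>?M)"
        by (intro nn_integral_cong) (use mu in auto)
      also have "\<dots> = ennreal (integral\<^sup>L ?M \<mu>)"
        using mui' mu by (intro nn_integral_eq_integral) auto
      finally show ?thesis using int_eq[OF mu(1)] by simp
    qed
    moreover have "(\<lambda>n. ennreal (integral {a..b} (E n))) \<longlonglongrightarrow> ennreal (integral {a..b} \<mu>)"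
      using Eint by (rule tendsto_ennrealI)
    ultimately show "limsup (\<lambda>n. \<integral>\<^sup>+r. norm (E n r) \<partial>?M) \<le> (\<integral>\<^sup>+r. norm (\<mu> r) \<partial>?M)"
      by (simp add: lim_imp_Limsup)
  qed
  moreover have "(\<integral>\<^sup>+r. norm (E n r - \<mu> r) \<partial>?M) = ennreal (integral {a..b} (\<lambda>r. \<bar>E n r - \<mu> r\<bar>))" for n
  proof -
    have i: "(\<lambda>r. \<bar>E n r - \<mu> r\<bar>) absolutely_integrable_on {a..b}"
      using Ei[of n] mu by (simp add: bo)
    have "(\<integral>\<^sup>+r. norm (E n r - \<mu> r) \<partial>?M) = ennreal (integral\<^sup>L ?M (\<lambda>r. \<bar>E n r - \<mu> r\<bar>))"
      using i by (subst nn_integral_eq_integral[symmetric]) (auto simp: bo)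
    then show ?thesis using int_eq[OF i] by simp
  qed
  ultimately have "(\<lambda>n. ennreal (integral {a..b} (\<lambda>r. \<bar>E n r - \<mu> r\<bar>))) \<longlonglongrightarrow> ennreal 0" by simp
  then have L1: "(\<lambda>n. integral {a..b} (\<lambda>r. \<bar>E n r - \<mu> r\<bar>)) \<longlonglongrightarrow> 0"
  proof (subst (asm) tendsto_ennreal_iff)
    show "\<forall>\<^sub>F n in sequentially. 0 \<le> integral {a..b} (\<lambda>r. \<bar>E n r - \<mu> r\<bar>)"
      using Ei mu by (intro always_eventually allI integral_nonneg set_lebesgue_integral_eq_integral(1)) (auto simp:
          bo)
  qed auto
  \<comment> \<open>Truncation at the limit of the dominating functions makes dominated convergence applicable; the
    truncation error is at most \<open>|E n - \<mu>|\<close>, which tends to \<open>0\<close> in \<open>L\<^sup>1\<close>.\<close>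
  define C where "C n r = max (- D' r) (min (f n r) (D' r))" for n r
  have Cm: "C n \<in> borel_measurable ?M" for n
    using fi[of n] D'i unfolding bo C_def[abs_def] by (intro borel_measurable_max borel_measurable_min) auto
  have CD: "\<bar>C n r\<bar> \<le> D' r" for n r using mu(2)[of r] k(2)[of r] by (auto simp: C_def D'_def)
  have Ci: "C n absolutely_integrable_on {a..b}" for n
    unfolding bo
    by (rule Bochner_Integration.integrable_bound[OF D'i[unfolded bo] Cm]) (use order_trans[OF CD abs_ge_self] in
        auto)
  have Clim: "AE r in ?M. (\<lambda>n. C n r) \<longlonglongrightarrow> w r"
    using flim wD
  proof eventually_elim
    case (elim r)
    have "(\<lambda>n. C n r) \<longlonglongrightarrow> max (- D' r) (min (w r) (D' r))"
      unfolding C_def by (intro tendsto_intros elim)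
    then show ?case using elim(2) by (simp add: min_def max_def abs_le_iff split: if_splits)
  qed
  have wm: "w \<in> borel_measurable ?M"
  proof -
    define g where "g r = (if r \<in> {a..b} then lim (\<lambda>n. C n r) else 0)" for r
    have "(\<lambda>r. lim (\<lambda>n. C n r)) \<in> borel_measurable ?M" using Cm by measurable
    then have "g \<in> borel_measurable lebesgue"
      unfolding g_def by (subst borel_measurable_if) auto
    moreover have "AE r in lebesgue. g r = (if r \<in> {a..b} then w r else 0)"
      using Clim unfolding AE_restrict_space_iff[of "{a..b}" lebesgue, simplified]
      by (rule AE_mp) (auto simp: g_def limI intro!: AE_I2)
    ultimately have "(\<lambda>r. if r \<in> {a..b} then w r else 0) \<in> borel_measurable lebesgue"
      by (rule borel_measurable_AE)
    then show ?thesis by (subst (asm) borel_measurable_if) auto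
  qed
  show wi: "w absolutely_integrable_on {a..b}"
    unfolding bo
  proof (rule Bochner_Integration.integrable_bound[OF D'i[unfolded bo] wm])
    show "AE r in ?M. norm (w r) \<le> norm (D' r)" using wD by eventually_elim auto
  qed
  have "(\<lambda>n. integral\<^sup>L ?M (C n)) \<longlonglongrightarrow> integral\<^sup>L ?M w"
    by (rule integral_dominated_convergence[OF wm Cm D'i[unfolded bo] Clim]) (use CD in auto)
  then have Cint: "(\<lambda>n. integral {a..b} (C n)) \<longlonglongrightarrow> integral {a..b} w"
    using int_eq[OF Ci] int_eq[OF wi] by simp
  have le: "integral {a + h n..b} (\<lambda>r. (W r - W (r - h n)) / h n) 
      \<le> integral {a..b} (C n) + integral {a..b} (\<lambda>r. \<bar>E n r - \<mu> r\<bar>)" for n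
  proof -
    have "integral {a + h n..b} (\<lambda>r. (W r - W (r - h n)) / h n) \<le> integral {a + h n..b} (Q (h n))"
      using h[of n] by (intro integral_le integrable_continuous_interval cm W Qc) (auto simp: field_simps intro!:
          WQ[simplified algebra_simps])
    also have "\<dots> = integral {a..b} (f n)"
      unfolding f_def[abs_def] by (intro cut(2)[symmetric] Qc h)
    also have "\<dots> = integral\<^sup>L ?M (f n)" using int_eq[OF fi] by simp
    also have "\<dots> \<le> integral\<^sup>L ?M (\<lambda>r. C n r + \<bar>E n r - \<mu> r\<bar>)"
    proof (rule integral_mono_AE)
      show "integrable ?M (f n)" using fi by (simp add: bo)
      show "integrable ?M (\<lambda>r. C n r + \<bar>E n r - \<mu> r\<bar>)" using Ci Ei mu by (simp add: bo)
      show "AE r in ?M. f n r \<le> C n r + \<bar>E n r - \<mu> r\<bar>"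
        using fD
      proof eventually_elim
        case (elim r)
        then have "\<bar>f n r\<bar> \<le> D n r" by blast
        then show ?case by (auto simp: C_def D_def D'_def max_def min_def)
      qed
    qed
    also have "\<dots> = integral\<^sup>L ?M (C n) + integral\<^sup>L ?M (\<lambda>r. \<bar>E n r - \<mu> r\<bar>)"
      using Ci Ei mu by (intro Bochner_Integration.integral_add) (auto simp: bo)
    also have "\<dots> = integral {a..b} (C n) + integral {a..b} (\<lambda>r. \<bar>E n r - \<mu> r\<bar>)"
      using int_eq[OF Ci[of n]] int_eq[of "\<lambda>r. \<bar>E n r - \<mu> r\<bar>"] Ei[of n] mu by (simp add: bo)
    finally show ?thesis .
  qed
  show "W b - W a \<le> integral {a..b} w"
  proof (rule LIMSEQ_le)
    show "(\<lambda>n. integral {a + h n..b} (\<lambda>r. (W r - W (r - h n)) / h n)) \<longlonglongrightarrow> W b - W a"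
      using filterlim_compose[OF integral_difference_quotient_tendsto[OF ab W] hr] .
    show "(\<lambda>n. integral {a..b} (C n) + integral {a..b} (\<lambda>r. \<bar>E n r - \<mu> r\<bar>)) \<longlonglongrightarrow> integral {a..b} w"
      using tendsto_add[OF Cint L1] by simp
  qed (use le in auto)
qed

section \<open>Smooth test functions and weak derivatives\<close>

text \<open>
  The functions \<open>P(r) s\<^sup>k exp(-s)\<close> with \<open>s = 1/(r(1-r))\<close> on \<open>(0,1)\<close>, extended by \<open>0\<close>. They are closed
  under differentiation, which makes \<open>flat 1 0\<close> a bump function.
\<close>
definition flat :: "real poly \<Rightarrow> nat \<Rightarrow> real \<Rightarrow> real" where
  "flat P k r = (if 0 < r \<and> r < 1
     then poly P r * (1 / (r * (1 - r))) ^ k * exp (- (1 / (r * (1 - r)))) else 0)"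

text \<open>
  A function that is quadratically small near a zero has derivative \<open>0\<close> there, so this estimate gives
  the derivative at the end points \<open>0\<close> and \<open>1\<close>.
\<close>
lemma flat_le_quadratic:
  "\<exists>M. \<forall>r. 0 < r \<longrightarrow> r < 1 \<longrightarrow> \<bar>flat P k r\<bar> \<le> M * (r * (1 - r))^2"
proof -
  have "compact (poly P ` {0..1})"
    by (intro compact_continuous_image continuous_intros) auto
  then have "bounded (poly P ` {0..1})" by (rule compact_imp_bounded)
  then obtain B where B: "\<forall>r\<in>{0..1}. \<bar>poly P r\<bar> \<le> B"
    by (auto simp: bounded_iff)
  have "\<bar>flat P k r\<bar> \<le> (B * real (k+2) ^ (k+2)) * (r * (1 - r))^2" if r: "0 < r" "r < 1" for r
  proof -
    define w where "w = r * (1 - r)"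
    have w: "w > 0" using r by (simp add: w_def)
    define N where "N = k + 2"
    have N: "real N > 0" by (simp add: N_def)
    have "(1 / (real N * w)) ^ N \<le> (exp (1 / (real N * w))) ^ N"
      using exp_ge_add_one_self[of "1 / (real N * w)"] w N
      by (intro power_mono) (auto simp del: exp_ge_add_one_self)
    also have "\<dots> = exp (real N * (1 / (real N * w)))" by (rule exp_of_nat_mult[symmetric])
    also have "real N * (1 / (real N * w)) = 1 / w" using N by simp
    finally have "inverse (real N * w) ^ N \<le> exp (1/w)" by (simp add: inverse_eq_divide)
    then have "inverse (exp (1/w)) \<le> inverse (inverse (real N * w) ^ N)"
      using N w by (intro le_imp_inverse_le) auto
    then have "exp (- (1/w)) \<le> (real (k+2) * w) ^ (k+2)"
      by (simp only: exp_minus power_inverse inverse_inverse_eq N_def)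
    then have le1: "(1 / w) ^ k * exp (- (1/w)) \<le> (1 / w) ^ k * (real (k+2) * w) ^ (k+2)"
      using w by (intro mult_left_mono) auto
    have eq: "(1 / w) ^ k * (real (k+2) * w) ^ (k+2) = real (k+2) ^ (k+2) * w^2"
      using w by (simp add: power_mult_distrib power_add power_one_over power2_eq_square)
    have le2: "(1 / w) ^ k * exp (- (1/w)) \<le> real (k+2) ^ (k+2) * w^2" using le1 unfolding eq .
    have "\<bar>poly P r\<bar> * ((1 / w) ^ k * exp (- (1/w))) \<le> B * (real (k+2) ^ (k+2) * w^2)"
      proof (rule mult_mono)
      show "\<bar>poly P r\<bar> \<le> B" using B r by simp
      then show "0 \<le> B" by linarith
    qed (use w le2 in auto)
    then show ?thesis using r w by (simp add: flat_def w_def[symmetric] abs_mult mult.assoc)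
  qed
  then show ?thesis by blast
qed

text \<open>
  The polynomial factor of the derivative of \<open>flat P k\<close>, whose exponent is \<open>k + 2\<close>.
\<close>
definition flat_deriv :: "real poly \<Rightarrow> nat \<Rightarrow> real poly" where
  "flat_deriv P k = (let w = [:0, 1, -1:]; w' = [:1, -2:] in
     pderiv P * w^2 - smult (real k) (P * w' * w) + P * w')"

lemma flat_has_derivative:
  "(flat P k has_real_derivative flat (flat_deriv P k) (k+2) r) (at r)"
proof (cases "0 < r \<and> r < 1")
  case True
  define g where "g = (\<lambda>r. poly P r * (1 / (r * (1 - r))) ^ k * exp (- (1 / (r * (1 - r)))))"
  have w: "r * (1 - r) \<noteq> 0" using True by auto
  have "(g has_real_derivative flat (flat_deriv P k) (k+2) r) (at r)"
  proof -
    define w where "w = r * (1 - r)"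
    have w0: "w \<noteq> 0" using w by (simp add: w_def)
    have d: "((\<lambda>r. 1 / (r * (1 - r))) has_real_derivative - ((1 - 2 * r) * (1 / w)^2)) (at r)"
      using w by (auto intro!: derivative_eq_intros simp: w_def power2_eq_square minus_divide_left)
    have "(g has_real_derivative
        (poly (pderiv P) r * (1/w)^k + poly P r * (real k * (1/w)^(k-1) * - ((1 - 2 * r) * (1 / w)^2))) * exp
            (-(1/w))
         + poly P r * (1/w)^k * (exp (-(1/w)) * ((1 - 2 * r) * (1 / w)^2))) (at r)"
      unfolding g_def
      by (rule DERIV_cong[OF DERIV_mult[OF DERIV_mult[OF poly_DERIV DERIV_power[OF d]] DERIV_fun_exp[OF
          DERIV_minus[OF d]]]])
        (simp only: w_def[symmetric], simp add: algebra_simps)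
    moreover have "flat (flat_deriv P k) (k+2) r = 
       (poly (pderiv P) r * (1/w)^k + poly P r * (real k * (1/w)^(k-1) * - ((1 - 2 * r) * (1 / w)^2))) * exp
           (-(1/w))
         + poly P r * (1/w)^k * (exp (-(1/w)) * ((1 - 2 * r) * (1 / w)^2))"
    proof -
      have pw: "poly [:0, 1, -1:] r = w" by (simp add: w_def algebra_simps)
      have "flat (flat_deriv P k) (k+2) r = (poly (pderiv P) r * w^2 - real k * (poly P r * (1 - 2 * r) * w)
          + poly P r * (1 - 2*r)) * (1/w)^(k+2) * exp (-(1/w))"
      proof -
        have pw': "poly [:1, -2:] r = 1 - 2 * r" by simp
        have "poly (flat_deriv P k) r = poly (pderiv P) r * w^2 - real k * (poly P r * (1 - 2 * r) * w)
            + poly P r * (1 - 2*r)"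
          unfolding flat_deriv_def Let_def
          by (simp only: poly_add poly_diff poly_mult poly_power poly_smult pw pw')
        then show ?thesis using True by (simp only: flat_def w_def[symmetric] if_True simp_thms)
      qed
      also have "\<dots> = poly (pderiv P) r * (w^2 * (1/w)^(k+2)) * exp (-(1/w)) - poly P r * (1 - 2 * r) * (real k * (w
          * (1/w)^(k+2))) * exp (-(1/w))
           + poly P r * (1 - 2*r) * (1/w)^(k+2) * exp (-(1/w))"
        by (simp add: algebra_simps)
      also have "w^2 * (1/w)^(k+2) = (1/w)^k" using w0
          by (simp add: power_add power_one_over field_simps power2_eq_square)
      also have "real k * (w * (1/w)^(k+2)) = real k * ((1/w)^(k-1) * (1/w)^2)" 
        using w0 by (cases k) (simp_all add: power_add power_one_over field_simps power2_eq_square)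
      finally have e: "flat (flat_deriv P k) (k+2) r = poly (pderiv P) r * (1/w)^k * exp (-(1/w)) - poly P r * (1
          - 2 * r) * (real k * ((1/w)^(k-1) * (1/w)^2)) * exp (-(1/w))
           + poly P r * (1 - 2*r) * (1/w)^(k+2) * exp (-(1/w))" .
      define v where "v = 1/w"
      show ?thesis unfolding e v_def[symmetric] by (simp add: algebra_simps power_add power2_eq_square)
    qed
    ultimately show ?thesis by simp
  qed
  then show ?thesis
    by (rule has_field_derivative_transform_within_open[of _ _ _ "{0<..<1}"])
      (use True in \<open>auto simp: g_def flat_def\<close>)
next
  case False
  obtain M where M: "\<And>r. 0 < r \<Longrightarrow> r < 1 \<Longrightarrow> \<bar>flat P k r\<bar> \<le> M * (r * (1 - r))^2"
    using flat_le_quadratic by blast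
  have "0 \<le> M" using M[of "1/2"] by (smt (verit) divide_pos_pos power2_eq_square zero_less_mult_iff
      mult_nonneg_nonpos2 mult_neg_pos zero_less_power abs_ge_zero half_gt_zero_iff field_sum_of_halves)
  have z: "flat P k r = 0" "flat (flat_deriv P k) (k+2) r = 0" using False by (auto simp: flat_def)
  have le: "\<bar>flat P k y\<bar> \<le> M * (y - r)^2" for y
  proof (cases "0 < y \<and> y < 1")
    case True
    have "y * (1 - y) \<le> \<bar>y - r\<bar>"
    proof (cases "r \<le> 0")
      case r: True
      have "y * (1 - y) \<le> y * 1" using True by (intro mult_left_mono) auto
      then show ?thesis using r by simp
    next
      case r: False
      have "y * (1 - y) \<le> 1 * (1 - y)" using True by (intro mult_right_mono) auto
      then show ?thesis using r False by simp
    qed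
    then have "(y * (1 - y))^2 \<le> \<bar>y - r\<bar>^2" using True by (intro power_mono) auto
    then have "M * (y * (1 - y))^2 \<le> M * (y - r)^2" using \<open>0 \<le> M\<close> by (simp add: mult_left_mono)
    then show ?thesis using M[of y] True by linarith
  qed (use \<open>0 \<le> M\<close> in \<open>auto simp: flat_def\<close>)
  have "((\<lambda>y. (flat P k y - flat P k r) / (y - r)) \<longlongrightarrow> 0) (at r)"
  proof (rule Lim_null_comparison)
    show "\<forall>\<^sub>F y in at r. norm ((flat P k y - flat P k r) / (y - r)) \<le> M * \<bar>y - r\<bar>"
      unfolding eventually_at_filter
    proof (rule always_eventually, intro allI impI)
      fix y assume "y \<noteq> r"
      then show "norm ((flat P k y - flat P k r) / (y - r)) \<le> M * \<bar>y - r\<bar>"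
        using le[of y] by (simp add: z abs_divide divide_le_eq power2_eq_square abs_mult_self_eq mult.assoc)
    qed
    show "((\<lambda>y. M * \<bar>y - r\<bar>) \<longlongrightarrow> 0) (at r)" by (auto intro!: tendsto_eq_intros)
  qed
  then show ?thesis using z by (simp add: has_field_derivative_iff)
qed

text \<open>
  A smooth function rising from \<open>0\<close> on the negative axis to \<open>1\<close> beyond \<open>1\<close>, together with all its
  derivatives: \<open>S m\<close> is the derivative of order \<open>m\<close>.
\<close>
lemma smooth_step:
  obtains S :: "nat \<Rightarrow> real \<Rightarrow> real" where
    "\<And>m r. (S m has_real_derivative S (Suc m) r) (at r)"
    "\<And>r. r \<le> 0 \<Longrightarrow> S 0 r = 0" "\<And>r. r \<ge> 1 \<Longrightarrow> S 0 r = 1"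
    "\<And>r. 0 \<le> S 1 r" "\<And>r. r \<notin> {0<..<1} \<Longrightarrow> S 1 r = 0"
proof -
  define d where "d = rec_nat (1 :: real poly, 0 :: nat) (\<lambda>_ (P, k). (flat_deriv P k, k + 2))"
  have d: "d 0 = (1, 0)" "\<And>m. d (Suc m) = (flat_deriv (fst (d m)) (snd (d m)), snd (d m) + 2)"
    by (simp_all add: d_def split_beta)
  define f where "f m = flat (fst (d m)) (snd (d m))" for m
  have f: "(f m has_real_derivative f (Suc m) r) (at r)" for m r
    using flat_has_derivative by (simp add: f_def d)
  have f0: "f 0 r = (if 0 < r \<and> r < 1 then exp (- (1 / (r * (1 - r)))) else 0)" for r
    by (simp add: f_def d flat_def)
  have fc: "isCont (f 0) r" for r using f DERIV_isCont by blast
  obtain G where "\<And>x. - \<infinity> < ereal x \<Longrightarrow> ereal x < \<infinity> \<Longrightarrow> (G has_vector_derivative f 0 x) (at x)"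
    using einterval_antiderivative[of "-\<infinity>" "\<infinity>" "f 0"] fc by auto
  then have G: "(G has_real_derivative f 0 x) (at x)" for x
    by (simp add: has_real_derivative_iff_has_vector_derivative)
  have G0: "G r = G 0" if "r \<le> 0" for r
  proof (cases "r = 0")
    case False
    then have "r < 0" using that by simp
    then obtain z where "r < z" "z < 0" "G 0 - G r = (0 - r) * f 0 z"
      using MVT2[of r 0 G "f 0", OF _ G] by auto
    then show ?thesis by (simp add: f0)
  qed simp
  have G1: "G r = G 1" if "r \<ge> 1" for r
  proof (cases "r = 1")
    case False
    then have "1 < r" using that by simp
    then obtain z where "1 < z" "z < r" "G r - G 1 = (r - 1) * f 0 z"
      using MVT2[of 1 r G "f 0", OF _ G] by auto
    then show ?thesis by (simp add: f0)
  qed simp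
  have lt: "G 0 < G 1"
  proof -
    obtain z where "0 < z" "z < 1" "G 1 - G 0 = (1 - 0) * f 0 z"
      using MVT2[of 0 1 G "f 0", OF _ G] by auto
    moreover have "f 0 z > 0" using calculation by (simp add: f0)
    ultimately show ?thesis by simp
  qed
  define c where "c = G 1 - G 0"
  define S where "S m r = (case m of 0 \<Rightarrow> (G r - G 0) / c | Suc n \<Rightarrow> f n r / c)" for m r
  have "(S m has_real_derivative S (Suc m) r) (at r)" for m r
  proof (cases m)
    case 0
    then show ?thesis
      using DERIV_cdivide[OF DERIV_diff[OF G[of r] DERIV_const[of "G 0"]], of c] by (simp add: S_def[abs_def])
  next
    case (Suc n)
    then show ?thesis using DERIV_cdivide[OF f[of n r], of c] by (simp add: S_def[abs_def])
  qed
  moreover have "S 0 r = 0" if "r \<le> 0" for r using G0[OF that] by (simp add: S_def)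
  moreover have "S 0 r = 1" if "r \<ge> 1" for r using G1[OF that] lt by (simp add: S_def c_def)
  moreover have "0 \<le> S 1 r" for r using lt by (simp add: S_def c_def f0)
  moreover have "S 1 r = 0" if "r \<notin> {0<..<1}" for r using that by (auto simp: S_def f0)
  ultimately show thesis by (rule that)
qed

lemma test_functionI:
  assumes "\<And>m r. (D m has_real_derivative D (Suc m) r) (at r)"
    and "compact K" "K \<subseteq> {a<..<b}" "\<And>t. t \<notin> K \<Longrightarrow> D 0 t = 0"
  shows "test_function a b (D 0)"
proof -
  have D: "(deriv ^^ n) (D 0) = D n" for n
  proof (induction n)
    case (Suc n)
    have "deriv (D n) = D (Suc n)" using DERIV_imp_deriv[OF assms(1)] by blast
    then show ?case by (simp add: Suc)
  qed simp
  have "D n differentiable_on UNIV" for n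
    by (auto simp: differentiable_on_def
        intro!: differentiableI[OF has_field_derivative_imp_has_derivative[OF assms(1)]])
  then show ?thesis
    using assms(2-) unfolding test_function_def D by blast
qed

text \<open>
  The rescaled derivative of a smooth step is an approximate identity, concentrated to the right of
  \<open>s\<close>.
\<close>
lemma approximate_identity:
  fixes S0 S1 c :: "real \<Rightarrow> real"
  assumes D: "\<And>r. (S0 has_real_derivative S1 r) (at r)" and cont: "continuous_on UNIV S1"
    and S0: "\<And>r. r \<le> 0 \<Longrightarrow> S0 r = 0" "\<And>r. r \<ge> 1 \<Longrightarrow> S0 r = 1"
    and S1: "\<And>r. 0 \<le> S1 r" "\<And>r. r \<notin> {0<..<1} \<Longrightarrow> S1 r = 0"
    and c: "continuous_on {a..b} c" and s: "a < s" "s < b"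
  shows "(\<lambda>n. integral {a..b} (\<lambda>r. (real n * S1 (real n * (r - s))) * c r)) \<longlonglongrightarrow> c s"
proof (rule LIMSEQ_I)
  fix e :: real assume e: "e > 0"
  obtain d where d: "d > 0" "\<And>r. r \<in> {a..b} \<Longrightarrow> \<bar>r - s\<bar> < d \<Longrightarrow> \<bar>c r - c s\<bar> < e / 2"
    using c s e unfolding continuous_on_iff dist_real_def
    by (metis (no_types, opaque_lifting) atLeastAtMost_iff half_gt_zero less_eq_real_def)
  obtain N where N: "N > 0" "inverse (real N) < min d (b - s)"
    using reals_Archimedean[of "min d (b - s)"] d s by (metis min_less_iff_conj diff_gt_0_iff_gt zero_less_Suc)
  show "\<exists>no. \<forall>n\<ge>no. norm (integral {a..b} (\<lambda>r. (real n * S1 (real n * (r - s))) * c r) - c s) < e"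
  proof (intro exI allI impI)
    fix n assume "n \<ge> N"
    then have n: "n > 0" using N by auto
    have "inverse (real n) \<le> inverse (real N)" using N \<open>n \<ge> N\<close> by (intro le_imp_inverse_le) auto
    then have n': "inverse (real n) < d" "inverse (real n) < b - s" using N by auto
    let ?k = "\<lambda>r. real n * S1 (real n * (r - s))"
    have kc: "continuous_on X ?k" for X
      by (intro continuous_intros continuous_on_compose2[OF cont]) auto
    have "((\<lambda>r. ?k r) has_integral (S0 (real n * (b - s)) - S0 (real n * (a - s)))) {a..b}"
    proof (rule fundamental_theorem_of_calculus)
      show "a \<le> b" using s by simp
      fix x assume "x \<in> {a..b}"
      have "((\<lambda>x. S0 (real n * (x - s))) has_real_derivative S1 (real n * (x - s)) * real n) (at x within {a..b})"
        by (rule DERIV_chain2[OF D]) (auto intro!: derivative_eq_intros)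
      then show "((\<lambda>x. S0 (real n * (x - s))) has_vector_derivative ?k x) (at x within {a..b})"
        by (simp add: has_real_derivative_iff_has_vector_derivative mult.commute)
    qed
    moreover have "S0 (real n * (b - s)) = 1" using n n' by (intro S0) (simp add: field_simps)
    moreover have "S0 (real n * (a - s)) = 0" using s by (intro S0) (simp add: mult_nonneg_nonpos)
    ultimately have k1: "(?k has_integral 1) {a..b}" by simp
    have i: "(\<lambda>r. ?k r * (c r - c s)) integrable_on {a..b}"
      by (intro integrable_continuous_interval continuous_intros kc c)
    have "((\<lambda>r. ?k r * (c r - c s)) has_integral (integral {a..b} (\<lambda>r. ?k r * c r) - c s)) {a..b}"
    proof -
      have "(\<lambda>r. ?k r * c r) integrable_on {a..b}"
        by (intro integrable_continuous_interval continuous_intros kc c)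
      from has_integral_diff[OF integrable_integral[OF this] has_integral_mult_left[OF k1, of "c s"]]
      show ?thesis by (simp add: algebra_simps)
    qed
    then have "integral {a..b} (\<lambda>r. ?k r * c r) - c s = integral {a..b} (\<lambda>r. ?k r * (c r - c s))"
      by (simp add: integral_unique)
    also have "norm \<dots> \<le> integral {a..b} (\<lambda>r. ?k r * (e/2))"
    proof (rule integral_norm_bound_integral[OF i])
      show "(\<lambda>r. ?k r * (e/2)) integrable_on {a..b}"
        by (intro integrable_continuous_interval continuous_intros kc)
      fix r assume r: "r \<in> {a..b}"
      show "norm (?k r * (c r - c s)) \<le> ?k r * (e/2)"
      proof (cases "real n * (r - s) \<in> {0<..<1}")
        case True
        then have "0 < r - s" "r - s < inverse (real n)" using n by (auto simp: field_simps zero_less_mult_iff)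
        then have "\<bar>c r - c s\<bar> < e/2" using n' by (intro d r) auto
        then show ?thesis using S1(1)[of "real n * (r - s)"] 
          by (simp add: abs_mult mult_left_mono del: times_divide_eq_right)
      qed (simp add: S1)
    qed
    also have "\<dots> = e/2" by (simp only: integral_unique[OF has_integral_mult_left[OF k1]] mult_1)
    also have "\<dots> < e" using e by simp
    finally show "norm (integral {a..b} (\<lambda>r. ?k r * c r) - c s) < e" .
  qed
qed

text \<open>
  The du Bois-Reymond lemma: a continuous function with an integrable weak derivative has the integrals
  of the latter as increments.
\<close>
lemma weak_derivative_imp_increment:
  fixes c \<gamma> :: "real \<Rightarrow> real"
  assumes c: "continuous_on {a..b} c" and \<gamma>: "\<gamma> absolutely_integrable_on {a..b}"
    and weak: "\<And>\<phi>. test_function a b \<phi> \<Longrightarrow>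
        integral {a..b} (\<lambda>t. deriv \<phi> t * c t) = - integral {a..b} (\<lambda>t. \<phi> t * \<gamma> t)"
    and st: "a \<le> s" "s \<le> t" "t \<le> b"
  shows "c t - c s = integral {s..t} \<gamma>"
proof (cases "a < b")
  case ab: True
  have gi: "\<gamma> integrable_on {a..b}" using \<gamma> set_lebesgue_integral_eq_integral(1) by blast
  obtain S :: "nat \<Rightarrow> real \<Rightarrow> real" where S:
    "\<And>m r. (S m has_real_derivative S (Suc m) r) (at r)"
    "\<And>r. r \<le> 0 \<Longrightarrow> S 0 r = 0" "\<And>r. r \<ge> 1 \<Longrightarrow> S 0 r = 1"
    "\<And>r. 0 \<le> S 1 r" "\<And>r. r \<notin> {0<..<1} \<Longrightarrow> S 1 r = 0"
    using smooth_step by blast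
  have S0D: "(S 0 has_real_derivative S 1 r) (at r)" for r using S(1)[of 0 r] by simp
  have cont: "continuous_on X (S m)" for m X
    using S(1) DERIV_isCont continuous_at_imp_continuous_on by blast
  have mono: "S 0 x \<le> S 0 y" if "x \<le> y" for x y
    using that S(4) S0D by (intro DERIV_nonneg_imp_nondecreasing[of x y "S 0"]) blast+
  have S01: "0 \<le> S 0 r \<and> S 0 r \<le> 1" for r
    using mono[of 0 r] mono[of r 1] S(2,3) by (metis linear order_refl zero_le_one)
  have inner: "c t - c s = integral {s..t} \<gamma>" if st: "a < s" "s \<le> t" "t < b" for s t
  proof -
    \<comment> \<open>Test functions approximating the indicator of \<open>(s,t]\<close>; their derivatives are approximate
      identities at \<open>s\<close> and, with the opposite sign, at \<open>t\<close>.\<close>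
    define \<phi> where "\<phi> n r = S 0 (real n * (r - s)) - S 0 (real n * (r - t))" for n r
    have ev: "\<forall>\<^sub>F n in sequentially. integral {a..b} (\<lambda>r. (real n * S 1 (real n * (r - s))) * c r)
         - integral {a..b} (\<lambda>r. (real n * S 1 (real n * (r - t))) * c r) = - integral {a..b} (\<lambda>r. \<phi> n r * \<gamma> r)"
    proof -
      have "\<forall>\<^sub>F n in sequentially. inverse (real n) < b - t"
        using st by (intro order_tendstoD[OF lim_inverse_n]) auto
      then show ?thesis using eventually_gt_at_top[of 0]
      proof eventually_elim
        case (elim n)
        define D where "D m r = real n ^ m * (S m (real n * (r - s)) - S m (real n * (r - t)))" for m r
        have chain: "((\<lambda>r. S m (real n * (r - u))) has_real_derivative S (Suc m) (real n * (r - u)) * real n) (at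
            r)" for m u r
          by (rule DERIV_chain2[OF S(1)]) (auto intro!: derivative_eq_intros)
        have DD: "(D m has_real_derivative D (Suc m) r) (at r)" for m r
          unfolding D_def[abs_def]
          by (rule DERIV_cong[OF DERIV_cmult[OF DERIV_diff[OF chain chain]]]) (simp add: algebra_simps)
        have \<phi>: "\<phi> n = D 0" by (simp add: D_def \<phi>_def fun_eq_iff)
        have tf: "test_function a b (D 0)"
        proof (rule test_functionI[where D = D, OF DD])
          show "compact {s..t + inverse (real n)}" "{s..t + inverse (real n)} \<subseteq> {a<..<b}"
            using st elim by auto
          fix r assume "r \<notin> {s..t + inverse (real n)}"
          then consider "r < s" | "r > t + inverse (real n)" by force
          then show "D 0 r = 0"
          proof cases
            case 1
            then have "real n * (r - s) \<le> 0" "real n * (r - t) \<le> 0" using st by (auto simp: mult_nonneg_nonpos)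
            then show ?thesis by (simp add: D_def S(2))
          next
            case 2
            then have "real n * (r - t) \<ge> 1" using elim by (simp add: field_simps)
            moreover have "real n * (r - s) \<ge> real n * (r - t)" using st by (intro mult_left_mono) auto
            ultimately show ?thesis by (simp add: D_def S(3))
          qed
        qed
        have "deriv (D 0) = D 1" using DD[of 0] DERIV_imp_deriv by (auto simp: fun_eq_iff)
        with weak[OF tf] have "integral {a..b} (\<lambda>r. D 1 r * c r) = - integral {a..b} (\<lambda>r. \<phi> n r * \<gamma> r)"
          by (simp add: \<phi>)
        moreover have "integral {a..b} (\<lambda>r. D 1 r * c r) = integral {a..b} (\<lambda>r. (real n * S 1 (real n * (r
            - s))) * c r - (real n * S 1 (real n * (r - t))) * c r)"
          by (simp add: D_def algebra_simps)
        moreover have "\<dots> = integral {a..b} (\<lambda>r. (real n * S 1 (real n * (r - s))) * c r)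
         - integral {a..b} (\<lambda>r. (real n * S 1 (real n * (r - t))) * c r)"
          by (intro Henstock_Kurzweil_Integration.integral_diff integrable_continuous_interval continuous_intros c
               continuous_on_compose2[OF cont[of UNIV 1]]) auto
        ultimately show ?case by simp
      qed
    qed
    have L: "(\<lambda>n. integral {a..b} (\<lambda>r. (real n * S 1 (real n * (r - s))) * c r)
         - integral {a..b} (\<lambda>r. (real n * S 1 (real n * (r - t))) * c r)) \<longlonglongrightarrow> c s - c t"
      using st by (intro tendsto_diff approximate_identity[OF S0D cont S(2,3,4,5) c]) auto
    have pw: "(\<lambda>n. \<phi> n r) \<longlonglongrightarrow> indicator {s<..t} r" for r
    proof -
      have H: "(\<lambda>n. S 0 (real n * (r - u))) \<longlonglongrightarrow> indicator {u<..} r" for u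
      proof (cases "r \<le> u")
        case True
        then have "S 0 (real n * (r - u)) = 0" for n by (intro S) (simp add: mult_nonneg_nonpos)
        then show ?thesis using True by simp
      next
        case False
        have "\<forall>\<^sub>F n in sequentially. inverse (real n) < r - u"
          using False by (intro order_tendstoD[OF lim_inverse_n]) auto
        then have "\<forall>\<^sub>F n in sequentially. 1 = S 0 (real n * (r - u))"
          using eventually_gt_at_top[of 0]
          by eventually_elim (intro S(3)[symmetric], simp add: field_simps)
        from Lim_transform_eventually[OF tendsto_const this] show ?thesis using False by simp
      qed
      have "(\<lambda>n. \<phi> n r) \<longlonglongrightarrow> indicator {s<..} r - indicator {t<..} r"
        unfolding \<phi>_def by (intro tendsto_diff H)
      moreover have "indicator {s<..} r - indicator {t<..} r = (indicator {s<..t} r :: real)"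
        using st by (auto simp: indicator_def)
      ultimately show ?thesis by simp
    qed
    let ?M = "lebesgue_on {a..b}"
    have gm: "\<gamma> \<in> borel_measurable ?M" and gI: "integrable ?M \<gamma>"
      using \<gamma> by (auto simp: absolutely_integrable_iff_integrable_lebesgue_on)
    have pm: "(\<lambda>r. \<phi> n r * \<gamma> r) \<in> borel_measurable ?M" for n
    proof (rule borel_measurable_times[OF _ gm])
      have "continuous_on {a..b} (\<phi> n)"
        unfolding \<phi>_def[abs_def] by (intro continuous_intros continuous_on_compose2[OF cont[of UNIV 0]]) auto
      then show "\<phi> n \<in> borel_measurable ?M" by (rule continuous_imp_measurable_on_sets_lebesgue) simp
    qed
    have pb: "norm (\<phi> n r * \<gamma> r) \<le> \<bar>\<gamma> r\<bar>" for n r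
    proof -
      have "\<bar>\<phi> n r\<bar> \<le> 1" using S01[of "real n * (r - s)"] S01[of "real n * (r - t)"]
          by (auto simp: \<phi>_def abs_le_iff)
      then show ?thesis by (simp add: abs_mult mult_left_le_one_le)
    qed
    have im: "(\<lambda>r. indicator {s<..t} r * \<gamma> r) \<in> borel_measurable ?M"
    proof (rule borel_measurable_times[OF _ gm])
      show "indicat_real {s<..t} \<in> borel_measurable ?M"
        by (intro borel_measurable_indicator) (use st in \<open>auto simp: sets_restrict_space_iff\<close>)
    qed
    have dc1: "integrable ?M (\<lambda>r. \<phi> n r * \<gamma> r)" for n
      using pb by (intro Bochner_Integration.integrable_bound[OF integrable_abs[OF gI] pm]) auto
    have dc2: "integrable ?M (\<lambda>r. indicator {s<..t} r * \<gamma> r)"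
      by (intro Bochner_Integration.integrable_bound[OF integrable_abs[OF gI] im])
        (auto simp: indicator_def)
    have dc3: "(\<lambda>n. integral\<^sup>L ?M (\<lambda>r. \<phi> n r * \<gamma> r)) \<longlonglongrightarrow> integral\<^sup>L ?M (\<lambda>r. indicator {s<..t} r * \<gamma> r)"
      by (rule integral_dominated_convergence[OF im pm integrable_abs[OF gI]])
        (use pb in \<open>auto intro!: AE_I2 tendsto_mult pw tendsto_const\<close>)
    have "(\<lambda>n. - integral {a..b} (\<lambda>r. \<phi> n r * \<gamma> r)) \<longlonglongrightarrow> - integral {a..b} (\<lambda>r. indicator {s<..t} r * \<gamma> r)"
      using tendsto_minus[OF dc3] dc1 dc2 by (simp add: lebesgue_integral_eq_integral)
    moreover have "(\<lambda>n. - integral {a..b} (\<lambda>r. \<phi> n r * \<gamma> r)) \<longlonglongrightarrow> c s - c t"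
      using ev by (rule Lim_transform_eventually[OF L])
    ultimately have "c t - c s = integral {a..b} (\<lambda>r. indicator {s<..t} r * \<gamma> r)"
      using LIMSEQ_unique by fastforce
    also have "\<dots> = integral {s..t} \<gamma>"
    proof -
      have "integral {a..b} (\<lambda>r. indicator {s<..t} r * \<gamma> r) = integral UNIV (\<lambda>r. if r \<in> {a..b} then indicator
          {s<..t} r * \<gamma> r else 0)"
        by (rule integral_restrict_UNIV[symmetric])
      also have "\<dots> = integral UNIV (\<lambda>r. if r \<in> {s..t} then \<gamma> r else 0)"
        by (rule integral_spike[of "{s}"]) (use st in \<open>auto simp: indicator_def\<close>)
      also have "\<dots> = integral {s..t} \<gamma>" by (rule integral_restrict_UNIV)
      finally show ?thesis .
    qed
    finally show ?thesis .
  qed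
  define H where "H r = c r - integral {a..r} \<gamma>" for r
  have Hc: "continuous_on {a..b} H"
    unfolding H_def by (intro continuous_intros c indefinite_integral_continuous_1 gi)
  define m where "m = (a + b) / 2"
  have m: "a < m" "m < b" using ab by (auto simp: m_def)
  have comb: "integral {a..s} \<gamma> + integral {s..t} \<gamma> = integral {a..t} \<gamma>" if "a \<le> s" "s \<le> t" "t \<le> b" for s t
    using that by (intro Henstock_Kurzweil_Integration.integral_combine integrable_on_subinterval[OF gi]) auto
  have "H r = H m" if "r \<in> {a<..<b}" for r
  proof (cases "r \<le> m")
    case True
    then show ?thesis using inner[of r m] comb[of r m] that m by (simp add: H_def)
  next
    case False
    then show ?thesis using inner[of m r] comb[of m r] that m by (simp add: H_def)
  qed
  then have "H r = H m" if "r \<in> {a..b}" for r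
    using continuous_constant_on_closure[of "{a<..<b}" H "H m" r] Hc ab that
    by (simp add: closure_greaterThanLessThan)
  then have "H t = H s" using st by simp
  then show ?thesis using comb[OF st] by (simp add: H_def)
next
  case False
  then have "s = t" using st by linarith
  then show ?thesis by simp
qed

section \<open>Integrated evolution equations and the energy inequality\<close>

text \<open>
  The integrated form of \<open>x' = g\<close> in \<open>V\<^sup>*\<close> on \<open>[a,b]\<close>: \<open>x\<close> is the continuous \<open>H\<close>-valued representative
  of \<open>X\<close>, the increments of \<open>(x(\<cdot>), v)\<close> are the integrals of \<open>\<langle>g, v\<rangle>\<close> for every \<open>v \<in> V\<close>, and \<open>\<gamma>\<close> is an
  integrable bound of the norm of \<open>g\<close>. Carrying \<open>\<gamma>\<close> instead of \<open>\<parallel>g\<parallel>\<^sub>*\<close> itself makes the notion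
  stable under differences without any measurability of sums of \<open>V\<^sup>*\<close>-valued functions.
\<close>
definition weak_evolution ::
    "('v::{banach,second_countable_topology} \<Rightarrow>\<^sub>L 'h::{real_inner,banach}) \<Rightarrow> real \<Rightarrow> real \<Rightarrow>
     (real \<Rightarrow> 'h) \<Rightarrow> (real \<Rightarrow> 'v) \<Rightarrow> (real \<Rightarrow> ('v \<Rightarrow>\<^sub>L real)) \<Rightarrow> (real \<Rightarrow> real) \<Rightarrow> bool" where
  "weak_evolution j a b x X g \<gamma> \<longleftrightarrow>
     continuous_on {a..b} x \<and>
     (\<forall>v. (\<lambda>t. blinfun_apply (g t) v) absolutely_integrable_on {a..b}) \<and>
     \<gamma> absolutely_integrable_on {a..b} \<and> (\<forall>t. norm (g t) \<le> \<gamma> t) \<and>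
     (AE t in lebesgue_on {a..b}. x t = blinfun_apply j (X t)) \<and>
     (\<forall>s t v. a \<le> s \<longrightarrow> s \<le> t \<longrightarrow> t \<le> b \<longrightarrow>
        (x t - x s) \<bullet> blinfun_apply j v = integral {s..t} (\<lambda>r. blinfun_apply (g r) v))"

lemma absolutely_integrable_imp_HK: "f absolutely_integrable_on S \<Longrightarrow> f integrable_on S"
  for f :: "real \<Rightarrow> real"
  by (rule set_lebesgue_integral_eq_integral(1))

lemma AE_lebesgue_on_subset:
  fixes S S' :: "real set"
  assumes "AE t in lebesgue_on S. P t" "S' \<subseteq> S" "S \<in> sets lebesgue" "S' \<in> sets lebesgue"
  shows "AE t in lebesgue_on S'. P t"
  using assms by (simp add: AE_restrict_space_iff) (erule eventually_mono, auto)

lemma weak_evolution_subinterval: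
  assumes "weak_evolution j a b x X g \<gamma>" "a \<le> a'" "b' \<le> b"
  shows "weak_evolution j a' b' x X g \<gamma>"
proof -
  have sub: "{a'..b'} \<subseteq> {a..b}" using assms by auto
  note a = assms(1)[unfolded weak_evolution_def]
  have "(x t - x s) \<bullet> blinfun_apply j v = integral {s..t} (\<lambda>r. blinfun_apply (g r) v)"
    if "a' \<le> s" "s \<le> t" "t \<le> b'" for s t v
  proof -
    have "a \<le> s" "t \<le> b" using that assms by auto
    then show ?thesis using a that(2) by blast
  qed
  then show ?thesis
    using a unfolding weak_evolution_def
    by (auto intro: continuous_on_subset[OF _ sub] absolutely_integrable_on_subinterval[OF _ sub]
        AE_lebesgue_on_subset[OF _ sub])
qed

lemma weak_evolution_diff:
  assumes "weak_evolution j a b x X g \<gamma>" "weak_evolution j a b y Y k \<kappa>"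
  shows "weak_evolution j a b (\<lambda>t. x t - y t) (\<lambda>t. X t - Y t) (\<lambda>t. g t - k t) (\<lambda>t. \<gamma> t + \<kappa> t)"
proof -
  note a = assms[unfolded weak_evolution_def]
  have 1: "(\<lambda>t. blinfun_apply (g t - k t) v) absolutely_integrable_on {a..b}" for v
    using a by (simp add: blinfun.diff_left set_integral_diff(1))
  have 2: "norm (g t - k t) \<le> \<gamma> t + \<kappa> t" for t
    using a norm_triangle_ineq4[of "g t" "k t"] by (meson add_mono order_trans)
  have 3: "AE t in lebesgue_on {a..b}. x t - y t = blinfun_apply j (X t - Y t)"
  proof -
    have "AE t in lebesgue_on {a..b}. x t = blinfun_apply j (X t)" "AE t in lebesgue_on {a..b}. y t
        = blinfun_apply j (Y t)"
      using a by auto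
    then show ?thesis by eventually_elim (simp add: blinfun.diff_right)
  qed
  have 4: "((x t - y t) - (x s - y s)) \<bullet> blinfun_apply j v = integral {s..t} (\<lambda>r. blinfun_apply (g r - k r) v)"
    if "a \<le> s" "s \<le> t" "t \<le> b" for s t v
  proof -
    have i: "(\<lambda>r. blinfun_apply (g r) v) integrable_on {s..t}" "(\<lambda>r. blinfun_apply (k r) v) integrable_on {s..t}"
      using a that by (auto intro!: absolutely_integrable_imp_HK absolutely_integrable_on_subinterval[where S =
          "{a..b}" and a = s and b = t])
    have "((x t - y t) - (x s - y s)) \<bullet> blinfun_apply j v = (x t - x s) \<bullet> blinfun_apply j v - (y t
        - y s) \<bullet> blinfun_apply j v"
      by (simp add: inner_diff_left)
    also have "\<dots> = integral {s..t} (\<lambda>r. blinfun_apply (g r) v) - integral {s..t} (\<lambda>r. blinfun_apply (k r) v)"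
      using a that by simp
    also have "\<dots> = integral {s..t} (\<lambda>r. blinfun_apply (g r - k r) v)"
      using i by (simp add: blinfun.diff_left Henstock_Kurzweil_Integration.integral_diff)
    finally show ?thesis .
  qed
  have 5: "continuous_on {a..b} (\<lambda>t. x t - y t)" using a by (intro continuous_on_diff) blast+
  have 6: "(\<lambda>t. \<gamma> t + \<kappa> t) absolutely_integrable_on {a..b}"
    using conjunct1[OF conjunct2[OF conjunct2[OF a(1)]]] conjunct1[OF conjunct2[OF conjunct2[OF a(2)]]]
    by (rule set_integral_add(1))
  show ?thesis unfolding weak_evolution_def
    by (intro conjI) (use 1 2 3 4 5 6 in \<open>simp_all\<close>)
qed

text \<open>
  Almost every point is a left Lebesgue point of \<open>\<langle>g, v\<rangle>\<close> for all \<open>v \<in> V\<close> simultaneously: a countable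
  dense set of \<open>v\<close> suffices because the means of \<open>\<gamma>\<close> stay bounded.
\<close>
lemma weak_Lebesgue_points:
  fixes g :: "real \<Rightarrow> ('v::{real_normed_vector,second_countable_topology} \<Rightarrow>\<^sub>L real)"
  assumes g: "\<And>v. (\<lambda>t. blinfun_apply (g t) v) integrable_on {a..b}"
    and \<gamma>: "\<gamma> integrable_on {a..b}" "\<And>t. norm (g t) \<le> \<gamma> t"
  shows "AE r in lebesgue_on {a..b}. r > a \<longrightarrow>
    (\<forall>v. ((\<lambda>h. integral {r-h..r} (\<lambda>t. blinfun_apply (g t) v) / h) \<longlongrightarrow> blinfun_apply (g r) v) (at_right 0))"
proof -
  obtain D :: "'v set" where D: "countable D" "\<And>S. open S \<Longrightarrow> S \<noteq> {} \<Longrightarrow> \<exists>d\<in>D. d \<in> S"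
    using countable_dense_setE by blast
  define L where "L v r \<longleftrightarrow> ((\<lambda>h. integral {r-h..r} (\<lambda>t. blinfun_apply (g t) v) / h) \<longlongrightarrow> blinfun_apply (g r) v)
      (at_right 0)" for v r
  have "\<exists>N. negligible N \<and> (\<forall>r\<in>{a<..b} - N. L v r)" for v
    unfolding L_def by (rule left_Lebesgue_differentiation[OF g[of v]]) blast
  then obtain N where N: "\<And>v. negligible (N v)" "\<And>v r. r \<in> {a<..b} - N v \<Longrightarrow> L v r"
    by metis
  obtain N0 where N0: "negligible N0"
    "\<And>r. r \<in> {a<..b} - N0 \<Longrightarrow> ((\<lambda>h. integral {r-h..r} \<gamma> / h) \<longlongrightarrow> \<gamma> r) (at_right 0)"
    by (rule left_Lebesgue_differentiation[OF \<gamma>(1)]) (rule that)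
  define Z where "Z = N0 \<union> (\<Union>v\<in>D. N v)"
  have Z: "negligible Z" unfolding Z_def
    using D(1) N(1) N0(1) by (intro negligible_Un negligible_countable_Union) auto
  have main: "((\<lambda>h. integral {r-h..r} (\<lambda>t. blinfun_apply (g t) v) / h) \<longlongrightarrow> blinfun_apply (g r) v) (at_right 0)"
    if r: "r \<in> {a<..b} - Z" for r v
  proof (rule tendstoI)
    fix e :: real assume e: "e > 0"
    have \<gamma>0: "\<gamma> t \<ge> 0" for t using \<gamma>(2)[of t] norm_ge_zero order_trans by blast
    define B where "B = 2 * \<gamma> r + 1"
    have B: "B > 0" using \<gamma>0[of r] by (simp add: B_def)
    obtain w where w: "w \<in> D" "dist v w < e / (2 * B)"
    proof -
      have "e / (2 * B) > 0" using e B by simp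
      then show ?thesis using D(2)[of "ball v (e / (2 * B))"] that by auto
    qed
    have "((\<lambda>h. integral {r-h..r} \<gamma> / h) \<longlongrightarrow> \<gamma> r) (at_right 0)"
      using r N0 by (auto simp: Z_def)
    then have ev1: "\<forall>\<^sub>F h in at_right 0. integral {r-h..r} \<gamma> / h < \<gamma> r + 1"
      by (rule order_tendstoD) simp
    have "((\<lambda>h. integral {r-h..r} (\<lambda>t. blinfun_apply (g t) w) / h) \<longlongrightarrow> blinfun_apply (g r) w) (at_right 0)"
      using N(2)[of r w] r w unfolding L_def Z_def by blast
    then have ev2: "\<forall>\<^sub>F h in at_right 0. dist (integral {r-h..r} (\<lambda>t. blinfun_apply (g t) w) / h) (blinfun_apply (g
        r) w) < e / 2"
      using e by (intro tendstoD) auto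
    have ev3: "\<forall>\<^sub>F h in at_right 0. h > 0 \<and> h < r - a"
      using r by (auto simp: eventually_at_right_field intro!: exI[of _ "r - a"])
    show "\<forall>\<^sub>F h in at_right 0. dist (integral {r-h..r} (\<lambda>t. blinfun_apply (g t) v) / h) (blinfun_apply (g r) v) < e"
      using ev1 ev2 ev3
    proof eventually_elim
      case (elim h)
      have sub: "{r-h..r} \<subseteq> {a..b}" using elim r by auto
      have i: "(\<lambda>t. blinfun_apply (g t) u) integrable_on {r-h..r}" for u
        using integrable_on_subinterval[OF g sub] .
      have ig: "\<gamma> integrable_on {r-h..r}" using integrable_on_subinterval[OF \<gamma>(1) sub] .
      have eq: "integral {r-h..r} (\<lambda>t. blinfun_apply (g t) v) = integral {r-h..r} (\<lambda>t. blinfun_apply (g t) w)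
          + integral {r-h..r} (\<lambda>t. blinfun_apply (g t) (v - w))"
        using i by (simp add: blinfun.diff_right Henstock_Kurzweil_Integration.integral_diff)
      have "norm (integral {r-h..r} (\<lambda>t. blinfun_apply (g t) (v - w))) \<le> integral {r-h..r} (\<lambda>t. \<gamma> t * norm (v - w))"
      proof (rule Henstock_Kurzweil_Integration.integral_norm_bound_integral[OF i])
        show "(\<lambda>t. \<gamma> t * norm (v - w)) integrable_on {r-h..r}" using ig by (rule integrable_on_mult_left)
        show "norm (blinfun_apply (g t) (v - w)) \<le> \<gamma> t * norm (v - w)" for t
          using norm_blinfun[of "g t" "v - w"] mult_right_mono[OF \<gamma>(2)[of t], of "norm (v-w)"] by simp
      qed
      also have "\<dots> = integral {r-h..r} \<gamma> * norm (v - w)" by simp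
      finally have "norm (integral {r-h..r} (\<lambda>t. blinfun_apply (g t) (v - w))) / h
          \<le> (integral {r-h..r} \<gamma> / h) * norm (v - w)"
        using elim by (simp add: divide_right_mono)
      also have "\<dots> \<le> (\<gamma> r + 1) * norm (v - w)" using elim by (intro mult_right_mono) auto
      finally have 1: "\<bar>integral {r-h..r} (\<lambda>t. blinfun_apply (g t) (v - w)) / h\<bar> \<le> (\<gamma> r + 1) * norm (v - w)"
        using elim by simp
      have 2: "\<bar>blinfun_apply (g r) (v - w)\<bar> \<le> \<gamma> r * norm (v - w)"
        using norm_blinfun[of "g r" "v - w"] mult_right_mono[OF \<gamma>(2)[of r], of "norm (v-w)"] by simp
      have "(\<gamma> r + 1) * norm (v - w) + \<gamma> r * norm (v - w) = B * norm (v - w)" by (simp add: B_def algebra_simps)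
      also have "\<dots> < B * (e / (2 * B))" using w B by (intro mult_strict_left_mono) (auto simp: dist_norm)
      also have "\<dots> = e / 2" using B by simp
      finally have 3: "(\<gamma> r + 1) * norm (v - w) + \<gamma> r * norm (v - w) < e / 2" .
      have "integral {r-h..r} (\<lambda>t. blinfun_apply (g t) v) / h - blinfun_apply (g r) v =
        (integral {r-h..r} (\<lambda>t. blinfun_apply (g t) w) / h - blinfun_apply (g r) w) + integral {r-h..r} (\<lambda>t.
            blinfun_apply (g t) (v - w)) / h
         - blinfun_apply (g r) (v - w)"
        unfolding eq by (simp add: blinfun.diff_right add_divide_distrib)
      then show ?case using 1 2 3 elim(2) unfolding dist_real_def by linarith
    qed
  qed
  show ?thesis
    using negligible_imp_AE_lebesgue_on[OF Z, of a b] AE_space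
    by eventually_elim (use main in \<open>auto simp: space_restrict_space\<close>)
qed

lemma weak_evolution_unique:
  assumes j: "inj (blinfun_apply j)"
    and 1: "weak_evolution j a b x X g \<gamma>" and 2: "weak_evolution j a b x X' g' \<gamma>'"
  shows "AE t in lebesgue_on {a..b}. X t = X' t \<and> g t = g' t"
proof -
  note a1 = 1[unfolded weak_evolution_def] and a2 = 2[unfolded weak_evolution_def]
  have l1: "AE r in lebesgue_on {a..b}. r > a \<longrightarrow>
    (\<forall>v. ((\<lambda>h. integral {r-h..r} (\<lambda>t. blinfun_apply (g t) v) / h) \<longlongrightarrow> blinfun_apply (g r) v) (at_right 0))"
    by (rule weak_Lebesgue_points[of g a b \<gamma>]) (use a1 absolutely_integrable_imp_HK in blast)+
  have l2: "AE r in lebesgue_on {a..b}. r > a \<longrightarrow>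
    (\<forall>v. ((\<lambda>h. integral {r-h..r} (\<lambda>t. blinfun_apply (g' t) v) / h) \<longlongrightarrow> blinfun_apply (g' r) v) (at_right 0))"
    by (rule weak_Lebesgue_points[of g' a b \<gamma>']) (use a2 absolutely_integrable_imp_HK in blast)+
  have x1: "AE t in lebesgue_on {a..b}. x t = blinfun_apply j (X t)" and x2: "AE t in lebesgue_on {a..b}. x t
      = blinfun_apply j (X' t)"
    using a1 a2 by auto
  show ?thesis
    using l1 l2 x1 x2 AE_lebesgue_on_greater AE_space
  proof eventually_elim
    case (elim r)
    have "blinfun_apply (g r) v = blinfun_apply (g' r) v" for v
    proof (rule tendsto_unique[OF trivial_limit_at_right_real])
      show "((\<lambda>h. integral {r-h..r} (\<lambda>t. blinfun_apply (g t) v) / h) \<longlongrightarrow> blinfun_apply (g r) v) (at_right 0)"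
        using elim by blast
      have "((\<lambda>h. integral {r-h..r} (\<lambda>t. blinfun_apply (g' t) v) / h) \<longlongrightarrow> blinfun_apply (g' r) v) (at_right 0)"
        using elim by blast
      moreover have "\<forall>\<^sub>F h in at_right 0. integral {r-h..r} (\<lambda>t. blinfun_apply (g' t) v) / h
          = integral {r-h..r} (\<lambda>t. blinfun_apply (g t) v) / h"
      proof (rule eventually_at_rightI[of 0 "r - a"])
        fix h assume "h \<in> {0<..<r - a}"
        then have "a \<le> r - h" "r - h \<le> r" "r \<le> b" using elim by (auto simp: space_restrict_space)
        then have "integral {r-h..r} (\<lambda>t. blinfun_apply (g' t) v) = integral {r-h..r} (\<lambda>t. blinfun_apply (g t) v)"
          using a1 a2 by metis
        then show "integral {r-h..r} (\<lambda>t. blinfun_apply (g' t) v) / h = integral {r-h..r} (\<lambda>t. blinfun_apply (g t)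
            v) / h" by simp
      qed (use elim in auto)
      ultimately show "((\<lambda>h. integral {r-h..r} (\<lambda>t. blinfun_apply (g t) v) / h) \<longlongrightarrow> blinfun_apply (g' r) v) (at_right
          0)"
        by (rule Lim_transform_eventually)
    qed
    then have "g r = g' r" by (rule blinfun_eqI)
    moreover have "X r = X' r" using elim j by (metis injD)
    ultimately show ?case by simp
  qed
qed

text \<open>
  The half of the integration by parts formula in \<open>W\<^sub>p\<^sub>q\<close> that is needed. The domination hypothesis
  is Young's inequality in the applications.
\<close>
lemma energy_inequality:
  fixes j :: "'v::{banach,second_countable_topology} \<Rightarrow>\<^sub>L 'h::{real_inner,banach}"
  assumes ev: "weak_evolution j a b x X g \<gamma>" and ab: "a \<le> b"
    and mu: "\<mu> absolutely_integrable_on {a..b}" "\<And>r. \<mu> r \<ge> 0"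
    and k: "k absolutely_integrable_on {a..b}" "\<And>r. k r \<ge> 0"
    and dom: "\<And>s r. \<gamma> s * norm (X r) \<le> \<mu> s + k r"
  shows "(\<lambda>t. blinfun_apply (g t) (X t)) absolutely_integrable_on {a..b}"
    "(norm (x b))\<^sup>2 / 2 - (norm (x a))\<^sup>2 / 2 \<le> integral {a..b} (\<lambda>t. blinfun_apply (g t) (X t))"
proof -
  note a = ev[unfolded weak_evolution_def]
  have *: "(\<lambda>t. blinfun_apply (g t) (X t)) absolutely_integrable_on {a..b} \<and>
    (norm (x b))\<^sup>2 / 2 - (norm (x a))\<^sup>2 / 2 \<le> integral {a..b} (\<lambda>t. blinfun_apply (g t) (X t))" if ab: "a < b"
  proof -
    have xc: "continuous_on {a..b} x" using a by blast
    have ig: "(\<lambda>r. blinfun_apply (g r) v) integrable_on {a..b}" for v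
      using a absolutely_integrable_imp_HK by blast
    have i\<gamma>: "\<gamma> integrable_on {a..b}" using a absolutely_integrable_imp_HK by blast
    have xX: "AE t in lebesgue_on {a..b}. x t = blinfun_apply j (X t)" using a by auto
    define Q where "Q h r = (x r - x (r - h)) \<bullet> x r / h" for h r
    have Qeq: "Q h r = integral {r-h..r} (\<lambda>s. blinfun_apply (g s) (X r)) / h"
      if "x r = blinfun_apply j (X r)" "h > 0" "a \<le> r - h" "r \<le> b" for h r
    proof -
      have "(x r - x (r-h)) \<bullet> blinfun_apply j (X r) = integral {r-h..r} (\<lambda>s. blinfun_apply (g s) (X r))"
        using a that(2,3,4) by simp
      then show ?thesis using that(1) by (simp add: Q_def)
    qed
    have c: "continuous_on {a..b} (\<lambda>r. (norm (x r))\<^sup>2 / 2)" by (intro continuous_intros xc) auto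
    have Qc: "continuous_on {a+h..b} (Q h)" if "h > 0" for h
      unfolding Q_def[abs_def] using that
      by (intro continuous_intros continuous_on_compose2[OF xc]) auto
    have le: "(norm (x r))\<^sup>2 / 2 - (norm (x (r-h)))\<^sup>2 / 2 \<le> h * Q h r" if "h > 0" for r h
    proof -
      have "0 \<le> (norm (x r - x (r - h)))\<^sup>2" by simp
      then have "(norm (x r))\<^sup>2 / 2 - (norm (x (r-h)))\<^sup>2 / 2 \<le> (x r - x (r-h)) \<bullet> x r"
        by (simp add: power2_norm_eq_inner inner_diff_left inner_diff_right inner_commute algebra_simps)
      then show ?thesis using that by (simp add: Q_def)
    qed
    have Qb: "AE r in lebesgue_on {a..b}. \<forall>h>0. a \<le> r - h \<longrightarrow> \<bar>Q h r\<bar> \<le> integral {r-h..r} \<mu> / h + k r"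
      using xX AE_space
    proof eventually_elim
      case (elim r)
      show ?case
      proof (intro allI impI)
        fix h assume h: "h > 0" "a \<le> r - h"
        have sub: "{r-h..r} \<subseteq> {a..b}" using h elim by (auto simp: space_restrict_space)
        have i\<mu>: "\<mu> integrable_on {r-h..r}"
          using integrable_on_subinterval[OF absolutely_integrable_imp_HK[OF mu(1)] sub] .
        have "norm (integral {r-h..r} (\<lambda>s. blinfun_apply (g s) (X r))) \<le> integral {r-h..r} (\<lambda>s. \<mu> s + k r)"
        proof (rule Henstock_Kurzweil_Integration.integral_norm_bound_integral[OF integrable_on_subinterval[OF ig
            sub]])
          show "(\<lambda>s. \<mu> s + k r) integrable_on {r-h..r}" using i\<mu> by (intro integrable_add) auto
          fix s
          have "norm (blinfun_apply (g s) (X r)) \<le> norm (g s) * norm (X r)" by (rule norm_blinfun)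
          also have "\<dots> \<le> \<gamma> s * norm (X r)" using a by (intro mult_right_mono) auto
          also have "\<dots> \<le> \<mu> s + k r" by (rule dom)
          finally show "norm (blinfun_apply (g s) (X r)) \<le> \<mu> s + k r" .
        qed
        also have "\<dots> = integral {r-h..r} \<mu> + h * k r"
          using i\<mu> h by (subst Henstock_Kurzweil_Integration.integral_add) (auto simp: mult.commute)
        finally have "\<bar>integral {r-h..r} (\<lambda>s. blinfun_apply (g s) (X r))\<bar> / h \<le> (integral {r-h..r} \<mu> + h * k r) / h"
          using h by (simp add: divide_right_mono)
        then show "\<bar>Q h r\<bar> \<le> integral {r-h..r} \<mu> / h + k r"
          using Qeq[OF elim(1) h] elim(2) h by (simp add: space_restrict_space add_divide_distrib)
      qed
    qed
    have l: "AE r in lebesgue_on {a..b}. r > a \<longrightarrow>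
      (\<forall>v. ((\<lambda>h. integral {r-h..r} (\<lambda>t. blinfun_apply (g t) v) / h) \<longlongrightarrow> blinfun_apply (g r) v) (at_right 0))"
      using a by (intro weak_Lebesgue_points[OF ig i\<gamma>]) auto
    have Qw: "AE r in lebesgue_on {a..b}. r > a \<longrightarrow> ((\<lambda>h. Q h r) \<longlongrightarrow> blinfun_apply (g r) (X r)) (at_right 0)"
      using l xX AE_space
    proof eventually_elim
      case (elim r)
      show ?case
      proof
        assume ra: "r > a"
        then have "((\<lambda>h. integral {r-h..r} (\<lambda>t. blinfun_apply (g t) (X r)) / h) \<longlongrightarrow> blinfun_apply (g r) (X r))
            (at_right 0)"
          using elim(1) by blast
        then show "((\<lambda>h. Q h r) \<longlongrightarrow> blinfun_apply (g r) (X r)) (at_right 0)"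
        proof (rule Lim_transform_eventually)
          show "\<forall>\<^sub>F h in at_right 0. integral {r-h..r} (\<lambda>t. blinfun_apply (g t) (X r)) / h = Q h r"
            by (rule eventually_at_rightI[of 0 "r - a"], rule Qeq[symmetric, OF elim(2)])
              (use ra elim in \<open>auto simp: space_restrict_space\<close>)
        qed
      qed
    qed
    show ?thesis
      using increment_le_integral_left_derivative[OF ab c mu k Qc le Qb Qw] by blast
  qed
  have "(\<lambda>t. blinfun_apply (g t) (X t)) absolutely_integrable_on {a..b} \<and>
    (norm (x b))\<^sup>2 / 2 - (norm (x a))\<^sup>2 / 2 \<le> integral {a..b} (\<lambda>t. blinfun_apply (g t) (X t))"
  proof (cases "a < b")
    case False
    then have "a = b" using ab by simp
    then show ?thesis using absolutely_integrable_on_null[of a a "\<lambda>t. blinfun_apply (g t) (X t)"] by simp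
  qed (rule *)
  then show "(\<lambda>t. blinfun_apply (g t) (X t)) absolutely_integrable_on {a..b}"
    "(norm (x b))\<^sup>2 / 2 - (norm (x a))\<^sup>2 / 2 \<le> integral {a..b} (\<lambda>t. blinfun_apply (g t) (X t))" by auto
qed

lemma test_function_facts:
  assumes "test_function a b \<phi>"
  shows "\<And>t. (\<phi> has_real_derivative deriv \<phi> t) (at t)" "continuous_on S \<phi>" "continuous_on S (deriv \<phi>)"
    "\<And>t. t \<le> a \<or> b \<le> t \<Longrightarrow> \<phi> t = 0"
proof -
  have d: "(deriv ^^ n) \<phi> differentiable at t" for n t
    using assms by (auto simp: test_function_def differentiable_on_def)
  show "(\<phi> has_real_derivative deriv \<phi> t) (at t)" for t
    using d[of 0 t] by (simp add: DERIV_deriv_iff_real_differentiable)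
  have "continuous_on S ((deriv ^^ n) \<phi>)" for n
    using d by (intro continuous_at_imp_continuous_on ballI differentiable_imp_continuous_within) auto
  from this[of 0] this[of 1] show "continuous_on S \<phi>" "continuous_on S (deriv \<phi>)" by auto
  show "\<phi> t = 0" if "t \<le> a \<or> b \<le> t" for t
  proof -
    obtain K where "K \<subseteq> {a<..<b}" "\<forall>t. t \<notin> K \<longrightarrow> \<phi> t = 0"
      using assms unfolding test_function_def by blast
    then show ?thesis using that by (metis greaterThanLessThan_iff linorder_not_le subsetD)
  qed
qed

text \<open>
  Integration by parts against a test function, the converse of the du Bois-Reymond lemma. The
  one-sided fundamental theorem is applied to \<open>\<phi> c\<close> and to \<open>-\<phi> c\<close>, which vanish at both ends.
\<close>
lemma increment_imp_weak_derivative: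
  fixes c \<gamma> :: "real \<Rightarrow> real"
  assumes ab: "a < b" and c: "continuous_on {a..b} c" and \<gamma>: "\<gamma> absolutely_integrable_on {a..b}"
    and inc: "\<And>s t. a \<le> s \<Longrightarrow> s \<le> t \<Longrightarrow> t \<le> b \<Longrightarrow> c t - c s = integral {s..t} \<gamma>"
    and \<phi>: "test_function a b \<phi>"
  shows "integral {a..b} (\<lambda>t. deriv \<phi> t * c t) = - integral {a..b} (\<lambda>t. \<phi> t * \<gamma> t)"
proof -
  note t = test_function_facts[OF \<phi>]
  have "bounded (c ` {a..b})" "bounded (\<phi> ` {a..b})" "bounded (deriv \<phi> ` {a..b})"
    by (intro compact_imp_bounded compact_continuous_image c t compact_Icc)+
  then obtain C B B' where bd: "\<forall>r\<in>{a..b}. \<bar>c r\<bar> \<le> C" "\<forall>r\<in>{a..b}. \<bar>\<phi> r\<bar> \<le> B" "\<forall>r\<in>{a..b}. \<bar>deriv \<phi> r\<bar> \<le> B'"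
    unfolding bounded_iff by auto
  have pos: "0 \<le> C" "0 \<le> B" "0 \<le> B'" using bd ab by force+
  define W where "W r = \<phi> r * c r" for r
  define Q where "Q h r = (W r - W (r - h)) / h" for h r
  define w where "w r = \<phi> r * \<gamma> r + deriv \<phi> r * c r" for r
  have Wc: "continuous_on {a..b} W" unfolding W_def by (intro continuous_intros c t)
  have Qc: "continuous_on {a+h..b} (Q h)" if "h > 0" for h
    unfolding Q_def[abs_def] using that by (intro continuous_intros continuous_on_compose2[OF Wc]) auto
  have gi: "\<gamma> integrable_on {a..b}" using \<gamma> by (rule absolutely_integrable_imp_HK)
  have ab\<gamma>: "(\<lambda>r. \<bar>\<gamma> r\<bar>) absolutely_integrable_on {a..b}" using \<gamma> by (rule set_integrable_abs)
  have split: "W r - W (r - h) = \<phi> r * (c r - c (r - h)) + c (r - h) * (\<phi> r - \<phi> (r - h))" for r h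
    by (simp add: W_def algebra_simps)
  have Qb: "\<bar>Q h r\<bar> \<le> integral {r-h..r} (\<lambda>s. B * \<bar>\<gamma> s\<bar>) / h + C * B'" if h: "h > 0" "a \<le> r - h" "r \<le> b" for h r
  proof -
    have sub: "{r-h..r} \<subseteq> {a..b}" using h by auto
    have i: "(\<lambda>r. \<bar>\<gamma> r\<bar>) integrable_on {r-h..r}"
      using integrable_on_subinterval[OF absolutely_integrable_imp_HK[OF ab\<gamma>] sub] .
    have "\<bar>c r - c (r - h)\<bar> \<le> integral {r-h..r} (\<lambda>s. \<bar>\<gamma> s\<bar>)"
      using inc[of "r-h" r] h Henstock_Kurzweil_Integration.integral_norm_bound_integral[OF
          integrable_on_subinterval[OF gi sub] i] by simp
    then have 1: "\<bar>\<phi> r * (c r - c (r - h))\<bar> \<le> B * integral {r-h..r} (\<lambda>s. \<bar>\<gamma> s\<bar>)"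
      unfolding abs_mult using bd h pos by (intro mult_mono) auto
    have "\<bar>\<phi> r - \<phi> (r - h)\<bar> \<le> B' * h"
    proof -
      obtain z where "r - h < z" "z < r" "\<phi> r - \<phi> (r - h) = (r - (r - h)) * deriv \<phi> z"
        using MVT2[of "r-h" r \<phi> "deriv \<phi>", OF _ t(1)] h by auto
      then show ?thesis using bd h by (auto simp: abs_mult mult.commute intro!: mult_left_mono)
    qed
    then have 2: "\<bar>c (r - h) * (\<phi> r - \<phi> (r - h))\<bar> \<le> C * (B' * h)"
      unfolding abs_mult using bd h pos by (intro mult_mono) auto
    have "\<bar>W r - W (r - h)\<bar> \<le> B * integral {r-h..r} (\<lambda>s. \<bar>\<gamma> s\<bar>) + C * B' * h"
      unfolding split using 1 2 by linarith
    then have "\<bar>W r - W (r - h)\<bar> / h \<le> (B * integral {r-h..r} (\<lambda>s. \<bar>\<gamma> s\<bar>) + C * B' * h) / h"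
      using h by (simp add: divide_right_mono)
    then show ?thesis using h by (simp add: Q_def add_divide_distrib)
  qed
  obtain N where N: "negligible N" "\<And>r. r \<in> {a<..b} - N \<Longrightarrow> ((\<lambda>h. integral {r-h..r} \<gamma> / h) \<longlongrightarrow> \<gamma> r) (at_right 0)"
    by (rule left_Lebesgue_differentiation[OF gi]) (rule that)
  have Qw: "((\<lambda>h. Q h r) \<longlongrightarrow> w r) (at_right 0)" if r: "r \<in> {a<..b} - N" for r
  proof -
    have hr: "((\<lambda>h. r - h) \<longlongrightarrow> r) (at_right 0)" by (auto intro!: tendsto_eq_intros)
    have fl: "filterlim (\<lambda>h. r - h) (at r) (at_right 0)"
      unfolding filterlim_at using hr by (auto simp: eventually_at_right_field intro!: exI[of _ 1])
    have fl': "filterlim (\<lambda>h. r - h) (at r within {a..b}) (at_right 0)"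
      unfolding filterlim_at using hr r by (auto simp: eventually_at_right_field intro!: exI[of _ "r - a"])
    have "((\<lambda>h. (\<phi> (r - h) - \<phi> r) / (r - h - r)) \<longlongrightarrow> deriv \<phi> r) (at_right 0)"
      using filterlim_compose[OF t(1)[unfolded has_field_derivative_iff] fl] .
    moreover have "(\<phi> (r - h) - \<phi> r) / (r - h - r) = (\<phi> r - \<phi> (r - h)) / h" for h
      by (simp add: minus_divide_right[symmetric] minus_divide_left)
    ultimately have d: "((\<lambda>h. (\<phi> r - \<phi> (r - h)) / h) \<longlongrightarrow> deriv \<phi> r) (at_right 0)" by simp
    have "((c) \<longlongrightarrow> c r) (at r within {a..b})" using c r by (auto simp: continuous_on_def)
    then have cc: "((\<lambda>h. c (r - h)) \<longlongrightarrow> c r) (at_right 0)" using fl' by (rule filterlim_compose)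
    have "((\<lambda>h. \<phi> r * (integral {r-h..r} \<gamma> / h) + c (r - h) * ((\<phi> r - \<phi> (r - h)) / h)) \<longlongrightarrow> \<phi> r * \<gamma> r
        + c r * deriv \<phi> r) (at_right 0)"
      by (intro tendsto_intros N r cc d)
    then have "((\<lambda>h. \<phi> r * (integral {r-h..r} \<gamma> / h) + c (r - h) * ((\<phi> r - \<phi> (r - h)) / h)) \<longlongrightarrow> w r) (at_right 0)"
      by (simp add: w_def mult.commute)
    then show ?thesis
    proof (rule Lim_transform_eventually)
      show "\<forall>\<^sub>F h in at_right 0. \<phi> r * (integral {r-h..r} \<gamma> / h) + c (r - h) * ((\<phi> r - \<phi> (r - h)) / h) = Q h r"
      proof (rule eventually_at_rightI[of 0 "r - a"])
        fix h assume "h \<in> {0<..<r - a}"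
        then have "c r - c (r - h) = integral {r-h..r} \<gamma>" using inc[of "r-h" r] r by simp
        then show "\<phi> r * (integral {r-h..r} \<gamma> / h) + c (r - h) * ((\<phi> r - \<phi> (r - h)) / h) = Q h r"
          unfolding Q_def split by (simp add: add_divide_distrib)
      qed (use r in auto)
    qed
  qed
  have AEN: "AE r in lebesgue_on {a..b}. r \<notin> N \<and> r \<in> {a..b}"
    using negligible_imp_AE_lebesgue_on[OF N(1), of a b] AE_space
        by eventually_elim (simp add: space_restrict_space)
  have mu: "(\<lambda>s. B * \<bar>\<gamma> s\<bar>) absolutely_integrable_on {a..b}" using ab\<gamma> by (rule set_integrable_mult_right)
  have k: "(\<lambda>s. C * B') absolutely_integrable_on {a..b}" by (rule absolutely_integrable_continuous_real) auto
  have B0: "B * \<bar>\<gamma> r\<bar> \<ge> 0" "C * B' \<ge> 0" for r using pos by auto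
  have QbA: "AE r in lebesgue_on {a..b}. \<forall>h>0. a \<le> r - h \<longrightarrow> \<bar>Q h r\<bar> \<le> integral {r-h..r} (\<lambda>s. B * \<bar>\<gamma> s\<bar>) / h + C * B'"
    using AEN by eventually_elim (use Qb in auto)
  then have QbA': "AE r in lebesgue_on {a..b}. \<forall>h>0. a \<le> r - h \<longrightarrow> \<bar>- Q h r\<bar> \<le> integral {r-h..r} (\<lambda>s. B * \<bar>\<gamma> s\<bar>) / h
      + C * B'"
    by simp
  have QwA: "AE r in lebesgue_on {a..b}. r > a \<longrightarrow> ((\<lambda>h. Q h r) \<longlongrightarrow> w r) (at_right 0)"
    using AEN by eventually_elim (use Qw in auto)
  then have QwA': "AE r in lebesgue_on {a..b}. r > a \<longrightarrow> ((\<lambda>h. - Q h r) \<longlongrightarrow> - w r) (at_right 0)"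
    by eventually_elim (auto intro: tendsto_minus)
  have WQ: "W r - W (r-h) \<le> h * Q h r" "(- W r) - (- W (r-h)) \<le> h * - Q h r" if "h > 0" for r h
    using that by (simp_all add: Q_def)
  have 1: "w absolutely_integrable_on {a..b}" "W b - W a \<le> integral {a..b} w"
    using increment_le_integral_left_derivative[OF ab Wc mu B0(1) k B0(2) Qc WQ(1) QbA QwA] by auto
  have 2: "(- W b) - (- W a) \<le> integral {a..b} (\<lambda>r. - w r)"
    using increment_le_integral_left_derivative(2)[OF ab continuous_on_minus[OF Wc] mu B0(1) k B0(2)
        continuous_on_minus[OF Qc] WQ(2) QbA' QwA'] by auto
  have W0: "W a = 0" "W b = 0" by (simp_all add: W_def t(4))
  have "integral {a..b} w = 0" using 1(2) 2 absolutely_integrable_imp_HK[OF 1(1)] by (simp add: W0)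
  moreover have "integral {a..b} w = integral {a..b} (\<lambda>r. \<phi> r * \<gamma> r) + integral {a..b} (\<lambda>r. deriv \<phi> r * c r)"
    unfolding w_def
  proof (rule Henstock_Kurzweil_Integration.integral_add)
    show i2: "(\<lambda>r. deriv \<phi> r * c r) integrable_on {a..b}"
      by (intro integrable_continuous_interval continuous_intros t c)
    have "(\<lambda>r. w r - deriv \<phi> r * c r) integrable_on {a..b}"
      by (intro integrable_diff absolutely_integrable_imp_HK[OF 1(1)] i2)
    then show "(\<lambda>r. \<phi> r * \<gamma> r) integrable_on {a..b}" by (simp add: w_def)
  qed
  ultimately show ?thesis by simp
qed

section \<open>The evolution equation with a monotone operator\<close>

lemma le_one_plus_powr: "y \<le> 1 + y powr r" if "r \<ge> 1" "y \<ge> 0" for y r :: real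
proof (cases "y \<le> 1")
  case False
  then have "y powr 1 \<le> y powr r" using that by (intro powr_mono) auto
  then show ?thesis using that by simp
qed (simp add: add_increasing2)

lemma Youngs_inequality_weak:
  fixes p q :: real
  assumes "p > 1" "q > 1" "1/p + 1/q = 1" "a \<ge> 0" "b \<ge> 0"
  shows "a * b \<le> a powr q + b powr p"
proof -
  have "a * b \<le> a powr q / q + b powr p / p" using Youngs_inequality[of q p a b] assms by (simp add: add.commute)
  also have "a powr q / q \<le> a powr q / 1" using assms by (intro divide_left_mono) auto
  also have "b powr p / p \<le> b powr p / 1" using assms by (intro divide_left_mono) auto
  finally show ?thesis by simp
qed

lemma Lp_fun_norm_integrable:
  fixes f :: "real \<Rightarrow> 'b::real_normed_vector"
  assumes "Lp_fun r {a..b} f" "r \<ge> 1"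
  shows "(\<lambda>t. norm (f t)) absolutely_integrable_on {a..b}"
    "(\<lambda>t. norm (f t) powr r) absolutely_integrable_on {a..b}"
proof -
  note bo = absolutely_integrable_iff_integrable_lebesgue_on
  show 1: "(\<lambda>t. norm (f t) powr r) absolutely_integrable_on {a..b}"
    using assms by (simp add: bo Lp_fun_def)
  have m: "(\<lambda>t. norm (f t)) \<in> borel_measurable (lebesgue_on {a..b})"
    using assms by (auto simp: Lp_fun_def)
  have "(\<lambda>t. 1 + norm (f t) powr r) absolutely_integrable_on {a..b}"
    by (intro set_integral_add(1) 1 absolutely_integrable_continuous_real continuous_intros)
  then show "(\<lambda>t. norm (f t)) absolutely_integrable_on {a..b}"
    unfolding bo
    by (rule Bochner_Integration.integrable_bound[OF _ m])
      (use assms in \<open>auto simp: abs_of_nonneg le_one_plus_powr\<close>)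
qed

lemma blinfun_apply_measurable:
  assumes "g \<in> borel_measurable M"
  shows "(\<lambda>t. blinfun_apply (g t) v) \<in> borel_measurable M"
  by (rule measurable_compose[OF assms borel_measurable_continuous_onI]) (intro continuous_intros)

lemma to_dual_apply: "blinfun_apply (to_dual j f) v = f \<bullet> blinfun_apply j v"
  by (simp add: to_dual_def)

lemma test_function_pairings:
  fixes j :: "'v::{banach,second_countable_topology} \<Rightarrow>\<^sub>L 'h::{real_inner,banach}"
  assumes \<phi>: "test_function a b \<phi>" and X: "X \<in> borel_measurable (lebesgue_on {a..b})"
    and x: "continuous_on {a..b} x" "AE t in lebesgue_on {a..b}. x t = blinfun_apply j (X t)"
    and g: "(\<lambda>t. blinfun_apply (g t) v) absolutely_integrable_on {a..b}"
  shows "(LINT r:{a..b}|lebesgue. deriv \<phi> r * blinfun_apply (to_dual j (blinfun_apply j (X r))) v)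
      = integral {a..b} (\<lambda>r. deriv \<phi> r * (x r \<bullet> blinfun_apply j v))"
    "(LINT r:{a..b}|lebesgue. \<phi> r * blinfun_apply (g r) v) = integral {a..b} (\<lambda>r. \<phi> r * blinfun_apply (g r) v)"
proof -
  note t = test_function_facts[OF \<phi>] and bo = absolutely_integrable_iff_integrable_lebesgue_on
  have Xv: "(\<lambda>t. blinfun_apply j (X t) \<bullet> blinfun_apply j v) \<in> borel_measurable (lebesgue_on {a..b})"
    by (rule measurable_compose[OF X borel_measurable_continuous_onI]) (intro continuous_intros)
  have d: "deriv \<phi> \<in> borel_measurable (lebesgue_on {a..b})"
    by (rule continuous_imp_measurable_on_sets_lebesgue[OF t(3)]) simp
  have i: "(\<lambda>r. deriv \<phi> r * (x r \<bullet> blinfun_apply j v)) absolutely_integrable_on {a..b}"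
    by (intro absolutely_integrable_continuous_real continuous_intros t x)
  have "(LINT r:{a..b}|lebesgue. deriv \<phi> r * blinfun_apply (to_dual j (blinfun_apply j (X r))) v)
      = integral\<^sup>L (lebesgue_on {a..b}) (\<lambda>r. deriv \<phi> r * (blinfun_apply j (X r) \<bullet> blinfun_apply j v))"
    by (simp add: set_lebesgue_integral_def to_dual_apply integral_restrict_space)
  also have "\<dots> = integral\<^sup>L (lebesgue_on {a..b}) (\<lambda>r. deriv \<phi> r * (x r \<bullet> blinfun_apply j v))"
  proof (rule integral_cong_AE)
    show "(\<lambda>r. deriv \<phi> r * (x r \<bullet> blinfun_apply j v)) \<in> borel_measurable (lebesgue_on {a..b})"
      using i by (auto simp: bo)
    show "AE r in lebesgue_on {a..b}. deriv \<phi> r * (blinfun_apply j (X r) \<bullet> blinfun_apply j v)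
        = deriv \<phi> r * (x r \<bullet> blinfun_apply j v)"
      using x(2) by eventually_elim simp
  qed (intro borel_measurable_times d Xv)
  also have "\<dots> = integral {a..b} (\<lambda>r. deriv \<phi> r * (x r \<bullet> blinfun_apply j v))"
    using i by (simp add: bo lebesgue_integral_eq_integral)
  finally show "(LINT r:{a..b}|lebesgue. deriv \<phi> r * blinfun_apply (to_dual j (blinfun_apply j (X r))) v) = \<dots>" .
  have "(\<lambda>r. \<phi> r * blinfun_apply (g r) v) absolutely_integrable_on {a..b}"
    by (intro absolutely_integrable_bounded_measurable_product_real g
          continuous_imp_measurable_on_sets_lebesgue t compact_imp_bounded compact_continuous_image) auto
  then show "(LINT r:{a..b}|lebesgue. \<phi> r * blinfun_apply (g r) v) = integral {a..b} (\<lambda>r. \<phi> r * blinfun_apply (g r)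
      v)"
    by (rule set_lebesgue_integral_eq_integral)
qed

lemma W_pq_imp_weak_evolution:
  fixes j :: "'v::{banach,second_countable_topology} \<Rightarrow>\<^sub>L 'h::{real_inner,banach}"
  assumes W: "W_pq p q j a b X X'" and pq: "p \<ge> 1" "q \<ge> 1" and ab: "a < b"
    and x: "continuous_on {a..b} x" "AE t in lebesgue_on {a..b}. x t = blinfun_apply j (X t)"
  shows "weak_evolution j a b x X X' (\<lambda>t. norm (X' t))"
proof -
  have LX: "Lp_fun p {a..b} X" and LX': "Lp_fun q {a..b} X'" and gd: "generalized_derivative j a b X X'"
    using W by (auto simp: W_pq_def)
  have nX': "(\<lambda>t. norm (X' t)) absolutely_integrable_on {a..b}"
    using Lp_fun_norm_integrable(1)[OF LX' pq(2)] .
  have X'm: "X' \<in> borel_measurable (lebesgue_on {a..b})" and Xm: "X \<in> borel_measurable (lebesgue_on {a..b})"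
    using LX LX' by (auto simp: Lp_fun_def)
  note bo = absolutely_integrable_iff_integrable_lebesgue_on
  have iX': "(\<lambda>t. blinfun_apply (X' t) v) absolutely_integrable_on {a..b}" for v
  proof -
    have "(\<lambda>t. norm (X' t) * norm v) absolutely_integrable_on {a..b}" using nX' by (rule set_integrable_mult_left)
    then show ?thesis unfolding bo
      by (rule Bochner_Integration.integrable_bound[OF _ blinfun_apply_measurable[OF X'm]])
        (use norm_blinfun[of "_ :: 'v \<Rightarrow>\<^sub>L real" v, unfolded real_norm_def] in \<open>auto intro!: AE_I2\<close>)
  qed
  have inc: "(x t - x s) \<bullet> blinfun_apply j v = integral {s..t} (\<lambda>r. blinfun_apply (X' r) v)"
    if st: "a \<le> s" "s \<le> t" "t \<le> b" for s t v
  proof -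
    have "x t \<bullet> blinfun_apply j v - x s \<bullet> blinfun_apply j v = integral {s..t} (\<lambda>r. blinfun_apply (X' r) v)"
    proof (rule weak_derivative_imp_increment[OF _ iX' _ st])
      show xc: "continuous_on {a..b} (\<lambda>t. x t \<bullet> blinfun_apply j v)" by (intro continuous_intros x)
      fix \<phi> assume \<phi>: "test_function a b \<phi>"
      note LR = test_function_pairings[OF \<phi> Xm x iX']
      have "(LINT r:{a..b}|lebesgue. deriv \<phi> r * blinfun_apply (to_dual j (blinfun_apply j (X r))) v)
          = - (LINT r:{a..b}|lebesgue. \<phi> r * blinfun_apply (X' r) v)"
        using gd \<phi> unfolding generalized_derivative_def by blast
      then show "integral {a..b} (\<lambda>r. deriv \<phi> r * (x r \<bullet> blinfun_apply j v))
          = - integral {a..b} (\<lambda>r. \<phi> r * blinfun_apply (X' r) v)"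
        unfolding LR .
    qed
    then show ?thesis by (simp add: inner_diff_left)
  qed
  show ?thesis
    unfolding weak_evolution_def by (intro conjI allI impI x nX' iX' order_refl) (rule inc)
qed

lemma weak_evolution_imp_W_pq:
  fixes j :: "'v::{banach,second_countable_topology} \<Rightarrow>\<^sub>L 'h::{real_inner,banach}"
  assumes ev: "weak_evolution j a b x X X' \<gamma>" and ab: "a < b"
    and LX: "Lp_fun p {a..b} X" and LX': "Lp_fun q {a..b} X'"
  shows "W_pq p q j a b X X'"
proof -
  note e = ev[unfolded weak_evolution_def]
  have Xm: "X \<in> borel_measurable (lebesgue_on {a..b})"
    using LX by (auto simp: Lp_fun_def)
  have "generalized_derivative j a b X X'"
    unfolding generalized_derivative_def
  proof (intro allI impI)
    fix \<phi> v assume \<phi>: "test_function a b \<phi>"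
    have x: "continuous_on {a..b} x" "AE t in lebesgue_on {a..b}. x t = blinfun_apply j (X t)" using e by blast+
    have iX': "(\<lambda>t. blinfun_apply (X' t) v) absolutely_integrable_on {a..b}" using e by blast
    show "(LINT t:{a..b}|lebesgue. deriv \<phi> t * blinfun_apply (to_dual j (blinfun_apply j (X t))) v)
        = - (LINT t:{a..b}|lebesgue. \<phi> t * blinfun_apply (X' t) v)"
      unfolding test_function_pairings[OF \<phi> Xm x iX']
    proof (rule increment_imp_weak_derivative[OF ab _ iX' _ \<phi>])
      show "continuous_on {a..b} (\<lambda>t. x t \<bullet> blinfun_apply j v)" by (intro continuous_intros x)
      show "x t \<bullet> blinfun_apply j v - x s \<bullet> blinfun_apply j v = integral {s..t} (\<lambda>r. blinfun_apply (X' r) v)"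
        if "a \<le> s" "s \<le> t" "t \<le> b" for s t
        using e that by (simp add: inner_diff_left[symmetric])
    qed
  qed
  then show ?thesis using LX LX' by (simp add: W_pq_def)
qed

text \<open>Measurability needs no separability of \<open>H\<close>, since \<open>x\<close> is a limit of step functions.\<close>
lemma inner_continuous_measurable:
  fixes f x :: "real \<Rightarrow> 'h::real_inner"
  assumes f: "f \<in> borel_measurable (lebesgue_on {a..b})" and x: "continuous_on {a..b} x" and ab: "a \<le> b"
  shows "(\<lambda>t. f t \<bullet> x t) \<in> borel_measurable (lebesgue_on {a..b})"
proof -
  \<comment> \<open>Sampling \<open>x\<close> at multiples of \<open>1/n\<close>, clipped to the interval.\<close>
  define c where "c n t = max a (min b (real_of_int \<lfloor>real n * t\<rfloor> / real n))" for n t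
  have m: "(\<lambda>t. f t \<bullet> x (c n t)) \<in> borel_measurable (lebesgue_on {a..b})" for n
  proof -
    have "(\<lambda>t. f t \<bullet> x (max a (min b (real_of_int i / real n)))) \<in> borel_measurable (lebesgue_on {a..b})" for i
      by (rule measurable_compose[OF f borel_measurable_continuous_onI]) (intro continuous_intros)
    moreover have "(\<lambda>t. \<lfloor>real n * t\<rfloor>) \<in> lebesgue_on {a..b} \<rightarrow>\<^sub>M count_space UNIV"
    proof -
      have "(\<lambda>t. real n * t) \<in> borel_measurable (lebesgue_on {a..b})"
        by (rule continuous_imp_measurable_on_sets_lebesgue) (auto intro!: continuous_intros)
      then show ?thesis by measurable
    qed
    ultimately show ?thesis unfolding c_def by (rule measurable_compose_countable)
  qed
  show ?thesis
  proof (rule borel_measurable_LIMSEQ_real[OF _ m])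
    fix t assume "t \<in> space (lebesgue_on {a..b})"
    then have t: "t \<in> {a..b}" by (simp add: space_restrict_space)
    have "(\<lambda>n. real_of_int \<lfloor>real n * t\<rfloor> / real n) \<longlonglongrightarrow> t"
    proof (rule LIMSEQ_I)
      fix e :: real assume "e > 0"
      then obtain N where N: "N > 0" "inverse (real N) < e" using reals_Archimedean by (metis zero_less_Suc)
      show "\<exists>no. \<forall>n\<ge>no. norm (real_of_int \<lfloor>real n * t\<rfloor> / real n - t) < e"
      proof (intro exI allI impI)
        fix n assume n: "n \<ge> N"
        then have n0: "real n > 0" using N by simp
        have "\<bar>real_of_int \<lfloor>real n * t\<rfloor> - real n * t\<bar> \<le> 1" by linarith
        then have "\<bar>real_of_int \<lfloor>real n * t\<rfloor> - real n * t\<bar> / real n \<le> inverse (real n)"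
          using n0 by (simp add: divide_right_mono inverse_eq_divide)
        also have "\<bar>real_of_int \<lfloor>real n * t\<rfloor> - real n * t\<bar> / real n = \<bar>real_of_int \<lfloor>real n * t\<rfloor> / real n - t\<bar>"
        proof -
          have "real_of_int \<lfloor>real n * t\<rfloor> / real n - t = (real_of_int \<lfloor>real n * t\<rfloor> - real n * t) / real n"
            using n0 by (simp add: diff_divide_distrib)
          then show ?thesis using n0 by (simp add: abs_divide)
        qed
        also have "inverse (real n) \<le> inverse (real N)" using n N by (intro le_imp_inverse_le) auto
        finally show "norm (real_of_int \<lfloor>real n * t\<rfloor> / real n - t) < e" using N by simp
      qed
    qed
    then have "(\<lambda>n. c n t) \<longlonglongrightarrow> max a (min b t)" unfolding c_def by (intro tendsto_intros)
    then have "(\<lambda>n. c n t) \<longlonglongrightarrow> t" using t by simp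
    then have "(\<lambda>n. x (c n t)) \<longlonglongrightarrow> x t"
      by (rule continuous_on_tendsto_compose[OF x]) (use t ab in \<open>auto simp: c_def\<close>)
    then show "(\<lambda>n. f t \<bullet> x (c n t)) \<longlonglongrightarrow> f t \<bullet> x t" by (intro tendsto_intros)
  qed
qed

lemma inner_absolutely_integrable:
  fixes f x :: "real \<Rightarrow> 'h::real_inner"
  assumes f: "f \<in> borel_measurable (lebesgue_on {a..b})" "(\<lambda>t. norm (f t)) absolutely_integrable_on {a..b}"
    and x: "continuous_on {a..b} x"
  shows "(\<lambda>t. f t \<bullet> x t) absolutely_integrable_on {a..b}"
proof (cases "a \<le> b")
  case True
  note bo = absolutely_integrable_iff_integrable_lebesgue_on
  have "bounded (x ` {a..b})" by (intro compact_imp_bounded compact_continuous_image x compact_Icc)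
  then obtain B where B: "\<forall>t\<in>{a..b}. norm (x t) \<le> B" unfolding bounded_iff by auto
  have "(\<lambda>t. norm (f t) * B) absolutely_integrable_on {a..b}" using f(2) by (rule set_integrable_mult_left)
  then show ?thesis unfolding bo
  proof (rule Bochner_Integration.integrable_bound[OF _ inner_continuous_measurable[OF f(1) x True]])
    show "AE t in lebesgue_on {a..b}. norm (f t \<bullet> x t) \<le> norm (norm (f t) * B)"
    proof (rule AE_I2)
      fix t assume "t \<in> space (lebesgue_on {a..b})"
      then have "norm (x t) \<le> B" using B by (simp add: space_restrict_space)
      have "norm (f t \<bullet> x t) \<le> norm (f t) * norm (x t)" using Cauchy_Schwarz_ineq2 by simp
      also have "\<dots> \<le> norm (f t) * B" using \<open>norm (x t) \<le> B\<close> by (intro mult_left_mono) auto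
      also have "\<dots> \<le> norm (norm (f t) * B)" by simp
      finally show "norm (f t \<bullet> x t) \<le> norm (norm (f t) * B)" .
    qed
  qed
qed simp

text \<open>
  The evolution triple and the operator, with all their hypotheses.
\<close>
locale evolution_problem =
  fixes T p q :: real
    and j :: "'v::{banach,second_countable_topology} \<Rightarrow>\<^sub>L 'h::{real_inner,banach}"
    and A :: "real \<Rightarrow> 'v \<Rightarrow> ('v \<Rightarrow>\<^sub>L real)"
  assumes T: "T > 0" and p: "p \<ge> 2" and q: "q > 1" and pq: "1 / p + 1 / q = 1"
    and triple: "evolution_triple j"
    and A: "admissible_operator T p q A"
begin

text \<open>
  \<open>x\<close> solves \<open>x' + A(t,x) = f\<close> on \<open>[t\<^sub>0,T]\<close> in integrated form, with \<open>V\<close>-valued version \<open>X\<close> and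
  derivative \<open>g\<close>. On continuous paths it is equivalent to \<open>f\<close> being a forcing of \<open>x\<close>.
\<close>
definition evolves :: "real \<Rightarrow> (real \<Rightarrow> 'h) \<Rightarrow> (real \<Rightarrow> 'h) \<Rightarrow> (real \<Rightarrow> 'v) \<Rightarrow> (real \<Rightarrow> ('v \<Rightarrow>\<^sub>L real)) \<Rightarrow> bool" where
  "evolves t\<^sub>0 x f X g \<longleftrightarrow> Lp_fun 2 {t\<^sub>0..T} f \<and> Lp_fun p {t\<^sub>0..T} X \<and> Lp_fun q {t\<^sub>0..T} g \<and>
     weak_evolution j t\<^sub>0 T x X g (\<lambda>t. norm (g t)) \<and>
     (AE t in lebesgue_on {t\<^sub>0..T}. g t + A t (X t) = to_dual j (f t))"

lemma C_paths_continuous: "x \<in> C_paths T \<Longrightarrow> 0 \<le> a \<Longrightarrow> b \<le> T \<Longrightarrow> continuous_on {a..b} x"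
  by (auto simp: C_paths_def intro: continuous_on_subset)

lemma is_forcing_iff_evolves:
  assumes x: "x \<in> C_paths T" and t0: "0 \<le> t\<^sub>0" "t\<^sub>0 < T"
  shows "is_forcing T p q j A t\<^sub>0 x f \<longleftrightarrow> (\<exists>X g. evolves t\<^sub>0 x f X g)"
proof
  have xc: "continuous_on {t\<^sub>0..T} x" using C_paths_continuous[OF x] t0 by simp
  assume "is_forcing T p q j A t\<^sub>0 x f"
  then obtain X g where W: "W_pq p q j t\<^sub>0 T X g" and ae: "AE t in lebesgue_on {t\<^sub>0..T}. x t
      = blinfun_apply j (X t)"
    "AE t in lebesgue_on {t\<^sub>0..T}. g t + A t (X t) = to_dual j (f t)" "Lp_fun 2 {t\<^sub>0..T} f"
    unfolding is_forcing_def by blast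
  have "weak_evolution j t\<^sub>0 T x X g (\<lambda>t. norm (g t))"
    using p q t0 by (intro W_pq_imp_weak_evolution[OF W _ _ _ xc ae(1)]) auto
  then have "evolves t\<^sub>0 x f X g" using W ae by (simp add: evolves_def W_pq_def)
  then show "\<exists>X g. evolves t\<^sub>0 x f X g" by blast
next
  assume "\<exists>X g. evolves t\<^sub>0 x f X g"
  then obtain X g where e: "evolves t\<^sub>0 x f X g" by blast
  then have "W_pq p q j t\<^sub>0 T X g" unfolding evolves_def using weak_evolution_imp_W_pq t0 by blast
  moreover have "AE t in lebesgue_on {t\<^sub>0..T}. x t = blinfun_apply j (X t)"
    using e by (auto simp: evolves_def weak_evolution_def)
  ultimately show "is_forcing T p q j A t\<^sub>0 x f"
    using e unfolding is_forcing_def evolves_def by blast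
qed

lemma to_dual_inject: "to_dual j f = to_dual j g \<longleftrightarrow> f = g"
proof
  assume "to_dual j f = to_dual j g"
  then have "f \<bullet> blinfun_apply j v = g \<bullet> blinfun_apply j v" for v by (metis to_dual_apply)
  then have z: "(f - g) \<bullet> w = 0" if "w \<in> range (blinfun_apply j)" for w
    using that by (auto simp: inner_diff_left)
  have "(f - g) \<bullet> (f - g) = 0"
    by (rule continuous_constant_on_closure[of "range (blinfun_apply j)" "\<lambda>w. (f - g) \<bullet> w"])
      (use z triple in \<open>auto simp: evolution_triple_def intro!: continuous_intros\<close>)
  then show "f = g" by simp
qed simp

lemma forcing_unique:
  assumes "evolves t\<^sub>0 x f X g" "evolves t\<^sub>0 x f' X' g'"
  shows "AE t in lebesgue_on {t\<^sub>0..T}. f t = f' t"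
proof -
  have "inj (blinfun_apply j)" using triple by (simp add: evolution_triple_def)
  then have "AE t in lebesgue_on {t\<^sub>0..T}. X t = X' t \<and> g t = g' t"
    using assms unfolding evolves_def by (intro weak_evolution_unique) auto
  moreover have "AE t in lebesgue_on {t\<^sub>0..T}. g t + A t (X t) = to_dual j (f t)"
     "AE t in lebesgue_on {t\<^sub>0..T}. g' t + A t (X' t) = to_dual j (f' t)" using assms by (auto simp: evolves_def)
  ultimately show ?thesis by eventually_elim (metis to_dual_inject)
qed

lemma forcing_measurable:
  assumes "evolves t\<^sub>0 x f X g" "t\<^sub>0 \<le> s" "t \<le> T"
  shows "f \<in> borel_measurable (lebesgue_on {s..t})" "(\<lambda>t. norm (f t)) absolutely_integrable_on {s..t}"
proof -
  have L: "Lp_fun 2 {t\<^sub>0..T} f" using assms by (simp add: evolves_def)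
  show "f \<in> borel_measurable (lebesgue_on {s..t})"
    by (rule measurable_restrict_mono[of _ _ "{t\<^sub>0..T}"]) (use L assms in \<open>auto simp: Lp_fun_def\<close>)
  show "(\<lambda>t. norm (f t)) absolutely_integrable_on {s..t}"
    by (rule absolutely_integrable_on_subinterval[where S = "{t\<^sub>0..T}"]) (use Lp_fun_norm_integrable(1)[OF L] assms
        in auto)
qed

lemma energy_difference:
  assumes e: "evolves t\<^sub>0 x f X g" "evolves t\<^sub>0 y k Y m" and st: "t\<^sub>0 \<le> s" "s \<le> t" "t \<le> T" "0 \<le> t\<^sub>0"
  shows "(\<lambda>r. (f r - k r) \<bullet> (x r - y r)) absolutely_integrable_on {s..t}"
   "(norm (x t - y t))\<^sup>2 / 2 - (norm (x s - y s))\<^sup>2 / 2 \<le> integral {s..t} (\<lambda>r. (f r - k r) \<bullet> (x r - y r))"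
proof -
  have d: "weak_evolution j s t (\<lambda>t. x t - y t) (\<lambda>t. X t - Y t) (\<lambda>t. g t - m t) (\<lambda>t. norm (g t) + norm (m t))"
    using e by (intro weak_evolution_subinterval[OF weak_evolution_diff st(1,3)]) (simp_all add: evolves_def)
  have sub: "{s..t} \<subseteq> {t\<^sub>0..T}" using st by auto
  have i: "(\<lambda>t. norm (X t) powr p) absolutely_integrable_on {t\<^sub>0..T}"
      "(\<lambda>t. norm (Y t) powr p) absolutely_integrable_on {t\<^sub>0..T}"
     "(\<lambda>t. norm (g t) powr q) absolutely_integrable_on {t\<^sub>0..T}" "(\<lambda>t. norm (m t) powr q) absolutely_integrable_on
         {t\<^sub>0..T}"
    using e p q by (auto simp: evolves_def intro: Lp_fun_norm_integrable)
  note i' = i[THEN absolutely_integrable_on_subinterval, OF sub]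
  define mu where "mu r = 2 * (norm (g r) powr q + norm (m r) powr q)" for r
  define kk where "kk r = 2 * (norm (X r) powr p + norm (Y r) powr p)" for r
  have mu: "mu absolutely_integrable_on {s..t}" "mu r \<ge> 0" for r
    unfolding mu_def[abs_def] by (intro set_integrable_mult_right set_integral_add(1) i') simp
  have kk: "kk absolutely_integrable_on {s..t}" "kk r \<ge> 0" for r
    unfolding kk_def[abs_def] by (intro set_integrable_mult_right set_integral_add(1) i') simp
  have yg: "norm u * norm w \<le> norm u powr q + norm w powr p" for u :: "'v \<Rightarrow>\<^sub>L real" and w :: 'v
    using p q pq by (intro Youngs_inequality_weak) auto
  have dom: "(norm (g s) + norm (m s)) * norm (X r - Y r) \<le> mu s + kk r" for s r
  proof -
    have "(norm (g s) + norm (m s)) * norm (X r - Y r) \<le> (norm (g s) + norm (m s)) * (norm (X r) + norm (Y r))"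
      by (intro mult_left_mono norm_triangle_ineq4) auto
    also have "\<dots> \<le> mu s + kk r"
      using yg[of "g s" "X r"] yg[of "g s" "Y r"] yg[of "m s" "X r"] yg[of "m s" "Y r"]
      by (simp add: mu_def kk_def algebra_simps)
    finally show ?thesis .
  qed
  note en = energy_inequality[OF d st(2) mu kk dom]
  have xy: "continuous_on {t\<^sub>0..T} (\<lambda>t. x t - y t)"
    using e by (intro continuous_on_diff) (auto simp: evolves_def weak_evolution_def)
  have x': "continuous_on {s..t} (\<lambda>t. x t - y t)" using xy sub by (rule continuous_on_subset)
  have "(\<lambda>r. f r \<bullet> (x r - y r) - k r \<bullet> (x r - y r)) absolutely_integrable_on {s..t}"
    using forcing_measurable[OF e(1) st(1,3)] forcing_measurable[OF e(2) st(1,3)] x'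
    by (intro set_integral_diff(1) inner_absolutely_integrable)
  then show fi: "(\<lambda>r. (f r - k r) \<bullet> (x r - y r)) absolutely_integrable_on {s..t}"
    by (simp add: inner_diff_left)
  have mono: "AE t in lebesgue_on {s..t}. \<forall>x y. blinfun_apply (A t x - A t y) (x - y) \<ge> 0"
  proof -
    have "AE t in lebesgue_on {0..T}. \<forall>x y. blinfun_apply (A t x - A t y) (x - y) \<ge> 0"
      using A by (simp add: admissible_operator_def)
    then show ?thesis by (rule AE_lebesgue_on_subset) (use st in auto)
  qed
  have ae: "AE t in lebesgue_on {s..t}. g t + A t (X t) = to_dual j (f t)" "AE t in lebesgue_on {s..t}. m t
      + A t (Y t) = to_dual j (k t)"
    using e by (auto simp: evolves_def intro: AE_lebesgue_on_subset[OF _ sub])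
  have xX: "AE t in lebesgue_on {s..t}. x t - y t = blinfun_apply j (X t - Y t)" using d
      by (simp add: weak_evolution_def)
  have le: "AE r in lebesgue_on {s..t}. blinfun_apply (g r - m r) (X r - Y r) \<le> (f r - k r) \<bullet> (x r - y r)"
    using mono ae xX
  proof eventually_elim
    case (elim r)
    have g: "g r = to_dual j (f r) - A r (X r)" "m r = to_dual j (k r) - A r (Y r)"
      using elim(2,3) by (simp_all add: eq_diff_eq)
    have "blinfun_apply (g r - m r) (X r - Y r) = (f r - k r) \<bullet> (x r - y r) - blinfun_apply (A r (X r)
        - A r (Y r)) (X r - Y r)"
      unfolding g elim(4) by (simp add: blinfun.diff_left to_dual_apply inner_diff_left)
    then show ?case using elim(1)[rule_format, of "X r" "Y r"] by linarith
  qed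
  note bo = absolutely_integrable_iff_integrable_lebesgue_on
  have "integral {s..t} (\<lambda>r. blinfun_apply (g r - m r) (X r - Y r))
      = integral\<^sup>L (lebesgue_on {s..t}) (\<lambda>r. blinfun_apply (g r - m r) (X r - Y r))"
    using en(1) by (simp add: bo lebesgue_integral_eq_integral)
  also have "\<dots> \<le> integral\<^sup>L (lebesgue_on {s..t}) (\<lambda>r. (f r - k r) \<bullet> (x r - y r))"
    using en(1) fi le by (intro integral_mono_AE) (auto simp: bo)
  also have "\<dots> = integral {s..t} (\<lambda>r. (f r - k r) \<bullet> (x r - y r))"
    using fi by (simp add: bo lebesgue_integral_eq_integral)
  finally show "(norm (x t - y t))\<^sup>2 / 2 - (norm (x s - y s))\<^sup>2 / 2 \<le> integral {s..t} (\<lambda>r. (f r - k r) \<bullet> (x r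
      - y r))"
    using en(2) by linarith
qed

lemma energy_single:
  obtains c\<^sub>2 where "c\<^sub>2 > 0" "\<And>t\<^sub>0 x f X g s t. \<lbrakk>evolves t\<^sub>0 x f X g; t\<^sub>0 \<le> s; s \<le> t; t \<le> T; 0 \<le> t\<^sub>0\<rbrakk> \<Longrightarrow>
    (\<lambda>r. f r \<bullet> x r) absolutely_integrable_on {s..t} \<and>
   (norm (x t))\<^sup>2 / 2 - (norm (x s))\<^sup>2 / 2 + c\<^sub>2 * integral {s..t} (\<lambda>r. norm (X r) powr p)
       \<le> integral {s..t} (\<lambda>r. f r \<bullet> x r)"
proof -
  obtain c\<^sub>2 where c2: "c\<^sub>2 > 0" "AE t in lebesgue_on {0..T}. \<forall>x. blinfun_apply (A t x) x \<ge> c\<^sub>2 * norm x powr p"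
    using A unfolding admissible_operator_def by blast
  show thesis
  proof (rule that[OF c2(1)])
    fix t\<^sub>0 x f X g s t
    assume e: "evolves t\<^sub>0 x f X g" and st: "t\<^sub>0 \<le> s" "s \<le> t" "t \<le> T" "0 \<le> t\<^sub>0"
    have d: "weak_evolution j s t x X g (\<lambda>t. norm (g t))"
      using e by (intro weak_evolution_subinterval[OF _ st(1,3)]) (simp add: evolves_def)
    have sub: "{s..t} \<subseteq> {t\<^sub>0..T}" using st by auto
    have i: "(\<lambda>t. norm (X t) powr p) absolutely_integrable_on {t\<^sub>0..T}"
     "(\<lambda>t. norm (g t) powr q) absolutely_integrable_on {t\<^sub>0..T}"
      using e p q by (auto simp: evolves_def intro: Lp_fun_norm_integrable)
    note i' = i[THEN absolutely_integrable_on_subinterval, OF sub]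
    have dom: "norm (g s) * norm (X r) \<le> norm (g s) powr q + norm (X r) powr p" for s r
      using p q pq by (intro Youngs_inequality_weak) auto
    note en = energy_inequality[OF d st(2) i'(2) _ i'(1) _ dom, simplified]
    have x': "continuous_on {s..t} x" using d by (simp add: weak_evolution_def)
    have fi: "(\<lambda>r. f r \<bullet> x r) absolutely_integrable_on {s..t}"
      using forcing_measurable[OF e(1) st(1,3)] x' by (intro inner_absolutely_integrable)
    have co: "AE t in lebesgue_on {s..t}. \<forall>x. blinfun_apply (A t x) x \<ge> c\<^sub>2 * norm x powr p"
      by (rule AE_lebesgue_on_subset[OF c2(2)]) (use st in auto)
    have ae: "AE t in lebesgue_on {s..t}. g t + A t (X t) = to_dual j (f t)"
      using e by (auto simp: evolves_def intro: AE_lebesgue_on_subset[OF _ sub])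
    have xX: "AE t in lebesgue_on {s..t}. x t = blinfun_apply j (X t)" using d by (simp add: weak_evolution_def)
    have le: "AE r in lebesgue_on {s..t}. blinfun_apply (g r) (X r) + c\<^sub>2 * norm (X r) powr p \<le> f r \<bullet> x r"
      using co ae xX
    proof eventually_elim
      case (elim r)
      have g: "g r = to_dual j (f r) - A r (X r)" using elim(2) by (simp add: eq_diff_eq)
      have "blinfun_apply (g r) (X r) = f r \<bullet> x r - blinfun_apply (A r (X r)) (X r)"
        unfolding g elim(3) by (simp add: blinfun.diff_left to_dual_apply)
      then show ?case using elim(1)[rule_format, of "X r"] by linarith
    qed
    note bo = absolutely_integrable_iff_integrable_lebesgue_on
    have ic: "(\<lambda>r. c\<^sub>2 * norm (X r) powr p) absolutely_integrable_on {s..t}"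
      by (intro set_integrable_mult_right i')
    have isum: "(\<lambda>r. blinfun_apply (g r) (X r) + c\<^sub>2 * norm (X r) powr p) absolutely_integrable_on {s..t}"
      by (intro set_integral_add(1) en(1) ic)
    have "integral {s..t} (\<lambda>r. blinfun_apply (g r) (X r)) + c\<^sub>2 * integral {s..t} (\<lambda>r. norm (X r) powr p)
      = integral {s..t} (\<lambda>r. blinfun_apply (g r) (X r) + c\<^sub>2 * norm (X r) powr p)"
      using en(1) ic by (simp add: Henstock_Kurzweil_Integration.integral_add absolutely_integrable_imp_HK)
    also have "\<dots> = integral\<^sup>L (lebesgue_on {s..t}) (\<lambda>r. blinfun_apply (g r) (X r) + c\<^sub>2 * norm (X r) powr p)"
      by (rule lebesgue_integral_eq_integral[symmetric]) (use isum in \<open>simp_all add: bo\<close>)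
    also have "\<dots> \<le> integral\<^sup>L (lebesgue_on {s..t}) (\<lambda>r. f r \<bullet> x r)"
      using isum fi le by (intro integral_mono_AE) (simp_all only: bo)
    also have "\<dots> = integral {s..t} (\<lambda>r. f r \<bullet> x r)"
      using fi by (simp add: bo lebesgue_integral_eq_integral)
    finally show "(\<lambda>r. f r \<bullet> x r) absolutely_integrable_on {s..t} \<and>
       (norm (x t))\<^sup>2 / 2 - (norm (x s))\<^sup>2 / 2 + c\<^sub>2 * integral {s..t} (\<lambda>r. norm (X r) powr p)
           \<le> integral {s..t} (\<lambda>r. f r \<bullet> x r)"
      using en(2) fi by linarith
  qed
qed

end

section \<open>A priori bounds and concatenation of trajectories\<close>

lemma integral_mono_AE_lebesgue_on:
  fixes f g :: "real \<Rightarrow> real"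
  assumes "f absolutely_integrable_on {a..b}" "g absolutely_integrable_on {a..b}"
    and "AE t in lebesgue_on {a..b}. f t \<le> g t"
  shows "integral {a..b} f \<le> integral {a..b} g"
proof -
  note bo = absolutely_integrable_iff_integrable_lebesgue_on
  have "integral\<^sup>L (lebesgue_on {a..b}) f \<le> integral\<^sup>L (lebesgue_on {a..b}) g"
    using assms by (intro integral_mono_AE) (simp_all only: bo)
  then show ?thesis using assms by (simp add: bo lebesgue_integral_eq_integral)
qed

lemma integral_nonneg_everywhere:
  fixes f :: "real \<Rightarrow> real"
  assumes "\<And>t. 0 \<le> f t"
  shows "0 \<le> integral S f"
  using assms by (cases "f integrable_on S") (auto simp: not_integrable_integral intro: integral_nonneg)

lemma sup_upto_upper:
  assumes "x \<in> C_paths T" "0 \<le> s" "s \<le> t" "t \<le> T"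
  shows "norm (x s) \<le> sup_upto t x"
proof -
  have "continuous_on {0..t} x" using assms by (auto simp: C_paths_def intro: continuous_on_subset)
  then have "bounded ((\<lambda>s. norm (x s)) ` {0..t})"
    by (intro compact_imp_bounded compact_continuous_image continuous_intros compact_Icc)
  then show ?thesis unfolding sup_upto_def
    using assms by (intro cSUP_upper bounded_imp_bdd_above) auto
qed

lemma sup_upto_least:
  assumes "0 \<le> t" "\<And>s. 0 \<le> s \<Longrightarrow> s \<le> t \<Longrightarrow> norm (x s) \<le> B"
  shows "sup_upto t x \<le> B"
  unfolding sup_upto_def using assms by (intro cSUP_least) auto

lemma sup_upto_nonneg: "x \<in> C_paths T \<Longrightarrow> 0 \<le> t \<Longrightarrow> t \<le> T \<Longrightarrow> 0 \<le> sup_upto t x"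
  using sup_upto_upper[of x T 0 t] norm_ge_zero order_trans by blast

lemma sup_upto_cong: "(\<And>s. 0 \<le> s \<Longrightarrow> s \<le> t \<Longrightarrow> x s = y s) \<Longrightarrow> sup_upto t x = sup_upto t y"
  unfolding sup_upto_def by (intro SUP_cong) auto

text \<open>
  A lower power is at most a small multiple of a higher power plus a constant; this replaces
  Hoelder's inequality in the equicontinuity estimate.
\<close>
lemma powr_interpolation:
  fixes y s r \<delta> :: real
  assumes "0 \<le> y" "0 \<le> s" "s < r" "\<delta> > 0"
  shows "y powr s \<le> \<delta> * y powr r + (1/\<delta>) powr (s / (r - s))"
proof (cases "y \<le> (1/\<delta>) powr (1 / (r - s))")
  case True
  then have "y powr s \<le> ((1/\<delta>) powr (1 / (r - s))) powr s" using assms by (intro powr_mono2) auto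
  also have "\<dots> = (1/\<delta>) powr (s / (r - s))" by (simp add: powr_powr)
  finally show ?thesis using assms by (simp add: add_increasing)
next
  case False
  then have y: "(1/\<delta>) powr (1 / (r - s)) < y" by simp
  have "((1/\<delta>) powr (1 / (r - s))) powr (r - s) \<le> y powr (r - s)"
    using assms y by (intro powr_mono2) auto
  then have "1/\<delta> \<le> y powr (r - s)" using assms by (simp add: powr_powr)
  then have "1 \<le> \<delta> * y powr (r - s)" using assms by (simp add: field_simps)
  then have "1 * y powr s \<le> (\<delta> * y powr (r - s)) * y powr s" by (intro mult_right_mono) auto
  also have "\<dots> = \<delta> * y powr r" by (simp add: powr_add[symmetric])
  finally show ?thesis by (simp add: add_increasing2)
qed

lemma Lp_fun_join:
  fixes f g :: "real \<Rightarrow> 'b::real_normed_vector"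
  assumes f: "Lp_fun r {a..b} f" and g: "Lp_fun r {c..b} g" and c: "a \<le> c" "c \<le> b"
  shows "Lp_fun r {a..b} (\<lambda>t. if t \<le> c then f t else g t)"
proof -
  have r1: "restrict_space (lebesgue_on {a..b}) {t. t \<le> c} = lebesgue_on {a..c}"
    using c by (subst restrict_restrict_space) (auto intro!: arg_cong[where f="restrict_space lebesgue"])
  have r2: "restrict_space (lebesgue_on {a..b}) {t. \<not> t \<le> c} = lebesgue_on {c<..b}"
    using c by (subst restrict_restrict_space) (auto intro!: arg_cong[where f="restrict_space lebesgue"])
  have meas: "(\<lambda>t. if t \<le> c then F t else G t) \<in> borel_measurable (lebesgue_on {a..b})"
    if F: "F \<in> borel_measurable (lebesgue_on {a..b})" and G: "G \<in> borel_measurable (lebesgue_on {c..b})"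
        for F G :: "real \<Rightarrow> 'b"
  proof (subst measurable_If_restrict_space_iff)
    have "{t \<in> space (lebesgue_on {a..b}). t \<le> c} = {a..c}" using c by (auto simp: space_restrict_space)
    then show "{t \<in> space (lebesgue_on {a..b}). t \<le> c} \<in> sets (lebesgue_on {a..b})"
      using c by (auto simp: sets_restrict_space_iff)
    show "F \<in> borel_measurable (restrict_space (lebesgue_on {a..b}) {t. t \<le> c}) \<and>
      G \<in> borel_measurable (restrict_space (lebesgue_on {a..b}) {t. \<not> t \<le> c})"
      unfolding r1 r2 using c
      by (intro conjI measurable_restrict_mono[OF F] measurable_restrict_mono[OF G]) auto
  qed
  note bo = absolutely_integrable_iff_integrable_lebesgue_on
  have m: "(\<lambda>t. if t \<le> c then f t else g t) \<in> borel_measurable (lebesgue_on {a..b})"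
    using f g by (intro meas) (auto simp: Lp_fun_def)
  let ?h = "\<lambda>t. norm (if t \<le> c then f t else g t) powr r"
  have "?h absolutely_integrable_on ({a..c} \<union> {c..b})"
  proof (rule set_integrable_Un)
    have "(\<lambda>t. norm (f t) powr r) absolutely_integrable_on {a..c}"
      by (rule absolutely_integrable_on_subinterval[where S = "{a..b}"]) (use f c in \<open>auto simp: Lp_fun_def bo\<close>)
    then show "?h absolutely_integrable_on {a..c}"
      by (rule absolutely_integrable_spike[where S = "{}"]) auto
    have "(\<lambda>t. norm (g t) powr r) absolutely_integrable_on {c..b}"
      using g by (auto simp: Lp_fun_def bo)
    then show "?h absolutely_integrable_on {c..b}"
      by (rule absolutely_integrable_spike[where S = "{c}"]) auto
  qed auto
  moreover have "{a..c} \<union> {c..b} = {a..b}" using c by auto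
  ultimately show ?thesis using m by (simp add: Lp_fun_def bo)
qed

lemma weak_evolution_join:
  fixes j :: "'v::{banach,second_countable_topology} \<Rightarrow>\<^sub>L 'h::{real_inner,banach}"
  assumes 1: "weak_evolution j a b x X g \<gamma>" and 2: "weak_evolution j c b y Y k \<kappa>" and c: "a \<le> c" "c \<le> b"
    and xy: "\<And>t. t \<in> {a..c} \<Longrightarrow> y t = x t"
  shows "weak_evolution j a b y (\<lambda>t. if t \<le> c then X t else Y t) (\<lambda>t. if t \<le> c then g t else k t)
    (\<lambda>t. if t \<le> c then \<gamma> t else \<kappa> t)"
proof -
  note e1 = 1[unfolded weak_evolution_def] and e2 = 2[unfolded weak_evolution_def]
  have un: "{a..c} \<union> {c..b} = {a..b}" using c by auto
  have join: "(\<lambda>t. if t \<le> c then F t else G t) absolutely_integrable_on {a..b} \<and>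
     (\<forall>s t. a \<le> s \<longrightarrow> s \<le> t \<longrightarrow> t \<le> c \<longrightarrow> integral {s..t} (\<lambda>t. if t \<le> c then F t else G t) = integral {s..t} F) \<and>
     (\<forall>s t. c \<le> s \<longrightarrow> s \<le> t \<longrightarrow> t \<le> b \<longrightarrow> integral {s..t} (\<lambda>t. if t \<le> c then F t else G t) = integral {s..t} G)"
    if F: "F absolutely_integrable_on {a..b}" and G: "G absolutely_integrable_on {c..b}" for F G :: "real \<Rightarrow> real"
  proof (intro conjI allI impI)
    let ?h = "\<lambda>t. if t \<le> c then F t else G t"
    have "?h absolutely_integrable_on ({a..c} \<union> {c..b})"
    proof (rule set_integrable_Un)
      have "F absolutely_integrable_on {a..c}"
        by (rule absolutely_integrable_on_subinterval[OF F]) (use c in auto)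
      then show "?h absolutely_integrable_on {a..c}"
        by (rule absolutely_integrable_spike[where S = "{}"]) auto
      show "?h absolutely_integrable_on {c..b}"
        by (rule absolutely_integrable_spike[where S = "{c}", OF G]) auto
    qed auto
    then show "?h absolutely_integrable_on {a..b}" unfolding un .
    show "integral {s..t} ?h = integral {s..t} F" if "a \<le> s" "s \<le> t" "t \<le> c" for s t
      using that by (intro Henstock_Kurzweil_Integration.integral_cong) auto
    show "integral {s..t} ?h = integral {s..t} G" if "c \<le> s" "s \<le> t" "t \<le> b" for s t
      using that by (intro integral_spike[of "{c}"]) auto
  qed
  have yc: "continuous_on {a..b} y"
  proof -
    have "continuous_on {a..c} x" using e1 c by (auto intro: continuous_on_subset)
    then have "continuous_on {a..c} y" by (rule continuous_on_eq) (simp add: xy)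
    then show ?thesis using e2 un continuous_on_closed_Un[of "{a..c}" "{c..b}" y] by auto
  qed
  let ?k = "\<lambda>t. if t \<le> c then g t else k t"
  have kv: "(\<lambda>t. blinfun_apply (?k t) v) = (\<lambda>t. if t \<le> c then blinfun_apply (g t) v else blinfun_apply (k t) v)"
      for v
    by auto
  have ki: "(\<lambda>t. blinfun_apply (?k t) v) absolutely_integrable_on {a..b}" for v
    unfolding kv using join e1 e2 by blast
  have inc1: "(y t - y s) \<bullet> blinfun_apply j v = integral {s..t} (\<lambda>r. blinfun_apply (?k r) v)"
    if "a \<le> s" "s \<le> t" "t \<le> c" for s t v
  proof -
    have "(y t - y s) \<bullet> blinfun_apply j v = integral {s..t} (\<lambda>r. blinfun_apply (g r) v)"
      using e1 that xy[of s] xy[of t] c by simp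
    moreover have "integral {s..t} (\<lambda>r. blinfun_apply (?k r) v) = integral {s..t} (\<lambda>r. blinfun_apply (g r) v)"
      unfolding kv using join[of "\<lambda>t. blinfun_apply (g t) v" "\<lambda>t. blinfun_apply (k t) v"] e1 e2 that by blast
    ultimately show ?thesis by simp
  qed
  have inc2: "(y t - y s) \<bullet> blinfun_apply j v = integral {s..t} (\<lambda>r. blinfun_apply (?k r) v)"
    if "c \<le> s" "s \<le> t" "t \<le> b" for s t v
  proof -
    have "(y t - y s) \<bullet> blinfun_apply j v = integral {s..t} (\<lambda>r. blinfun_apply (k r) v)"
      using e2 that by simp
    moreover have "integral {s..t} (\<lambda>r. blinfun_apply (?k r) v) = integral {s..t} (\<lambda>r. blinfun_apply (k r) v)"
      unfolding kv using join[of "\<lambda>t. blinfun_apply (g t) v" "\<lambda>t. blinfun_apply (k t) v"] e1 e2 that by blast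
    ultimately show ?thesis by simp
  qed
  have inc: "(y t - y s) \<bullet> blinfun_apply j v = integral {s..t} (\<lambda>r. blinfun_apply (?k r) v)"
    if st: "a \<le> s" "s \<le> t" "t \<le> b" for s t v
  proof -
    consider "t \<le> c" | "c \<le> s" | "s \<le> c" "c \<le> t" by linarith
    then show ?thesis
    proof cases
      case 3
      have "(y t - y s) \<bullet> blinfun_apply j v = (y c - y s) \<bullet> blinfun_apply j v + (y t - y c) \<bullet> blinfun_apply j v"
        by (simp add: inner_diff_left)
      also have "\<dots> = integral {s..c} (\<lambda>r. blinfun_apply (?k r) v) + integral {c..t} (\<lambda>r. blinfun_apply (?k r) v)"
        using inc1[of s c v] inc2[of c t v] 3 st by simp
      also have "\<dots> = integral {s..t} (\<lambda>r. blinfun_apply (?k r) v)"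
        using 3 st by (intro Henstock_Kurzweil_Integration.integral_combine
            integrable_on_subinterval[OF absolutely_integrable_imp_HK[OF ki]]) auto
      finally show ?thesis .
    qed (use inc1 inc2 st in auto)
  qed
  have \<gamma>: "(\<lambda>t. if t \<le> c then \<gamma> t else \<kappa> t) absolutely_integrable_on {a..b}" using join e1 e2 by blast
  have nb: "norm (?k t) \<le> (if t \<le> c then \<gamma> t else \<kappa> t)" for t using e1 e2 by auto
  have ae: "AE t in lebesgue_on {a..b}. y t = blinfun_apply j (if t \<le> c then X t else Y t)"
  proof -
    have "AE t in lebesgue. t \<in> {a..b} \<longrightarrow> x t = blinfun_apply j (X t)" "AE t in lebesgue. t \<in> {c..b} \<longrightarrow>
        y t = blinfun_apply j (Y t)"
      using e1 e2 by (simp_all add: AE_restrict_space_iff)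
    then have "AE t in lebesgue. t \<in> {a..b} \<longrightarrow> y t = blinfun_apply j (if t \<le> c then X t else Y t)"
      by eventually_elim (use xy in auto)
    then show ?thesis by (simp add: AE_restrict_space_iff)
  qed
  show ?thesis
    unfolding weak_evolution_def by (intro conjI allI impI yc ki \<gamma> nb ae) (rule inc)
qed

context evolution_problem
begin

lemma trajectories_forcing:
  assumes "x \<in> trajectories T p q j A L t\<^sub>0 x\<^sub>0" "0 \<le> t\<^sub>0" "t\<^sub>0 < T"
  obtains f X g where "evolves t\<^sub>0 x f X g"
    "AE t in lebesgue_on {t\<^sub>0..T}. norm (f t) \<le> L * (1 + sup_upto t x)"
  using assms is_forcing_iff_evolves[of x t\<^sub>0] unfolding trajectories_def by blast

lemma trajectories_C_paths: "x \<in> trajectories T p q j A L t\<^sub>0 x\<^sub>0 \<Longrightarrow> x \<in> C_paths T"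
  by (simp add: trajectories_def)

lemma trajectories_initial: "x \<in> trajectories T p q j A L t\<^sub>0 x\<^sub>0 \<Longrightarrow> 0 \<le> t \<Longrightarrow> t \<le> t\<^sub>0 \<Longrightarrow> x t = x\<^sub>0 t"
  by (simp add: trajectories_def)

lemma trajectories_mono:
  assumes "L \<le> L'" "0 \<le> t\<^sub>0"
  shows "trajectories T p q j A L t\<^sub>0 x\<^sub>0 \<subseteq> trajectories T p q j A L' t\<^sub>0 x\<^sub>0"
proof
  fix x assume "x \<in> trajectories T p q j A L t\<^sub>0 x\<^sub>0"
  then obtain f where x: "x \<in> C_paths T" "\<forall>t\<in>{0..t\<^sub>0}. x t = x\<^sub>0 t" "is_forcing T p q j A t\<^sub>0 x f"
    and f: "AE t in lebesgue_on {t\<^sub>0..T}. norm (f t) \<le> L * (1 + sup_upto t x)"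
    unfolding trajectories_def by blast
  have "AE t in lebesgue_on {t\<^sub>0..T}. norm (f t) \<le> L' * (1 + sup_upto t x)"
    using f AE_space
  proof eventually_elim
    case (elim t)
    have "0 \<le> sup_upto t x" using elim assms by (intro sup_upto_nonneg[OF x(1)]) (auto simp: space_restrict_space)
    then have "L * (1 + sup_upto t x) \<le> L' * (1 + sup_upto t x)" using assms by (intro mult_right_mono) auto
    then show ?case using elim by linarith
  qed
  then show "x \<in> trajectories T p q j A L' t\<^sub>0 x\<^sub>0" using x unfolding trajectories_def by blast
qed

text \<open>
  The a priori bound. In place of Gronwall's inequality, the energy inequality is evaluated at a
  maximum point of \<open>exp(-lt)|x(t)|\<close> for a large enough exponent \<open>l\<close>.
\<close>
lemma trajectories_bounded:
  assumes L: "L \<ge> 0" and t0: "0 \<le> t\<^sub>0" "t\<^sub>0 < T" and x0: "x\<^sub>0 \<in> C_paths T"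
  obtains R where "R \<ge> 0" "\<And>x t. x \<in> trajectories T p q j A L t\<^sub>0 x\<^sub>0 \<Longrightarrow> t \<in> {0..T} \<Longrightarrow> norm (x t) \<le> R"
proof -
  define S where "S = sup_upto T x\<^sub>0"
  \<comment> \<open>Large enough for the forcing term to return at most half of the squared weighted maximum.\<close>
  define l where "l = 3 * L + 1"
  define B where "B = 2 * (S\<^sup>2 + L * T)"
  have l: "l > 0" using L by (simp add: l_def)
  have B0: "B \<ge> 0" using L T by (simp add: B_def)
  obtain c\<^sub>2 where c2: "c\<^sub>2 > 0" and en: "\<And>t\<^sub>0 x f X g s t. \<lbrakk>evolves t\<^sub>0 x f X g; t\<^sub>0 \<le> s; s \<le> t; t \<le> T; 0 \<le> t\<^sub>0\<rbrakk> \<Longrightarrow>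
    (\<lambda>r. f r \<bullet> x r) absolutely_integrable_on {s..t} \<and>
   (norm (x t))\<^sup>2 / 2 - (norm (x s))\<^sup>2 / 2 + c\<^sub>2 * integral {s..t} (\<lambda>r. norm (X r) powr p)
       \<le> integral {s..t} (\<lambda>r. f r \<bullet> x r)"
    by (rule energy_single) blast
  have main: "norm (x t) \<le> sqrt B * exp (l * T)" if x: "x \<in> trajectories T p q j A L t\<^sub>0 x\<^sub>0" and t: "t \<in> {0..T}"
      for x t
  proof -
    note xC = trajectories_C_paths[OF x]
    obtain f X g where e: "evolves t\<^sub>0 x f X g"
      and f: "AE t in lebesgue_on {t\<^sub>0..T}. norm (f t) \<le> L * (1 + sup_upto t x)"
      using trajectories_forcing[OF x t0] .
    have xc: "continuous_on {0..T} x" using C_paths_continuous[OF xC] by simp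
    have pc: "continuous_on {0..T} (\<lambda>t. exp (- l * t) * norm (x t))" by (intro continuous_intros xc)
    obtain \<tau> where \<tau>: "\<tau> \<in> {0..T}" "\<And>t. t \<in> {0..T} \<Longrightarrow> exp (- l * t) * norm (x t) \<le> exp (- l * \<tau>) * norm (x \<tau>)"
      using continuous_attains_sup[OF compact_Icc _ pc] T by force
    define N where "N = exp (- l * \<tau>) * norm (x \<tau>)"
    have N0: "N \<ge> 0" by (simp add: N_def)
    have xN: "norm (x t) \<le> N * exp (l * t)" if "t \<in> {0..T}" for t
    proof -
      have "(exp (- l * t) * norm (x t)) * exp (l * t) \<le> N * exp (l * t)"
        using \<tau>(2)[OF that] by (intro mult_right_mono) (auto simp: N_def)
      then show ?thesis by (simp add: exp_minus field_simps)
    qed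
    have sN: "sup_upto t x \<le> N * exp (l * t)" if "t \<in> {0..T}" for t
    proof (rule sup_upto_least)
      fix s assume "0 \<le> s" "s \<le> t"
      then have "norm (x s) \<le> N * exp (l * s)" using that by (intro xN) auto
      also have "\<dots> \<le> N * exp (l * t)" using N0 l \<open>s \<le> t\<close> by (intro mult_left_mono) auto
      finally show "norm (x s) \<le> N * exp (l * t)" .
    qed (use that in auto)
    have "N\<^sup>2 \<le> B"
    proof (cases "\<tau> \<le> t\<^sub>0")
      case True
      have "norm (x \<tau>) \<le> S"
        using \<tau>(1) True sup_upto_upper[OF x0, of \<tau> T] trajectories_initial[OF x, of \<tau>] by (simp add: S_def)
      moreover have "exp (- l * \<tau>) \<le> 1" using \<tau>(1) l by simp
      ultimately have "N \<le> 1 * S" unfolding N_def by (intro mult_mono) auto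
      then have "N\<^sup>2 \<le> S\<^sup>2" using N0 by (simp add: power_mono)
      also have "\<dots> \<le> B" using L T by (simp add: B_def)
      finally show ?thesis .
    next
      case False
      have int: "(\<lambda>r. f r \<bullet> x r) absolutely_integrable_on {t\<^sub>0..\<tau>}"
        and le: "(norm (x \<tau>))\<^sup>2 / 2 - (norm (x t\<^sub>0))\<^sup>2 / 2 + c\<^sub>2 * integral {t\<^sub>0..\<tau>} (\<lambda>r. norm (X r) powr p)
            \<le> integral {t\<^sub>0..\<tau>} (\<lambda>r. f r \<bullet> x r)"
        using en[OF e, of t\<^sub>0 \<tau>] False \<tau>(1) t0 by auto
      let ?h = "\<lambda>r. L / 2 + 3 * L / 2 * N\<^sup>2 * exp (2 * l * r)"
      have "integral {t\<^sub>0..\<tau>} (\<lambda>r. f r \<bullet> x r) \<le> integral {t\<^sub>0..\<tau>} ?h"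
      proof (rule integral_mono_AE_lebesgue_on[OF int])
        show "?h absolutely_integrable_on {t\<^sub>0..\<tau>}"
          by (intro absolutely_integrable_continuous_real continuous_intros)
        have f': "AE t in lebesgue_on {t\<^sub>0..\<tau>}. norm (f t) \<le> L * (1 + sup_upto t x)"
          by (rule AE_lebesgue_on_subset[OF f]) (use \<tau>(1) in auto)
        show "AE r in lebesgue_on {t\<^sub>0..\<tau>}. f r \<bullet> x r \<le> ?h r"
          using f' AE_space
        proof eventually_elim
          case (elim r)
          define E where "E = N * exp (l * r)"
          have r: "r \<in> {0..T}" using elim \<tau>(1) t0 by (auto simp: space_restrict_space)
          have E0: "E \<ge> 0" using N0 by (simp add: E_def)
          have "f r \<bullet> x r \<le> norm (f r) * norm (x r)" by (rule norm_cauchy_schwarz)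
          also have "\<dots> \<le> (L * (1 + E)) * E"
          proof (rule mult_mono)
            have "norm (f r) \<le> L * (1 + sup_upto r x)" using elim by simp
            also have "\<dots> \<le> L * (1 + E)" using sN[OF r] L by (intro mult_left_mono) (auto simp: E_def)
            finally show "norm (f r) \<le> L * (1 + E)" .
          qed (use xN[OF r] L E0 in \<open>auto simp: E_def\<close>)
          also have "\<dots> = L * (E + E\<^sup>2)" by (simp add: algebra_simps power2_eq_square)
          also have "\<dots> \<le> L * (1/2 + 3/2 * E\<^sup>2)"
          proof (rule mult_left_mono[OF _ L])
            have "0 \<le> (E - 1)\<^sup>2" by simp
            then show "E + E\<^sup>2 \<le> 1/2 + 3/2 * E\<^sup>2" by (simp add: power2_eq_square algebra_simps)
          qed
          also have "E\<^sup>2 = N\<^sup>2 * exp (2 * l * r)"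
            by (simp add: E_def power_mult_distrib power2_eq_square mult_exp_exp)
          finally show ?case by (simp add: algebra_simps)
        qed
      qed
      also have "integral {t\<^sub>0..\<tau>} ?h = L / 2 * (\<tau> - t\<^sub>0) + 3 * L / 2 * N\<^sup>2 * ((exp (2 * l * \<tau>) - exp (2 * l * t\<^sub>0))
          / (2 * l))"
      proof -
        have "(?h has_integral ((L / 2 * \<tau> + 3 * L / 2 * N\<^sup>2 * (exp (2 * l * \<tau>) / (2 * l))) - (L / 2 * t\<^sub>0
            + 3 * L / 2 * N\<^sup>2 * (exp (2 * l * t\<^sub>0) / (2 * l))))) {t\<^sub>0..\<tau>}"
        proof (rule fundamental_theorem_of_calculus)
          show "t\<^sub>0 \<le> \<tau>" using False by simp
          fix r assume "r \<in> {t\<^sub>0..\<tau>}"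
          have "((\<lambda>r. L / 2 * r + 3 * L / 2 * N\<^sup>2 * (exp (2 * l * r) / (2 * l))) has_real_derivative ?h r) (at r
              within {t\<^sub>0..\<tau>})"
            using l by (auto intro!: derivative_eq_intros)
          then show "((\<lambda>r. L / 2 * r + 3 * L / 2 * N\<^sup>2 * (exp (2 * l * r) / (2 * l))) has_vector_derivative ?h r)
              (at r within {t\<^sub>0..\<tau>})"
            by (simp add: has_real_derivative_iff_has_vector_derivative)
        qed
        from integral_unique[OF this] show ?thesis by (simp add: algebra_simps diff_divide_distrib)
      qed
      also have "\<dots> \<le> L / 2 * T + N\<^sup>2 * exp (2 * l * \<tau>) / 4"
      proof (rule add_mono)
        show "L / 2 * (\<tau> - t\<^sub>0) \<le> L / 2 * T" using L \<tau>(1) t0 by (intro mult_left_mono) auto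
        have "3 * L / 2 * N\<^sup>2 * ((exp (2 * l * \<tau>) - exp (2 * l * t\<^sub>0)) / (2 * l))
            \<le> 3 * L / 2 * N\<^sup>2 * (exp (2 * l * \<tau>) / (2 * l))"
          using L l by (intro mult_left_mono divide_right_mono) auto
        also have "\<dots> = (3 * L / l) * (N\<^sup>2 * exp (2 * l * \<tau>) / 4)" by simp
        also have "\<dots> \<le> 1 * (N\<^sup>2 * exp (2 * l * \<tau>) / 4)"
          using L l by (intro mult_right_mono) (auto simp: l_def)
        finally show "3 * L / 2 * N\<^sup>2 * ((exp (2 * l * \<tau>) - exp (2 * l * t\<^sub>0)) / (2 * l))
            \<le> N\<^sup>2 * exp (2 * l * \<tau>) / 4" by simp
      qed
      finally have I: "integral {t\<^sub>0..\<tau>} (\<lambda>r. f r \<bullet> x r) \<le> L / 2 * T + N\<^sup>2 * exp (2 * l * \<tau>) / 4" .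
      have "norm (x t\<^sub>0) \<le> S"
        using t0 sup_upto_upper[OF x0, of t\<^sub>0 T] trajectories_initial[OF x, of t\<^sub>0] by (simp add: S_def)
      then have "(norm (x t\<^sub>0))\<^sup>2 \<le> S\<^sup>2" by (simp add: power_mono)
      moreover have "0 \<le> c\<^sub>2 * integral {t\<^sub>0..\<tau>} (\<lambda>r. norm (X r) powr p)"
        using c2 by (intro mult_nonneg_nonneg) (auto intro!: integral_nonneg_everywhere)
      ultimately have "(norm (x \<tau>))\<^sup>2 \<le> S\<^sup>2 + L * T + N\<^sup>2 * exp (2 * l * \<tau>) / 2" using le I by simp
      then have "(norm (x \<tau>))\<^sup>2 * exp (- 2 * l * \<tau>) \<le> (S\<^sup>2 + L * T + N\<^sup>2 * exp (2 * l * \<tau>) / 2) * exp (- 2 * l * \<tau>)"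
        by (intro mult_right_mono) auto
      also have "\<dots> = (S\<^sup>2 + L * T) * exp (- 2 * l * \<tau>) + N\<^sup>2 / 2" by (simp add: algebra_simps mult_exp_exp)
      also have "\<dots> \<le> (S\<^sup>2 + L * T) * 1 + N\<^sup>2 / 2" using L T l \<tau>(1) by (intro add_mono mult_left_mono) auto
      also have "(norm (x \<tau>))\<^sup>2 * exp (- 2 * l * \<tau>) = N\<^sup>2"
        by (simp add: N_def power_mult_distrib power2_eq_square mult_exp_exp)
      finally show ?thesis by (simp add: B_def)
    qed
    then have "N \<le> sqrt B" by (simp add: real_le_rsqrt)
    have "norm (x t) \<le> N * exp (l * t)" by (rule xN[OF t])
    also have "\<dots> \<le> sqrt B * exp (l * T)" using \<open>N \<le> sqrt B\<close> N0 l t B0 by (intro mult_mono) auto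
    finally show ?thesis .
  qed
  show thesis by (rule that[of "sqrt B * exp (l * T)"]) (use main B0 in auto)
qed

text \<open>
  The growth condition on trajectories speaks of some forcing; it transfers to every forcing by
  uniqueness.
\<close>
lemma forcing_bounded:
  assumes L: "L \<ge> 0" and t0: "0 \<le> t\<^sub>0" "t\<^sub>0 < T" and x: "x \<in> trajectories T p q j A L t\<^sub>0 x\<^sub>0"
    and R: "\<And>t. t \<in> {0..T} \<Longrightarrow> norm (x t) \<le> R" and e: "evolves t\<^sub>0 x f X g"
  shows "AE t in lebesgue_on {t\<^sub>0..T}. norm (f t) \<le> L * (1 + R)"
proof -
  obtain f' X' g' where e': "evolves t\<^sub>0 x f' X' g'"
    and f': "AE t in lebesgue_on {t\<^sub>0..T}. norm (f' t) \<le> L * (1 + sup_upto t x)"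
    using trajectories_forcing[OF x t0] .
  show ?thesis using f' forcing_unique[OF e e'] AE_space
  proof eventually_elim
    case (elim t)
    have "sup_upto t x \<le> R" using elim t0 by (intro sup_upto_least R) (auto simp: space_restrict_space)
    then have "L * (1 + sup_upto t x) \<le> L * (1 + R)" using L by (intro mult_left_mono) auto
    then show ?case using elim by simp
  qed
qed

text \<open>
  Bounded trajectories with bounded forcing are bounded in \<open>L\<^sup>1(t\<^sub>0,T;V)\<close>, and the functions
  \<open>(x(\<cdot>), v)\<close> with \<open>\<parallel>v\<parallel> \<le> 1\<close> are uniformly equicontinuous, because the coercivity bounds \<open>X\<close> in
  \<open>L\<^sup>p\<close> and the growth condition then makes \<open>x'\<close> uniformly integrable in \<open>V\<^sup>*\<close>.
\<close>
lemma weak_equicontinuity: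
  assumes t0: "0 \<le> t\<^sub>0" "t\<^sub>0 < T" and R: "R \<ge> 0" and C: "C \<ge> 0"
  obtains D where "D \<ge> 0"
    "\<And>x f X g. \<lbrakk>evolves t\<^sub>0 x f X g; \<And>t. t \<in> {t\<^sub>0..T} \<Longrightarrow> norm (x t) \<le> R; AE t in lebesgue_on {t\<^sub>0..T}. norm (f t)
        \<le> C\<rbrakk>
       \<Longrightarrow> integral {t\<^sub>0..T} (\<lambda>r. norm (X r)) \<le> D"
    "\<And>e. e > 0 \<Longrightarrow> \<exists>d>0. \<forall>x f X g. evolves t\<^sub>0 x f X g \<longrightarrow> (\<forall>t\<in>{t\<^sub>0..T}. norm (x t) \<le> R) \<longrightarrow>
        (AE t in lebesgue_on {t\<^sub>0..T}. norm (f t) \<le> C)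
       \<longrightarrow> (\<forall>s t v. t\<^sub>0 \<le> s \<longrightarrow> s \<le> t \<longrightarrow> t \<le> T \<longrightarrow> t - s < d \<longrightarrow> \<bar>(x t - x s) \<bullet> blinfun_apply j v\<bar> \<le> e * norm v)"
proof -
  obtain c\<^sub>2 where c2: "c\<^sub>2 > 0" and en: "\<And>t\<^sub>0 x f X g s t. \<lbrakk>evolves t\<^sub>0 x f X g; t\<^sub>0 \<le> s; s \<le> t; t \<le> T; 0 \<le> t\<^sub>0\<rbrakk> \<Longrightarrow>
    (\<lambda>r. f r \<bullet> x r) absolutely_integrable_on {s..t} \<and>
   (norm (x t))\<^sup>2 / 2 - (norm (x s))\<^sup>2 / 2 + c\<^sub>2 * integral {s..t} (\<lambda>r. norm (X r) powr p)
       \<le> integral {s..t} (\<lambda>r. f r \<bullet> x r)"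
    by (rule energy_single) blast
  obtain a1 c1 where c1: "c1 \<ge> 0" and a1: "Lp_fun q {0..T} a1"
    and gr: "AE t in lebesgue_on {0..T}. \<forall>x. norm (A t x) \<le> a1 t + c1 * norm x powr (p - 1)"
    using A unfolding admissible_operator_def by blast
  define C1 where "C1 = (R\<^sup>2 / 2 + C * R * T) / c\<^sub>2"
  have C10: "C1 \<ge> 0" using R C T c2 by (simp add: C1_def)
  define I1 where "I1 = integral {0..T} (\<lambda>t. norm (a1 t) powr q)"
  have I10: "I1 \<ge> 0" unfolding I1_def
    using Lp_fun_norm_integrable(2)[OF a1] q by (intro integral_nonneg absolutely_integrable_imp_HK) auto
  have Xp: "integral {t\<^sub>0..T} (\<lambda>r. norm (X r) powr p) \<le> C1"
    if e: "evolves t\<^sub>0 x f X g" and xR: "\<And>t. t \<in> {t\<^sub>0..T} \<Longrightarrow> norm (x t) \<le> R"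
        and fC: "AE t in lebesgue_on {t\<^sub>0..T}. norm (f t) \<le> C" for x f X g
  proof -
    have int: "(\<lambda>r. f r \<bullet> x r) absolutely_integrable_on {t\<^sub>0..T}"
        and le: "(norm (x T))\<^sup>2 / 2 - (norm (x t\<^sub>0))\<^sup>2 / 2 + c\<^sub>2 * integral {t\<^sub>0..T} (\<lambda>r. norm (X r) powr p)
            \<le> integral {t\<^sub>0..T} (\<lambda>r. f r \<bullet> x r)"
        using en[OF e, of t\<^sub>0 T] t0 by auto
    have "integral {t\<^sub>0..T} (\<lambda>r. f r \<bullet> x r) \<le> integral {t\<^sub>0..T} (\<lambda>r. C * R)"
    proof (rule integral_mono_AE_lebesgue_on[OF int])
      show "(\<lambda>r. C * R) absolutely_integrable_on {t\<^sub>0..T}" by (rule absolutely_integrable_continuous_real) auto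
      show "AE r in lebesgue_on {t\<^sub>0..T}. f r \<bullet> x r \<le> C * R"
        using fC AE_space
      proof eventually_elim
        case (elim r)
        have "f r \<bullet> x r \<le> norm (f r) * norm (x r)" by (rule norm_cauchy_schwarz)
        also have "\<dots> \<le> C * R" using elim xR C by (intro mult_mono) (auto simp: space_restrict_space)
        finally show ?case .
      qed
    qed
    also have "\<dots> = C * R * (T - t\<^sub>0)" using t0 by simp
    also have "\<dots> \<le> C * R * T" using t0 C R by (intro mult_left_mono) auto
    finally have "integral {t\<^sub>0..T} (\<lambda>r. f r \<bullet> x r) \<le> C * R * T" .
    moreover have "(norm (x t\<^sub>0))\<^sup>2 \<le> R\<^sup>2" using xR[of t\<^sub>0] t0 by (simp add: power_mono)
    moreover have "0 \<le> (norm (x T))\<^sup>2" by simp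
    ultimately have "c\<^sub>2 * integral {t\<^sub>0..T} (\<lambda>r. norm (X r) powr p) \<le> R\<^sup>2 / 2 + C * R * T" using le by linarith
    then show ?thesis using c2 by (simp add: C1_def le_divide_eq mult.commute)
  qed
  have Xi: "(\<lambda>r. norm (X r)) absolutely_integrable_on {t\<^sub>0..T}" "(\<lambda>r. norm (X r) powr p) absolutely_integrable_on
      {t\<^sub>0..T}"
    if "evolves t\<^sub>0 x f X g" for x f X g
    using that p by (auto simp: evolves_def intro: Lp_fun_norm_integrable)
  show thesis
  proof (rule that[of "T + C1"])
    show "T + C1 \<ge> 0" using T C10 by simp
    fix x f X g assume e: "evolves t\<^sub>0 x f X g" and xR: "\<And>t. t \<in> {t\<^sub>0..T} \<Longrightarrow> norm (x t) \<le> R"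
        and fC: "AE t in lebesgue_on {t\<^sub>0..T}. norm (f t) \<le> C"
    have "integral {t\<^sub>0..T} (\<lambda>r. norm (X r)) \<le> integral {t\<^sub>0..T} (\<lambda>r. 1 + norm (X r) powr p)"
      using Xi[OF e] p by (intro integral_le integrable_add absolutely_integrable_imp_HK le_one_plus_powr) auto
    also have "\<dots> = (T - t\<^sub>0) + integral {t\<^sub>0..T} (\<lambda>r. norm (X r) powr p)"
      using Xi[OF e] t0 by (subst Henstock_Kurzweil_Integration.integral_add) (auto intro:
          absolutely_integrable_imp_HK)
    also have "\<dots> \<le> T + C1" using Xp[OF e xR fC] t0 by simp
    finally show "integral {t\<^sub>0..T} (\<lambda>r. norm (X r)) \<le> T + C1" .
  next
    fix e :: real assume e0: "e > 0"
    \<comment> \<open>The norm of \<open>x'\<close> is at most \<open>K\<close> plus \<open>\<delta>\<close> times a function with bounded integral.\<close>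
    define \<delta> where "\<delta> = e / (2 * (I1 + c1 * C1 + 1))"
    have den: "I1 + c1 * C1 + 1 > 0" using I10 c1 C10 by (simp add: add_nonneg_pos)
    have \<delta>: "\<delta> > 0" using e0 den by (simp add: \<delta>_def)
    define K where "K = norm j * C + (1/\<delta>) powr (1 / (q - 1)) + c1 * (1/\<delta>) powr (p - 1)"
    have K: "K \<ge> 0" using C c1 by (simp add: K_def)
    show "\<exists>d>0. \<forall>x f X g. evolves t\<^sub>0 x f X g \<longrightarrow> (\<forall>t\<in>{t\<^sub>0..T}. norm (x t) \<le> R) \<longrightarrow>
        (AE t in lebesgue_on {t\<^sub>0..T}. norm (f t) \<le> C)
       \<longrightarrow> (\<forall>s t v. t\<^sub>0 \<le> s \<longrightarrow> s \<le> t \<longrightarrow> t \<le> T \<longrightarrow> t - s < d \<longrightarrow> \<bar>(x t - x s) \<bullet> blinfun_apply j v\<bar> \<le> e * norm v)"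
    proof (intro exI[of _ "e / (2 * (K + 1))"] conjI allI impI)
      show "0 < e / (2 * (K + 1))" using e0 K by simp
      fix x f X g s t v
      assume ev: "evolves t\<^sub>0 x f X g" and xR: "\<forall>t\<in>{t\<^sub>0..T}. norm (x t) \<le> R"
          and fC: "AE t in lebesgue_on {t\<^sub>0..T}. norm (f t) \<le> C"
        and st: "t\<^sub>0 \<le> s" "s \<le> t" "t \<le> T" and small: "t - s < e / (2 * (K + 1))"
      have sub: "{s..t} \<subseteq> {t\<^sub>0..T}" using st by auto
      have ng: "(\<lambda>r. norm (g r)) absolutely_integrable_on {s..t}"
        using ev q by (intro absolutely_integrable_on_subinterval[OF Lp_fun_norm_integrable(1)[of q] sub]) (auto
            simp: evolves_def)
      have ia: "(\<lambda>r. norm (a1 r) powr q) absolutely_integrable_on {s..t}"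
        by (rule absolutely_integrable_on_subinterval[OF Lp_fun_norm_integrable(2)[OF a1]]) (use q st t0 in auto)
      have iX: "(\<lambda>r. norm (X r) powr p) absolutely_integrable_on {s..t}"
        using absolutely_integrable_on_subinterval[OF Xi(2)[OF ev] sub] .
      let ?h = "\<lambda>r. K + \<delta> * (norm (a1 r) powr q + c1 * norm (X r) powr p)"
      have ih': "(\<lambda>r. norm (a1 r) powr q + c1 * norm (X r) powr p) absolutely_integrable_on {s..t}"
        by (intro set_integral_add(1) set_integrable_mult_right ia iX)
      have ih: "?h absolutely_integrable_on {s..t}"
        by (intro set_integral_add(1) set_integrable_mult_right ih' absolutely_integrable_continuous_real
            continuous_intros)
      have "integral {s..t} (\<lambda>r. norm (g r)) \<le> integral {s..t} ?h"
      proof (rule integral_mono_AE_lebesgue_on[OF ng ih])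
        have 1: "AE t in lebesgue_on {s..t}. \<forall>x. norm (A t x) \<le> a1 t + c1 * norm x powr (p - 1)"
          by (rule AE_lebesgue_on_subset[OF gr]) (use st t0 in auto)
        have "AE t in lebesgue_on {t\<^sub>0..T}. g t + A t (X t) = to_dual j (f t)" using ev by (simp add: evolves_def)
        then have 2: "AE t in lebesgue_on {s..t}. g t + A t (X t) = to_dual j (f t)"
          by (rule AE_lebesgue_on_subset) (use sub in auto)
        have 3: "AE t in lebesgue_on {s..t}. norm (f t) \<le> C"
          by (rule AE_lebesgue_on_subset[OF fC sub]) auto
        show "AE r in lebesgue_on {s..t}. norm (g r) \<le> ?h r"
          using 1 2 3
        proof eventually_elim
          case (elim r)
          have "g r = to_dual j (f r) - A r (X r)" using elim(2) by (simp add: eq_diff_eq)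
          then have "norm (g r) \<le> norm (to_dual j (f r)) + norm (A r (X r))" by (simp add: norm_triangle_ineq4)
          also have "norm (to_dual j (f r)) \<le> norm j * C"
          proof -
            have "norm (to_dual j (f r)) \<le> norm (f r) * norm j"
            proof (rule norm_blinfun_bound)
              fix v
              have "norm (blinfun_apply (to_dual j (f r)) v) \<le> norm (f r) * norm (blinfun_apply j v)"
                by (simp add: to_dual_apply Cauchy_Schwarz_ineq2)
              also have "\<dots> \<le> norm (f r) * (norm j * norm v)" by (intro mult_left_mono norm_blinfun) auto
              finally show "norm (blinfun_apply (to_dual j (f r)) v) \<le> norm (f r) * norm j * norm v"
                  by (simp add: mult.assoc)
            qed auto
            also have "\<dots> \<le> C * norm j" using elim(3) by (intro mult_right_mono) auto
            finally show ?thesis by (simp add: mult.commute)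
          qed
          also have "norm (A r (X r)) \<le> a1 r + c1 * norm (X r) powr (p - 1)" using elim(1) by blast
          also have "a1 r \<le> \<delta> * norm (a1 r) powr q + (1/\<delta>) powr (1 / (q - 1))"
          proof -
            have "norm (a1 r) powr 1 \<le> \<delta> * norm (a1 r) powr q + (1/\<delta>) powr (1 / (q - 1))"
              using q \<delta> by (intro powr_interpolation) auto
            then show ?thesis by simp
          qed
          also have "c1 * norm (X r) powr (p - 1) \<le> c1 * (\<delta> * norm (X r) powr p + (1/\<delta>) powr (p - 1))"
          proof (rule mult_left_mono[OF _ c1])
            have "norm (X r) powr (p - 1) \<le> \<delta> * norm (X r) powr p + (1/\<delta>) powr ((p - 1) / (p - (p - 1)))"
              using p \<delta> by (intro powr_interpolation) auto
            then show "norm (X r) powr (p - 1) \<le> \<delta> * norm (X r) powr p + (1/\<delta>) powr (p - 1)" by simp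
          qed
          finally show ?case by (simp add: K_def algebra_simps)
        qed
      qed
      also have "\<dots> = K * (t - s) + \<delta> * integral {s..t} (\<lambda>r. norm (a1 r) powr q + c1 * norm (X r) powr p)"
        using st absolutely_integrable_imp_HK[OF ih']
        by (subst Henstock_Kurzweil_Integration.integral_add) (auto intro: integrable_on_mult_right)
      also have "integral {s..t} (\<lambda>r. norm (a1 r) powr q + c1 * norm (X r) powr p) \<le> I1 + c1 * C1"
      proof -
        have "integral {s..t} (\<lambda>r. norm (a1 r) powr q + c1 * norm (X r) powr p)
          = integral {s..t} (\<lambda>r. norm (a1 r) powr q) + c1 * integral {s..t} (\<lambda>r. norm (X r) powr p)"
          using absolutely_integrable_imp_HK[OF ia] absolutely_integrable_imp_HK[OF iX]
          by (subst Henstock_Kurzweil_Integration.integral_add) (auto intro: integrable_on_mult_right)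
        moreover have "integral {s..t} (\<lambda>r. norm (a1 r) powr q) \<le> I1"
          unfolding I1_def using absolutely_integrable_imp_HK[OF ia] Lp_fun_norm_integrable(2)[OF a1] q st t0
          by (intro integral_subset_le) (auto intro: absolutely_integrable_imp_HK)
        moreover have "integral {s..t} (\<lambda>r. norm (X r) powr p) \<le> C1"
        proof -
          have "integral {s..t} (\<lambda>r. norm (X r) powr p) \<le> integral {t\<^sub>0..T} (\<lambda>r. norm (X r) powr p)"
            using absolutely_integrable_imp_HK[OF iX] absolutely_integrable_imp_HK[OF Xi(2)[OF ev]] sub
            by (intro integral_subset_le) auto
          then show ?thesis using Xp[OF ev _ fC] xR by fastforce
        qed
        ultimately show ?thesis using c1 by (simp add: add_mono mult_left_mono)
      qed
      finally have "integral {s..t} (\<lambda>r. norm (g r)) \<le> K * (t - s) + \<delta> * (I1 + c1 * C1)" using \<delta>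
          by (simp add: mult_left_mono)
      also have "K * (t - s) \<le> (K + 1) * (t - s)" using st by (intro mult_right_mono) auto
      also have "\<dots> \<le> (K + 1) * (e / (2 * (K + 1)))" using small K by (intro mult_left_mono) auto
      also have "\<dots> = e / 2" using K by (simp add: divide_simps)
      also have "\<delta> * (I1 + c1 * C1) \<le> \<delta> * (I1 + c1 * C1 + 1)" using \<delta> by (intro mult_left_mono) auto
      also have "\<dots> = e / 2" using den unfolding \<delta>_def by (simp add: divide_simps)
      finally have le: "integral {s..t} (\<lambda>r. norm (g r)) \<le> e" by simp
      have we: "weak_evolution j t\<^sub>0 T x X g (\<lambda>r. norm (g r))" using ev by (simp add: evolves_def)
      then have "(x t - x s) \<bullet> blinfun_apply j v = integral {s..t} (\<lambda>r. blinfun_apply (g r) v)"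
        using st by (simp add: weak_evolution_def)
      also have "norm \<dots> \<le> integral {s..t} (\<lambda>r. norm (g r) * norm v)"
      proof (rule Henstock_Kurzweil_Integration.integral_norm_bound_integral)
        have "(\<lambda>r. blinfun_apply (g r) v) absolutely_integrable_on {t\<^sub>0..T}" using we
            by (simp add: weak_evolution_def)
        from absolutely_integrable_imp_HK[OF absolutely_integrable_on_subinterval[OF this sub]]
        show "(\<lambda>r. blinfun_apply (g r) v) integrable_on {s..t}" .
        show "(\<lambda>r. norm (g r) * norm v) integrable_on {s..t}"
          using absolutely_integrable_imp_HK[OF ng] by (rule integrable_on_mult_left)
      qed (rule norm_blinfun)
      also have "\<dots> = integral {s..t} (\<lambda>r. norm (g r)) * norm v" by simp
      also have "\<dots> \<le> e * norm v" using le by (intro mult_right_mono) auto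
      finally show "\<bar>(x t - x s) \<bullet> blinfun_apply j v\<bar> \<le> e * norm v" by simp
    qed
  qed
qed

lemma trajectories_concat:
  assumes t: "0 \<le> t\<^sub>0" "t\<^sub>0 \<le> t\<^sub>1" "t\<^sub>1 < T"
    and x: "x \<in> trajectories T p q j A L t\<^sub>0 x\<^sub>0" and y: "y \<in> trajectories T p q j A L t\<^sub>1 x"
  shows "y \<in> trajectories T p q j A L t\<^sub>0 x\<^sub>0"
proof -
  note xC = trajectories_C_paths[OF x] and yC = trajectories_C_paths[OF y]
  obtain f X g where e: "evolves t\<^sub>0 x f X g" and f: "AE t in lebesgue_on {t\<^sub>0..T}. norm (f t)
      \<le> L * (1 + sup_upto t x)"
    using trajectories_forcing[OF x] t by auto
  obtain k Y m where e': "evolves t\<^sub>1 y k Y m" and k: "AE t in lebesgue_on {t\<^sub>1..T}. norm (k t)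
      \<le> L * (1 + sup_upto t y)"
    using trajectories_forcing[OF y] t by auto
  have yx: "y r = x r" if "0 \<le> r" "r \<le> t\<^sub>1" for r using trajectories_initial[OF y that] .
  let ?f = "\<lambda>r. if r \<le> t\<^sub>1 then f r else k r" and ?X = "\<lambda>r. if r \<le> t\<^sub>1 then X r else Y r"
    and ?g = "\<lambda>r. if r \<le> t\<^sub>1 then g r else m r"
  have w: "weak_evolution j t\<^sub>0 T y ?X ?g (\<lambda>r. if r \<le> t\<^sub>1 then norm (g r) else norm (m r))"
    using e e' t yx by (intro weak_evolution_join[where x = x]) (auto simp: evolves_def)
  moreover have "(\<lambda>r. if r \<le> t\<^sub>1 then norm (g r) else norm (m r)) = (\<lambda>r. norm (?g r))" by auto
  ultimately have w': "weak_evolution j t\<^sub>0 T y ?X ?g (\<lambda>r. norm (?g r))" by simp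
  have ae: "AE r in lebesgue_on {t\<^sub>0..T}. ?g r + A r (?X r) = to_dual j (?f r)"
  proof -
    have "AE r in lebesgue. r \<in> {t\<^sub>0..T} \<longrightarrow> g r + A r (X r) = to_dual j (f r)"
      "AE r in lebesgue. r \<in> {t\<^sub>1..T} \<longrightarrow> m r + A r (Y r) = to_dual j (k r)"
      using e e' by (simp_all add: evolves_def AE_restrict_space_iff)
    then have "AE r in lebesgue. r \<in> {t\<^sub>0..T} \<longrightarrow> ?g r + A r (?X r) = to_dual j (?f r)"
      by eventually_elim auto
    then show ?thesis by (simp add: AE_restrict_space_iff)
  qed
  have L: "Lp_fun 2 {t\<^sub>0..T} ?f" "Lp_fun p {t\<^sub>0..T} ?X" "Lp_fun q {t\<^sub>0..T} ?g"
    using e e' t by (auto simp: evolves_def intro!: Lp_fun_join)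
  have "evolves t\<^sub>0 y ?f ?X ?g" unfolding evolves_def by (intro conjI L w' ae)
  then have "is_forcing T p q j A t\<^sub>0 y ?f" using is_forcing_iff_evolves[OF yC] t by force
  moreover have "AE r in lebesgue_on {t\<^sub>0..T}. norm (?f r) \<le> L * (1 + sup_upto r y)"
  proof -
    have "AE r in lebesgue. r \<in> {t\<^sub>0..T} \<longrightarrow> norm (f r) \<le> L * (1 + sup_upto r x)"
      "AE r in lebesgue. r \<in> {t\<^sub>1..T} \<longrightarrow> norm (k r) \<le> L * (1 + sup_upto r y)"
      using f k by (simp_all add: AE_restrict_space_iff)
    then have "AE r in lebesgue. r \<in> {t\<^sub>0..T} \<longrightarrow> norm (?f r) \<le> L * (1 + sup_upto r y)"
    proof eventually_elim
      case (elim r)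
      have "sup_upto r y = sup_upto r x" if "r \<le> t\<^sub>1" using that by (intro sup_upto_cong yx) auto
      then show ?case using elim by auto
    qed
    then show ?thesis by (simp add: AE_restrict_space_iff)
  qed
  moreover have "\<forall>r\<in>{0..t\<^sub>0}. y r = x\<^sub>0 r" using yx trajectories_initial[OF x] t by auto
  ultimately show ?thesis using yC unfolding trajectories_def by blast
qed

end

section \<open>Compactness of the set of trajectories\<close>

text \<open>
  Total boundedness of a set of paths in the supremum norm, with the net taken in the set itself.
\<close>
definition totally_bounded_paths :: "real \<Rightarrow> (real \<Rightarrow> 'h::real_normed_vector) set \<Rightarrow> bool" where
  "totally_bounded_paths T K \<longleftrightarrow> K \<subseteq> C_paths T \<and>
     (\<forall>e>0. \<exists>F. finite F \<and> F \<subseteq> K \<and> (\<forall>x\<in>K. \<exists>y\<in>F. \<forall>t\<in>{0..T}. norm (x t - y t) \<le> e))"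

lemma totally_bounded_paths_equicontinuous:
  assumes K: "totally_bounded_paths T K" and e: "e > 0"
  obtains d where "d > 0" "\<And>x s t. \<lbrakk>x \<in> K; s \<in> {0..T}; t \<in> {0..T}; \<bar>s - t\<bar> < d\<rbrakk> \<Longrightarrow> norm (x s - x t) < e"
proof -
  have "e / 3 > 0" using e by simp
  then obtain F where F: "finite F" "F \<subseteq> K" "\<And>x. x \<in> K \<Longrightarrow> \<exists>y\<in>F. \<forall>t\<in>{0..T}. norm (x t - y t) \<le> e / 3"
    using K unfolding totally_bounded_paths_def by meson
  have uc: "\<exists>d>0. \<forall>s\<in>{0..T}. \<forall>t\<in>{0..T}. \<bar>s - t\<bar> < d \<longrightarrow> norm (y s - y t) < e / 3" if "y \<in> F" for y
  proof -
    have "continuous_on {0..T} y" using that F K by (auto simp: totally_bounded_paths_def C_paths_def)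
    then have "uniformly_continuous_on {0..T} y" by (rule compact_uniformly_continuous) simp
    then show ?thesis using \<open>e / 3 > 0\<close> unfolding uniformly_continuous_on_def dist_norm real_norm_def by blast
  qed
  then obtain d where d: "\<And>y. y \<in> F \<Longrightarrow> d y > 0"
    "\<And>y s t. y \<in> F \<Longrightarrow> s \<in> {0..T} \<Longrightarrow> t \<in> {0..T} \<Longrightarrow> \<bar>s - t\<bar> < d y \<Longrightarrow> norm (y s - y t) < e / 3"
    by metis
  define m where "m = Min (insert 1 (d ` F))"
  have m: "m > 0" "\<And>y. y \<in> F \<Longrightarrow> m \<le> d y" using d F(1) by (auto simp: m_def)
  show thesis
  proof (rule that[OF m(1)])
    fix x s t assume h: "x \<in> K" "s \<in> {0..T}" "t \<in> {0..T}" "\<bar>s - t\<bar> < m"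
    then obtain y where y: "y \<in> F" "\<And>t. t \<in> {0..T} \<Longrightarrow> norm (x t - y t) \<le> e / 3" using F(3) by blast
    have "norm (y s - y t) < e / 3" using d(2)[OF y(1) h(2,3)] m(2)[OF y(1)] h(4) by simp
    moreover have "norm (x s - x t) \<le> norm (x s - y s) + norm (y s - y t) + norm (x t - y t)"
    proof -
      have "x s - x t = (x s - y s) + (y s - y t) - (x t - y t)" by simp
      then show ?thesis by (smt (verit) norm_triangle_ineq norm_triangle_ineq4)
    qed
    ultimately show "norm (x s - x t) < e" using y(2)[OF h(2)] y(2)[OF h(3)] by linarith
  qed
qed

text \<open>
  A totally bounded set of paths, extended constantly outside \<open>[0,T]\<close>, lies in a compact set of
  bounded continuous functions.
\<close>
lemma totally_bounded_paths_lift: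
  fixes K :: "(real \<Rightarrow> 'h::{real_normed_vector,banach}) set"
  assumes K: "totally_bounded_paths T K" and T: "T > 0"
  obtains C :: "(real \<Rightarrow>\<^sub>C 'h) set" and l where "compact C" "\<And>x. x \<in> K \<Longrightarrow> l x \<in> C"
    "\<And>x. x \<in> K \<Longrightarrow> restrict (apply_bcontfun (l x)) {0..T} = x"
    "\<And>x y e. x \<in> K \<Longrightarrow> y \<in> K \<Longrightarrow> \<forall>t\<in>{0..T}. norm (x t - y t) \<le> e \<Longrightarrow> dist (l x) (l y) \<le> e"
proof -
  have "\<exists>g :: real \<Rightarrow>\<^sub>C 'h. \<forall>t. apply_bcontfun g t = x (clamp 0 T t)" if "x \<in> K" for x
  proof -
    have "continuous_on (cbox 0 T) x" using that K by (auto simp: totally_bounded_paths_def C_paths_def)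
    then show ?thesis by (rule continuous_on_cbox_bcontfunE) blast
  qed
  then obtain l :: "(real \<Rightarrow> 'h) \<Rightarrow> (real \<Rightarrow>\<^sub>C 'h)" where l: "\<And>x t. x \<in> K \<Longrightarrow> apply_bcontfun (l x) t = x (clamp 0 T t)"
    by metis
  have cl: "clamp 0 T t \<in> {0..T}" for t using clamp_in_interval[of 0 T t] T by simp
  have cl': "clamp 0 T t = t" if "t \<in> {0..T}" for t using that by (intro clamp_cancel_cbox) simp
  have dist: "dist (l x) (l y) \<le> e" if "x \<in> K" "y \<in> K" "\<forall>t\<in>{0..T}. norm (x t - y t) \<le> e" for x y e
    using that cl by (intro dist_bound) (simp add: l dist_norm)
  have res: "restrict (apply_bcontfun (l x)) {0..T} = x" if "x \<in> K" for x
  proof (rule ext)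
    fix t show "restrict (apply_bcontfun (l x)) {0..T} t = x t"
    proof (cases "t \<in> {0..T}")
      case False
      have "x \<in> extensional {0..T}" using that K by (auto simp: totally_bounded_paths_def C_paths_def)
      then show ?thesis using False extensional_arb by fastforce
    qed (simp add: l that cl')
  qed
  have "compact (closure (l ` K))"
    unfolding compact_eq_totally_bounded
  proof (intro conjI allI impI)
    show "complete (closure (l ` K))" by (simp add: complete_eq_closed)
    fix e :: real assume e: "e > 0"
    then have "e / 2 > 0" by simp
    then obtain F where F: "finite F" "F \<subseteq> K" "\<And>x. x \<in> K \<Longrightarrow> \<exists>y\<in>F. \<forall>t\<in>{0..T}. norm (x t - y t) \<le> e / 2"
      using K unfolding totally_bounded_paths_def by meson
    have "l ` K \<subseteq> (\<Union>y\<in>l ` F. cball y (e / 2))"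
    proof
      fix z assume "z \<in> l ` K"
      then obtain x where x: "x \<in> K" "z = l x" by blast
      then obtain y where y: "y \<in> F" "\<forall>t\<in>{0..T}. norm (x t - y t) \<le> e / 2" using F by blast
      then have "dist (l x) (l y) \<le> e / 2" using F x by (intro dist) auto
      then show "z \<in> (\<Union>y\<in>l ` F. cball y (e / 2))" using x y by (auto simp: dist_commute)
    qed
    moreover have "closed (\<Union>y\<in>l ` F. cball y (e / 2))" using F(1) by (intro closed_UN) auto
    ultimately have "closure (l ` K) \<subseteq> (\<Union>y\<in>l ` F. cball y (e / 2))" by (rule closure_minimal)
    also have "\<dots> \<subseteq> (\<Union>y\<in>l ` F. ball y e)" using e by fastforce
    finally show "\<exists>k. finite k \<and> closure (l ` K) \<subseteq> (\<Union>y\<in>k. ball y e)" using F(1) by blast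
  qed
  then show thesis
    by (rule that) (use res dist in \<open>auto intro: closure_subset[THEN subsetD]\<close>)
qed

lemma restrict_bcontfun_C_paths: "restrict (apply_bcontfun \<phi>) {0..T} \<in> C_paths T"
proof -
  have "continuous_on {0..T} (restrict (apply_bcontfun \<phi>) {0..T}) = continuous_on {0..T} (apply_bcontfun \<phi>)"
    by (intro continuous_on_cong) auto
  then show ?thesis by (simp add: C_paths_def)
qed

lemma continuous_functional_on_totally_bounded:
  fixes K :: "(real \<Rightarrow> 'h::{real_normed_vector,banach}) set"
  assumes K: "totally_bounded_paths T K" and T: "T > 0" and h: "continuous_wrt (d_sup T) (C_paths T) h"
  shows "\<exists>B. \<forall>x\<in>K. \<bar>h x\<bar> \<le> B"
    "e > 0 \<Longrightarrow> \<exists>d>0. \<forall>x\<in>K. \<forall>y\<in>K. (\<forall>t\<in>{0..T}. norm (x t - y t) \<le> d) \<longrightarrow> \<bar>h x - h y\<bar> < e"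
proof -
  obtain C :: "(real \<Rightarrow>\<^sub>C 'h) set" and l where C: "compact C" and lC: "\<And>x. x \<in> K \<Longrightarrow> l x \<in> C"
    and lr: "\<And>x. x \<in> K \<Longrightarrow> restrict (apply_bcontfun (l x)) {0..T} = x"
    and ld: "\<And>x y e. x \<in> K \<Longrightarrow> y \<in> K \<Longrightarrow> \<forall>t\<in>{0..T}. norm (x t - y t) \<le> e \<Longrightarrow> dist (l x) (l y) \<le> e"
    by (rule totally_bounded_paths_lift[OF K T]) (rule that)
  define E where "E \<phi> = restrict (apply_bcontfun \<phi>) {0..T}" for \<phi> :: "real \<Rightarrow>\<^sub>C 'h"
  have EC: "E \<phi> \<in> C_paths T" for \<phi> unfolding E_def by (rule restrict_bcontfun_C_paths)
  have Ed: "d_sup T (E \<phi>) (E \<psi>) \<le> dist \<phi> \<psi>" for \<phi> \<psi>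
    unfolding d_sup_def using T dist_bounded by (intro cSUP_least) (auto simp: E_def dist_norm[symmetric])
  have cont: "continuous_on C (\<lambda>\<phi>. h (E \<phi>))"
    unfolding continuous_on_iff
  proof (intro ballI allI impI)
    fix \<phi> and e :: real assume "e > 0"
    then obtain d where d: "d > 0" "\<And>b. b \<in> C_paths T \<Longrightarrow> d_sup T (E \<phi>) b < d \<Longrightarrow> \<bar>h b - h (E \<phi>)\<bar> < e"
      using h EC unfolding continuous_wrt_def by meson
    show "\<exists>d>0. \<forall>\<psi>\<in>C. dist \<psi> \<phi> < d \<longrightarrow> dist (h (E \<psi>)) (h (E \<phi>)) < e"
    proof (intro exI[of _ d] conjI ballI impI d(1))
      fix \<psi> assume "dist \<psi> \<phi> < d"
      then have "d_sup T (E \<phi>) (E \<psi>) < d" using Ed[of \<phi> \<psi>] by (simp add: dist_commute)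
      then show "dist (h (E \<psi>)) (h (E \<phi>)) < e" using d(2) EC by (simp add: dist_real_def)
    qed
  qed
  have "bounded ((\<lambda>\<phi>. h (E \<phi>)) ` C)" using cont C by (intro compact_imp_bounded compact_continuous_image)
  then obtain B where "\<forall>\<phi>\<in>C. \<bar>h (E \<phi>)\<bar> \<le> B" unfolding bounded_iff by auto
  then have "\<forall>x\<in>K. \<bar>h x\<bar> \<le> B" using lC lr by (metis E_def)
  then show "\<exists>B. \<forall>x\<in>K. \<bar>h x\<bar> \<le> B" ..
  assume "e > 0"
  moreover have "uniformly_continuous_on C (\<lambda>\<phi>. h (E \<phi>))" using cont C by (rule compact_uniformly_continuous)
  ultimately obtain d where d: "d > 0" "\<And>\<phi> \<psi>. \<phi> \<in> C \<Longrightarrow> \<psi> \<in> C \<Longrightarrow> dist \<psi> \<phi> < d \<Longrightarrow> dist (h (E \<psi>)) (h (E \<phi>)) < e"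
    unfolding uniformly_continuous_on_def by meson
  show "\<exists>d>0. \<forall>x\<in>K. \<forall>y\<in>K. (\<forall>t\<in>{0..T}. norm (x t - y t) \<le> d) \<longrightarrow> \<bar>h x - h y\<bar> < e"
  proof (intro exI[of _ "d / 2"] conjI ballI impI)
    show "d / 2 > 0" using d by simp
    fix x y assume xy: "x \<in> K" "y \<in> K" "\<forall>t\<in>{0..T}. norm (x t - y t) \<le> d / 2"
    then have "dist (l x) (l y) \<le> d / 2" by (intro ld) auto
    then have "dist (h (E (l x))) (h (E (l y))) < e" using d lC xy by auto
    then show "\<bar>h x - h y\<bar> < e" using lr xy by (simp add: E_def dist_real_def)
  qed
qed

lemma d_inf_le:
  assumes "T > 0" "\<And>r. r \<in> {0..T} \<Longrightarrow> norm (x (min r t) - y (min r s)) \<le> B"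
  shows "d_inf T (t, x) (s, y) \<le> \<bar>t - s\<bar> + B"
  unfolding d_inf_def using assms by (auto intro!: cSUP_least)

lemma continuous_Hamiltonian_on_totally_bounded:
  fixes K :: "(real \<Rightarrow> 'h::{real_normed_vector,banach}) set"
  assumes K: "totally_bounded_paths T K" and T: "T > 0"
    and F: "continuous_wrt (d_inf_H T) ({0..T} \<times> C_paths T \<times> UNIV) (\<lambda>(t, x, z). F t x z)"
  shows "\<exists>B. \<forall>x\<in>K. \<forall>t\<in>{0..T}. \<bar>F t x z\<bar> \<le> B"
proof -
  obtain C :: "(real \<Rightarrow>\<^sub>C 'h) set" and l where C: "compact C" and lC: "\<And>x. x \<in> K \<Longrightarrow> l x \<in> C"
    and lr: "\<And>x. x \<in> K \<Longrightarrow> restrict (apply_bcontfun (l x)) {0..T} = x"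
    by (rule totally_bounded_paths_lift[OF K T]) blast
  define E where "E \<phi> = restrict (apply_bcontfun \<phi>) {0..T}" for \<phi> :: "real \<Rightarrow>\<^sub>C 'h"
  have EC: "E \<phi> \<in> C_paths T" for \<phi> unfolding E_def by (rule restrict_bcontfun_C_paths)
  have cont: "continuous_on ({0..T} \<times> C) (\<lambda>(t, \<phi>). F t (E \<phi>) z)"
    unfolding continuous_on_iff
  proof (intro ballI allI impI)
    fix a and e :: real assume a: "a \<in> {0..T} \<times> C" and e: "e > 0"
    obtain t \<phi> where a': "a = (t, \<phi>)" by (cases a)
    have t: "t \<in> {0..T}" using a a' by auto
    have mem: "(t, E \<phi>, z) \<in> {0..T} \<times> C_paths T \<times> UNIV" using t EC by simp
    obtain d where d: "d > 0" and db: "\<forall>b\<in>{0..T} \<times> C_paths T \<times> UNIV. d_inf_H T (t, E \<phi>, z) b < d \<longrightarrow>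
        \<bar>(case b of (t, x, z) \<Rightarrow> F t x z) - (case (t, E \<phi>, z) of (t, x, z) \<Rightarrow> F t x z)\<bar> < e"
      using bspec[OF F[unfolded continuous_wrt_def] mem] e by (auto simp only:)
    have "uniformly_continuous_on {0..T} (apply_bcontfun \<phi>)" by (rule compact_uniformly_continuous) auto
    moreover have "d / 4 > 0" using d by simp
    ultimately have "\<exists>d'>0. \<forall>r\<in>{0..T}. \<forall>s\<in>{0..T}. dist s r < d' \<longrightarrow> dist (apply_bcontfun \<phi> s) (apply_bcontfun \<phi> r) < d
        / 4"
      unfolding uniformly_continuous_on_def by blast
    then obtain d' where d': "d' > 0" and d'b: "\<forall>r\<in>{0..T}. \<forall>s\<in>{0..T}. dist s r < d' \<longrightarrow>
        dist (apply_bcontfun \<phi> s) (apply_bcontfun \<phi> r) < d / 4"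
      by blast
    show "\<exists>d>0. \<forall>b\<in>{0..T} \<times> C. dist b a < d \<longrightarrow> dist (case b of (t, \<phi>) \<Rightarrow> F t (E \<phi>) z) (case a of (t, \<phi>) \<Rightarrow> F t (E \<phi>) z)
        < e"
    proof (intro exI[of _ "min d' (d / 4)"] conjI ballI impI)
      show "min d' (d / 4) > 0" using d d' by simp
      fix b assume b: "b \<in> {0..T} \<times> C" "dist b a < min d' (d / 4)"
      obtain s \<psi> where b': "b = (s, \<psi>)" by (cases b)
      have s: "s \<in> {0..T}" using b b' by auto
      have ds: "\<bar>t - s\<bar> < min d' (d / 4)" using dist_fst_le[of b a] b(2)
          by (simp add: a' b' dist_real_def abs_minus_commute)
      have dp: "dist \<psi> \<phi> < d / 4" using dist_snd_le[of b a] b(2) by (simp add: a' b')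
      have "d_inf T (t, E \<phi>) (s, E \<psi>) \<le> \<bar>t - s\<bar> + d / 2"
      proof (rule d_inf_le[OF T])
        fix r assume r: "r \<in> {0..T}"
        have m: "min r t \<in> {0..T}" "min r s \<in> {0..T}" using r s t by auto
        have "\<bar>t - s\<bar> < d'" using ds by simp
        then have "dist (min r t) (min r s) < d'" using d' by (auto simp: dist_real_def min_def)
        then have "dist (apply_bcontfun \<phi> (min r t)) (apply_bcontfun \<phi> (min r s)) < d / 4" using d'b m by blast
        moreover have "dist (apply_bcontfun \<phi> (min r s)) (apply_bcontfun \<psi> (min r s)) < d / 4"
          using dist_bounded[of \<phi> "min r s" \<psi>] dp by (simp add: dist_commute)
        ultimately have "dist (apply_bcontfun \<phi> (min r t)) (apply_bcontfun \<psi> (min r s)) < d / 2"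
          using dist_triangle[of "apply_bcontfun \<phi> (min r t)" "apply_bcontfun \<psi> (min r s)"
              "apply_bcontfun \<phi> (min r s)"] by linarith
        then show "norm (E \<phi> (min r t) - E \<psi> (min r s)) \<le> d / 2" using m unfolding E_def by (simp add: dist_norm)
      qed
      then have "d_inf_H T (t, E \<phi>, z) (s, E \<psi>, z) < d" using ds d by (simp add: d_inf_H_def)
      then have "\<bar>F s (E \<psi>) z - F t (E \<phi>) z\<bar> < e" using db[rule_format, of "(s, E \<psi>, z)"] s EC by simp
      then show "dist (case b of (t, \<phi>) \<Rightarrow> F t (E \<phi>) z) (case a of (t, \<phi>) \<Rightarrow> F t (E \<phi>) z) < e"
        by (simp add: a' b' dist_real_def)
    qed
  qed
  have "bounded ((\<lambda>(t, \<phi>). F t (E \<phi>) z) ` ({0..T} \<times> C))"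
    using C by (intro compact_imp_bounded compact_continuous_image[OF cont] compact_Times compact_Icc)
  then obtain B where B: "\<And>a. a \<in> {0..T} \<times> C \<Longrightarrow> \<bar>(\<lambda>(t, \<phi>). F t (E \<phi>) z) a\<bar> \<le> B" unfolding bounded_iff by auto
  have "\<bar>F t x z\<bar> \<le> B" if "x \<in> K" "t \<in> {0..T}" for x t
    using B[of "(t, l x)"] lC[OF that(1)] lr[OF that(1)] that by (simp add: E_def)
  then show ?thesis by blast
qed

text \<open>
  An Ehrling type inequality: up to a small multiple of the \<open>V\<close>-norm, the \<open>H\<close>-norm on \<open>V\<close> is
  controlled by finitely many functionals.
\<close>
lemma compact_embedding_estimate:
  fixes j :: "'v::{banach,second_countable_topology} \<Rightarrow>\<^sub>L 'h::{real_inner,banach}"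
  assumes j: "evolution_triple j" and \<eta>: "\<eta> > 0"
  obtains W where "finite W" "\<And>v. (norm (blinfun_apply j v))\<^sup>2 \<le> \<eta> * norm (blinfun_apply j v) * norm v
     + norm v * (\<Sum>w\<in>W. \<bar>blinfun_apply j v \<bullet> blinfun_apply j w\<bar>)"
proof -
  have cp: "compact (closure (blinfun_apply j ` cball 0 1))"
    using j bounded_cball unfolding evolution_triple_def by blast
  have "closure (blinfun_apply j ` cball 0 1) \<subseteq> (\<Union>w\<in>cball 0 1. ball (blinfun_apply j w) \<eta>)"
  proof
    fix z assume "z \<in> closure (blinfun_apply j ` cball 0 1)"
    then obtain y where "y \<in> blinfun_apply j ` cball 0 1" "dist y z < \<eta>" using \<eta> closure_approachable by blast
    then show "z \<in> (\<Union>w\<in>cball 0 1. ball (blinfun_apply j w) \<eta>)" by auto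
  qed
  then obtain W where W: "W \<subseteq> cball 0 1" "finite W" "closure (blinfun_apply j ` cball 0 1) \<subseteq> (\<Union>w\<in>W. ball
      (blinfun_apply j w) \<eta>)"
    using compactE_image[OF cp, of "cball 0 1" "\<lambda>w. ball (blinfun_apply j w) \<eta>"] by (metis open_ball)
  show thesis
  proof (rule that[OF W(2)])
    fix v
    show "(norm (blinfun_apply j v))\<^sup>2 \<le> \<eta> * norm (blinfun_apply j v) * norm v + norm v * (\<Sum>w\<in>W. \<bar>blinfun_apply j v
        \<bullet> blinfun_apply j w\<bar>)"
    proof (cases "v = 0")
      case False
      define u where "u = (1 / norm v) *\<^sub>R v"
      have vu: "v = norm v *\<^sub>R u" using False by (simp add: u_def)
      have "norm u = 1" using False by (simp add: u_def)
      then have "blinfun_apply j u \<in> closure (blinfun_apply j ` cball 0 1)" using closure_subset by fastforce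
      then obtain w where w: "w \<in> W" "norm (blinfun_apply j u - blinfun_apply j w) < \<eta>"
        using W(3) by (auto simp: dist_norm norm_minus_commute)
      have "(norm (blinfun_apply j v))\<^sup>2 = norm v * (blinfun_apply j v \<bullet> blinfun_apply j u)"
      proof -
        have "(norm (blinfun_apply j v))\<^sup>2 = blinfun_apply j v \<bullet> blinfun_apply j (norm v *\<^sub>R u)"
          using vu by (simp add: power2_norm_eq_inner)
        then show ?thesis by (simp add: blinfun.scaleR_right)
      qed
      also have "blinfun_apply j v \<bullet> blinfun_apply j u = blinfun_apply j v \<bullet> (blinfun_apply j u - blinfun_apply j w)
          + blinfun_apply j v \<bullet> blinfun_apply j w"
        by (simp add: inner_diff_right)
      also have "norm v * \<dots> \<le> norm v * (norm (blinfun_apply j v) * \<eta> + (\<Sum>w\<in>W. \<bar>blinfun_apply j v \<bullet> blinfun_apply j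
          w\<bar>))"
      proof (intro mult_left_mono add_mono)
        have "blinfun_apply j v \<bullet> (blinfun_apply j u - blinfun_apply j w)
            \<le> norm (blinfun_apply j v) * norm (blinfun_apply j u - blinfun_apply j w)"
          by (rule norm_cauchy_schwarz)
        also have "\<dots> \<le> norm (blinfun_apply j v) * \<eta>" using w by (intro mult_left_mono) auto
        finally show "blinfun_apply j v \<bullet> (blinfun_apply j u - blinfun_apply j w) \<le> norm (blinfun_apply j v) * \<eta>" .
        have "blinfun_apply j v \<bullet> blinfun_apply j w \<le> \<bar>blinfun_apply j v \<bullet> blinfun_apply j w\<bar>" by simp
        also have "\<dots> \<le> (\<Sum>w\<in>W. \<bar>blinfun_apply j v \<bullet> blinfun_apply j w\<bar>)"
            by (rule member_le_sum[OF w(1)]) (use W in auto)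
        finally show "blinfun_apply j v \<bullet> blinfun_apply j w \<le> (\<Sum>w\<in>W. \<bar>blinfun_apply j v \<bullet> blinfun_apply j w\<bar>)" .
      qed auto
      finally show ?thesis by (simp add: algebra_simps)
    qed (simp add: blinfun.zero_right)
  qed
qed

lemma finite_partition_by_bounded_functions:
  fixes \<theta> :: "'x \<Rightarrow> 'i \<Rightarrow> real"
  assumes I: "finite I" and bd: "\<And>x i. x \<in> K \<Longrightarrow> i \<in> I \<Longrightarrow> \<bar>\<theta> x i\<bar> \<le> B" and e: "e > 0"
  obtains F where "finite F" "F \<subseteq> K" "\<And>x. x \<in> K \<Longrightarrow> \<exists>y\<in>F. \<forall>i\<in>I. \<bar>\<theta> x i - \<theta> y i\<bar> \<le> e"
proof -
  \<comment> \<open>One representative for each of the finitely many vectors of rounded values.\<close>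
  define c where "c x = restrict (\<lambda>i. \<lfloor>\<theta> x i / e\<rfloor>) I" for x
  define M where "M = \<lceil>B / e\<rceil> + 1"
  have "c ` K \<subseteq> I \<rightarrow>\<^sub>E {-M..M}"
  proof
    fix z assume "z \<in> c ` K"
    then obtain x where x: "x \<in> K" "z = c x" by blast
    have "\<lfloor>\<theta> x i / e\<rfloor> \<in> {-M..M}" if i: "i \<in> I" for i
    proof -
      have "\<bar>\<theta> x i\<bar> / e \<le> B / e" using bd[OF x(1) i] e by (intro divide_right_mono) auto
      then have "\<bar>\<theta> x i / e\<bar> \<le> B / e" using e by (simp add: abs_divide)
      moreover have "B / e \<le> real_of_int \<lceil>B / e\<rceil>" by simp
      ultimately have "\<theta> x i / e \<le> real_of_int \<lceil>B / e\<rceil>" "- real_of_int \<lceil>B / e\<rceil> \<le> \<theta> x i / e" by linarith+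
      then show ?thesis unfolding M_def atLeastAtMost_iff le_floor_iff floor_le_iff by simp
    qed
    then show "z \<in> I \<rightarrow>\<^sub>E {-M..M}" using x by (auto simp: c_def)
  qed
  moreover have "finite (I \<rightarrow>\<^sub>E {-M..M})" using I by (intro finite_PiE) auto
  ultimately have fin: "finite (c ` K)" using finite_subset by blast
  define r where "r z = (SOME x. x \<in> K \<and> c x = z)" for z
  have r: "r (c x) \<in> K \<and> c (r (c x)) = c x" if "x \<in> K" for x
    unfolding r_def by (rule someI_ex) (use that in blast)
  show thesis
  proof (rule that[of "r ` c ` K"])
    show "finite (r ` c ` K)" using fin by simp
    show "r ` c ` K \<subseteq> K" using r by auto
    fix x assume x: "x \<in> K"
    show "\<exists>y\<in>r ` c ` K. \<forall>i\<in>I. \<bar>\<theta> x i - \<theta> y i\<bar> \<le> e"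
    proof (intro bexI[of _ "r (c x)"] ballI)
      fix i assume i: "i \<in> I"
      have "c (r (c x)) i = c x i" using r[OF x] by simp
      then have "\<lfloor>\<theta> (r (c x)) i / e\<rfloor> = \<lfloor>\<theta> x i / e\<rfloor>" using i by (simp add: c_def)
      then have "\<bar>\<theta> x i / e - \<theta> (r (c x)) i / e\<bar> \<le> 1" by linarith
      then have "\<bar>(\<theta> x i - \<theta> (r (c x)) i) / e\<bar> \<le> 1" by (simp add: diff_divide_distrib)
      then show "\<bar>\<theta> x i - \<theta> (r (c x)) i\<bar> \<le> e" using e by (simp add: abs_divide divide_le_eq)
    qed (use x in auto)
  qed
qed

context evolution_problem
begin

text \<open>
  Two trajectories are uniformly close as soon as finitely many scalar functions \<open>(x(\<cdot>), w)\<close> are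
  close, and by equicontinuity it suffices to test those at finitely many times.
\<close>
lemma trajectories_totally_bounded:
  assumes L: "L \<ge> 0" and t0: "0 \<le> t\<^sub>0" "t\<^sub>0 < T" and x0: "x\<^sub>0 \<in> C_paths T"
  shows "totally_bounded_paths T (trajectories T p q j A L t\<^sub>0 x\<^sub>0)"
proof -
  let ?K = "trajectories T p q j A L t\<^sub>0 x\<^sub>0"
  obtain R where R: "R \<ge> 0" "\<And>x t. x \<in> ?K \<Longrightarrow> t \<in> {0..T} \<Longrightarrow> norm (x t) \<le> R"
    using trajectories_bounded[OF L t0 x0] by blast
  define C where "C = L * (1 + R)"
  have C: "C \<ge> 0" using L R by (simp add: C_def)
  have data: "\<exists>f X g. evolves t\<^sub>0 x f X g \<and> (AE t in lebesgue_on {t\<^sub>0..T}. norm (f t) \<le> C)" if x: "x \<in> ?K" for x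
  proof -
    obtain f X g where "evolves t\<^sub>0 x f X g" using trajectories_forcing[OF x t0] .
    then show ?thesis using forcing_bounded[OF L t0 x R(2)[OF x]] unfolding C_def by blast
  qed
  have R': "norm (x t) \<le> R" if "x \<in> ?K" "t \<in> {t\<^sub>0..T}" for x t using R(2) that t0 by auto
  obtain D where D: "D \<ge> 0"
    and D1: "\<And>x f X g. \<lbrakk>evolves t\<^sub>0 x f X g; \<And>t. t \<in> {t\<^sub>0..T} \<Longrightarrow> norm (x t) \<le> R;
        AE t in lebesgue_on {t\<^sub>0..T}. norm (f t) \<le> C\<rbrakk>
       \<Longrightarrow> integral {t\<^sub>0..T} (\<lambda>r. norm (X r)) \<le> D"
    and D2: "\<And>e. e > 0 \<Longrightarrow> \<exists>d>0. \<forall>x f X g. evolves t\<^sub>0 x f X g \<longrightarrow> (\<forall>t\<in>{t\<^sub>0..T}. norm (x t) \<le> R) \<longrightarrow>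
        (AE t in lebesgue_on {t\<^sub>0..T}. norm (f t) \<le> C)
       \<longrightarrow> (\<forall>s t v. t\<^sub>0 \<le> s \<longrightarrow> s \<le> t \<longrightarrow> t \<le> T \<longrightarrow> t - s < d \<longrightarrow> \<bar>(x t - x s) \<bullet> blinfun_apply j v\<bar> \<le> e * norm v)"
    by (rule weak_equicontinuity[OF t0 R(1) C]) blast
  have close: "\<exists>W \<theta>. finite W \<and> \<theta> > 0 \<and> (\<forall>x\<in>?K. \<forall>y\<in>?K.
      (\<forall>w\<in>W. \<forall>t\<in>{t\<^sub>0..T}. \<bar>(x t - y t) \<bullet> blinfun_apply j w\<bar> \<le> \<theta>) \<longrightarrow> (\<forall>t\<in>{0..T}. norm (x t - y t)
          \<le> e))" if e: "e > 0" for e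
  proof -
    \<comment> \<open>The energy inequality gives \<open>|x-y|\<^sup>2 \<le> e\<^sup>2\<close> once the \<open>L\<^sup>1\<close> distance of the paths is at most
      \<open>\<rho>\<close>. The other constants achieve this by way of \<open>|x-y| \<le> \<delta> + |x-y|\<^sup>2/\<delta>\<close>.\<close>
    define \<rho> where "\<rho> = e\<^sup>2 / (4 * (C + 1))"
    have \<rho>: "\<rho> > 0" using e C by (simp add: \<rho>_def)
    define \<delta> where "\<delta> = \<rho> / (2 * T)"
    have \<delta>: "\<delta> > 0" using \<rho> T by (simp add: \<delta>_def)
    define \<eta> where "\<eta> = \<delta> * \<rho> / (8 * (D + 1) * (2 * R + 1))"
    have \<eta>: "\<eta> > 0" using \<delta> \<rho> D R by (simp add: \<eta>_def)
    obtain W where W: "finite W" "\<And>v. (norm (blinfun_apply j v))\<^sup>2 \<le> \<eta> * norm (blinfun_apply j v) * norm v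
     + norm v * (\<Sum>w\<in>W. \<bar>blinfun_apply j v \<bullet> blinfun_apply j w\<bar>)"
      by (rule compact_embedding_estimate[OF triple \<eta>]) (rule that)
    define \<theta> where "\<theta> = \<delta> * \<rho> / (8 * (D + 1) * (real (card W) + 1))"
    have \<theta>: "\<theta> > 0" using \<delta> \<rho> D by (simp add: \<theta>_def add_nonneg_pos)
    have bnd: "norm (x t - y t) \<le> e"
      if x: "x \<in> ?K" and y: "y \<in> ?K" and cl: "\<And>w t. w \<in> W \<Longrightarrow> t \<in> {t\<^sub>0..T} \<Longrightarrow> \<bar>(x t - y t) \<bullet> blinfun_apply j w\<bar> \<le> \<theta>"
        and t: "t \<in> {0..T}" for x y t
    proof (cases "t \<le> t\<^sub>0")
      case True
      then have "x t = y t" using trajectories_initial[OF x] trajectories_initial[OF y] t by simp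
      then show ?thesis using e by simp
    next
      case False
      then have tt: "t\<^sub>0 \<le> t" "t \<le> T" using t by auto
      obtain f X g where ex: "evolves t\<^sub>0 x f X g" and f: "AE t in lebesgue_on {t\<^sub>0..T}. norm (f t) \<le> C"
          using data[OF x] by blast
      obtain k Y m where ey: "evolves t\<^sub>0 y k Y m" and k: "AE t in lebesgue_on {t\<^sub>0..T}. norm (k t) \<le> C"
          using data[OF y] by blast
      define H where "H = 2 * R * \<eta> + real (card W) * \<theta>"
      have H: "H \<ge> 0" using R \<eta> \<theta> by (simp add: H_def)
      have nX: "(\<lambda>r. norm (X r)) absolutely_integrable_on {t\<^sub>0..T}"
          and nY: "(\<lambda>r. norm (Y r)) absolutely_integrable_on {t\<^sub>0..T}"
        using ex ey p by (auto simp: evolves_def intro: Lp_fun_norm_integrable(1)[of p])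
      let ?b = "\<lambda>r. \<delta> + H / \<delta> * (norm (X r) + norm (Y r))"
      have bi: "?b absolutely_integrable_on {t\<^sub>0..T}"
        by (intro set_integral_add(1) set_integrable_mult_right nX nY absolutely_integrable_continuous_real
            continuous_intros)
      have bint: "integral {t\<^sub>0..T} ?b \<le> \<rho>"
      proof -
        have "integral {t\<^sub>0..T} ?b = \<delta> * (T - t\<^sub>0) + H / \<delta> * (integral {t\<^sub>0..T} (\<lambda>r. norm (X r)) + integral {t\<^sub>0..T}
            (\<lambda>r. norm (Y r)))"
        proof -
          have i: "(\<lambda>r. norm (X r)) integrable_on {t\<^sub>0..T}" "(\<lambda>r. norm (Y r)) integrable_on {t\<^sub>0..T}"
            using nX nY absolutely_integrable_imp_HK by auto
          have "integral {t\<^sub>0..T} ?b = integral {t\<^sub>0..T} (\<lambda>r. \<delta>) + integral {t\<^sub>0..T} (\<lambda>r. H / \<delta> * (norm (X r)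
              + norm (Y r)))"
            using i by (intro Henstock_Kurzweil_Integration.integral_add integrable_on_mult_right integrable_add)
                auto
          moreover have "integral {t\<^sub>0..T} (\<lambda>r. H / \<delta> * (norm (X r) + norm (Y r)))
              = H / \<delta> * integral {t\<^sub>0..T} (\<lambda>r. norm (X r) + norm (Y r))"
            by (rule integral_mult_right)
          moreover have "integral {t\<^sub>0..T} (\<lambda>r. norm (X r) + norm (Y r)) = integral {t\<^sub>0..T} (\<lambda>r. norm (X r))
              + integral {t\<^sub>0..T} (\<lambda>r. norm (Y r))"
            using i by (rule Henstock_Kurzweil_Integration.integral_add)
          ultimately show ?thesis using t0 by (simp add: mult.commute)
        qed
        also have "\<dots> \<le> \<delta> * T + H / \<delta> * (D + D)"
          using D1[OF ex R'[OF x] f] D1[OF ey R'[OF y] k] \<delta> H t0 by (intro add_mono mult_left_mono) auto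
        also have "\<delta> * T = \<rho> / 2" using T by (simp add: \<delta>_def)
        also have "H / \<delta> * (D + D) \<le> \<rho> / 2"
        proof -
          have "2 * R * \<eta> \<le> (2 * R + 1) * \<eta>" using \<eta> by (intro mult_right_mono) auto
          also have "\<dots> = \<delta> * \<rho> / (8 * (D + 1))" using R(1) D by (simp add: \<eta>_def)
          finally have 1: "2 * R * \<eta> \<le> \<delta> * \<rho> / (8 * (D + 1))" .
          have "real (card W) * \<theta> \<le> (real (card W) + 1) * \<theta>" using \<theta> by (intro mult_right_mono) auto
          also have "\<dots> = \<delta> * \<rho> / (8 * (D + 1))"
          proof -
            have "real (card W) + 1 \<noteq> 0" by linarith
            then show ?thesis using D by (simp add: \<theta>_def)
          qed
          finally have "H \<le> \<delta> * \<rho> / (8 * (D + 1)) + \<delta> * \<rho> / (8 * (D + 1))" using 1 unfolding H_def by linarith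
          also have "\<dots> = \<delta> * \<rho> / (4 * (D + 1))"
          proof -
            have "x / (8 * y) + x / (8 * y) = x / (4 * y)" for x y :: real
                by (cases "y = 0") (simp_all add: field_simps)
            then show ?thesis .
          qed
          finally have "H \<le> \<delta> * \<rho> / (4 * (D + 1))" .
          then have "H / \<delta> \<le> \<rho> / (4 * (D + 1))" using \<delta> by (simp add: divide_le_eq mult.commute)
          then have "H / \<delta> * (D + D) \<le> \<rho> / (4 * (D + 1)) * (D + D)" using D by (intro mult_right_mono) auto
          also have "\<dots> \<le> \<rho> / (4 * (D + 1)) * (2 * (D + 1))" using D \<rho> by (intro mult_left_mono) auto
          also have "\<dots> = \<rho> / 2" using D by (simp add: divide_simps)
          finally show ?thesis .
        qed
        finally show ?thesis by simp
      qed
      have we: "AE r in lebesgue_on {t\<^sub>0..T}. x r = blinfun_apply j (X r)" "AE r in lebesgue_on {t\<^sub>0..T}. y r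
          = blinfun_apply j (Y r)"
        using ex ey by (auto simp: evolves_def weak_evolution_def)
      have ptw: "AE r in lebesgue_on {t\<^sub>0..T}. norm (x r - y r) \<le> ?b r"
        using we AE_space
      proof eventually_elim
        case (elim r)
        define d where "d = norm (x r - y r)"
        have r: "r \<in> {t\<^sub>0..T}" using elim by (simp add: space_restrict_space)
        have xy: "x r - y r = blinfun_apply j (X r - Y r)" using elim by (simp add: blinfun.diff_right)
        have d2R: "d \<le> 2 * R" unfolding d_def using norm_triangle_ineq4[of "x r" "y r"] R'[OF x r] R'[OF y r]
            by linarith
        have "d\<^sup>2 \<le> \<eta> * d * norm (X r - Y r) + norm (X r - Y r) * (\<Sum>w\<in>W. \<bar>(x r - y r) \<bullet> blinfun_apply j w\<bar>)"
          unfolding d_def xy by (rule W(2))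
        also have "\<dots> \<le> \<eta> * (2 * R) * norm (X r - Y r) + norm (X r - Y r) * (real (card W) * \<theta>)"
          using d2R \<eta> cl[OF _ r] by (intro add_mono mult_left_mono mult_right_mono sum_bounded_above) auto
        also have "\<dots> = H * norm (X r - Y r)" by (simp add: H_def algebra_simps)
        also have "\<dots> \<le> H * (norm (X r) + norm (Y r))" using H by (intro mult_left_mono norm_triangle_ineq4)
        finally have d2: "d\<^sup>2 \<le> H * (norm (X r) + norm (Y r))" .
        have "d \<le> \<delta> + d\<^sup>2 / \<delta>"
        proof (cases "d \<le> \<delta>")
          case True
          then show ?thesis using \<delta> by (simp add: add_increasing2)
        next
          case False
          then have "\<delta> * d \<le> d * d" by (intro mult_right_mono) (auto simp: d_def)
          then have "d \<le> d\<^sup>2 / \<delta>" using \<delta> by (simp add: le_divide_eq power2_eq_square mult.commute)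
          then show ?thesis using \<delta> by simp
        qed
        also have "d\<^sup>2 / \<delta> \<le> H * (norm (X r) + norm (Y r)) / \<delta>" using d2 \<delta> by (intro divide_right_mono) auto
        finally show ?case by (simp add: d_def)
      qed
      have "(norm (x t - y t))\<^sup>2 / 2 - (norm (x t\<^sub>0 - y t\<^sub>0))\<^sup>2 / 2 \<le> integral {t\<^sub>0..t} (\<lambda>r. (f r - k r) \<bullet> (x r
          - y r))"
        by (rule energy_difference(2)[OF ex ey order_refl tt t0(1)])
      also have "\<dots> \<le> integral {t\<^sub>0..t} (\<lambda>r. 2 * C * ?b r)"
      proof (rule integral_mono_AE_lebesgue_on[OF energy_difference(1)[OF ex ey order_refl tt t0(1)]])
        show "(\<lambda>r. 2 * C * ?b r) absolutely_integrable_on {t\<^sub>0..t}"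
          using absolutely_integrable_on_subinterval[OF bi] tt by (intro set_integrable_mult_right) auto
        have 1: "AE r in lebesgue_on {t\<^sub>0..t}. norm (f r) \<le> C" "AE r in lebesgue_on {t\<^sub>0..t}. norm (k r) \<le> C"
            "AE r in lebesgue_on {t\<^sub>0..t}. norm (x r - y r) \<le> ?b r"
          by (rule AE_lebesgue_on_subset[OF f] AE_lebesgue_on_subset[OF k] AE_lebesgue_on_subset[OF ptw];
              use tt in auto)+
        show "AE r in lebesgue_on {t\<^sub>0..t}. (f r - k r) \<bullet> (x r - y r) \<le> 2 * C * ?b r"
          using 1
        proof eventually_elim
          case (elim r)
          have "(f r - k r) \<bullet> (x r - y r) \<le> norm (f r - k r) * norm (x r - y r)" by (rule norm_cauchy_schwarz)
          also have "\<dots> \<le> (2 * C) * ?b r"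
          proof (rule mult_mono)
            show "norm (f r - k r) \<le> 2 * C" using norm_triangle_ineq4[of "f r" "k r"] elim by linarith
          qed (use elim C in auto)
          finally show ?case .
        qed
      qed
      also have "\<dots> = 2 * C * integral {t\<^sub>0..t} ?b" by (rule integral_mult_right)
      also have "\<dots> \<le> 2 * C * integral {t\<^sub>0..T} ?b"
      proof (rule mult_left_mono)
        have i: "?b integrable_on {t\<^sub>0..T}" using bi by (rule absolutely_integrable_imp_HK)
        show "integral {t\<^sub>0..t} ?b \<le> integral {t\<^sub>0..T} ?b"
          using integrable_on_subinterval[OF i] i tt \<delta> H by (intro integral_subset_le) auto
      qed (use C in auto)
      also have "\<dots> \<le> 2 * C * \<rho>" using bint C by (intro mult_left_mono) auto
      also have "\<dots> \<le> 2 * (C + 1) * \<rho>" using \<rho> by (intro mult_right_mono) auto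
      also have "\<dots> = e\<^sup>2 / 2" using C unfolding \<rho>_def by (simp add: divide_simps)
      finally have "(norm (x t - y t))\<^sup>2 \<le> e\<^sup>2"
        using trajectories_initial[OF x, of t\<^sub>0] trajectories_initial[OF y, of t\<^sub>0] t0 by simp
      then show ?thesis using e by (simp add: power2_le_iff_abs_le)
    qed
    show ?thesis
    proof (intro exI[of _ W] exI[of _ \<theta>] conjI W(1) \<theta> ballI impI)
      fix x y t assume "x \<in> ?K" "y \<in> ?K" "\<forall>w\<in>W. \<forall>t\<in>{t\<^sub>0..T}. \<bar>(x t - y t) \<bullet> blinfun_apply j w\<bar> \<le> \<theta>" "t \<in> {0..T}"
      then show "norm (x t - y t) \<le> e" by (intro bnd) auto
    qed
  qed
  show ?thesis
    unfolding totally_bounded_paths_def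
  proof (intro conjI allI impI)
    show "?K \<subseteq> C_paths T" using trajectories_C_paths by blast
    fix e :: real assume e: "e > 0"
    from close[OF e] obtain W \<theta> where W: "finite W" and \<theta>: "\<theta> > 0" and cl': "\<forall>x\<in>?K. \<forall>y\<in>?K.
      (\<forall>w\<in>W. \<forall>t\<in>{t\<^sub>0..T}. \<bar>(x t - y t) \<bullet> blinfun_apply j w\<bar> \<le> \<theta>) \<longrightarrow> (\<forall>t\<in>{0..T}. norm (x t - y t) \<le> e)"
      by (elim exE conjE) (rule that)
    define N where "N = (\<Sum>w\<in>W. norm w)"
    have N: "N \<ge> 0" "\<And>w. w \<in> W \<Longrightarrow> norm w \<le> N" using W by (auto simp: N_def sum_nonneg intro: member_le_sum)
    define e' where "e' = \<theta> / (3 * (N + 1))"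
    have e': "e' > 0" using \<theta> N by (simp add: e'_def)
    from D2[OF e'] obtain d where d: "d > 0" and dd: "\<forall>x f X g. evolves t\<^sub>0 x f X g \<longrightarrow> (\<forall>t\<in>{t\<^sub>0..T}. norm (x t)
        \<le> R) \<longrightarrow> (AE t in lebesgue_on {t\<^sub>0..T}. norm (f t) \<le> C)
       \<longrightarrow> (\<forall>s t v. t\<^sub>0 \<le> s \<longrightarrow> s \<le> t \<longrightarrow> t \<le> T \<longrightarrow> t - s < d \<longrightarrow> \<bar>(x t - x s) \<bullet> blinfun_apply j v\<bar> \<le> e' * norm v)"
      by (elim exE conjE) (rule that)
    have osc: "\<bar>(x t - x s) \<bullet> blinfun_apply j w\<bar> \<le> \<theta> / 3" if h: "x \<in> ?K" "w \<in> W" "t\<^sub>0 \<le> s" "s \<le> t" "t \<le> T"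
        "t - s < d" for x w s t
    proof -
      obtain f X g where ev: "evolves t\<^sub>0 x f X g" and f: "AE t in lebesgue_on {t\<^sub>0..T}. norm (f t) \<le> C"
          using data[OF h(1)] by blast
      have "\<forall>t\<in>{t\<^sub>0..T}. norm (x t) \<le> R" using R' h(1) by blast
      then have "\<bar>(x t - x s) \<bullet> blinfun_apply j w\<bar> \<le> e' * norm w"
        using dd[rule_format, OF ev _ f, of s t w] h by blast
      also have "\<dots> \<le> e' * (N + 1)" using N(2)[OF h(2)] e' by (intro mult_left_mono) auto
      also have "\<dots> = \<theta> / 3" using N by (simp add: e'_def divide_simps)
      finally show ?thesis .
    qed
    \<comment> \<open>A finite grid of mesh \<open>d/2\<close> in \<open>[t\<^sub>0,T]\<close>.\<close>
    define n where "n = nat \<lceil>(T - t\<^sub>0) / d\<rceil> + 1"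
    define \<tau> where "\<tau> i = t\<^sub>0 + real i * (d / 2)" for i :: nat
    define I where "I = {i. i \<le> 2 * n \<and> \<tau> i \<le> T}"
    have fI: "finite I" by (simp add: I_def)
    have grid: "\<exists>i\<in>I. \<tau> i \<le> t \<and> t - \<tau> i < d" if t: "t \<in> {t\<^sub>0..T}" for t
    proof -
      define i where "i = nat \<lfloor>(t - t\<^sub>0) / (d / 2)\<rfloor>"
      have nn: "0 \<le> (t - t\<^sub>0) / (d / 2)" using t d by simp
      have i: "real i \<le> (t - t\<^sub>0) / (d / 2)" "(t - t\<^sub>0) / (d / 2) < real i + 1" 
        using nn unfolding i_def by linarith+
      have 1: "\<tau> i \<le> t" using i(1) d by (simp add: \<tau>_def field_simps)
      have 2: "t - \<tau> i < d" using i(2) d by (simp add: \<tau>_def field_simps)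
      have "(T - t\<^sub>0) / d \<le> real n" unfolding n_def by linarith
      moreover have "(t - t\<^sub>0) / (d / 2) \<le> 2 * ((T - t\<^sub>0) / d)" using t d by (simp add: field_simps)
      ultimately have "real i \<le> 2 * real n" using i(1) by linarith
      then have "i \<le> 2 * n" by linarith
      then have "i \<in> I" using 1 t by (simp add: I_def)
      then show ?thesis using 1 2 by blast
    qed
    define B where "B = R * (norm j * N)"
    define \<Theta> where "\<Theta> x iw = x (\<tau> (fst iw)) \<bullet> blinfun_apply j (snd iw)" for x :: "real \<Rightarrow> 'h" and iw
    have bd: "\<bar>\<Theta> x iw\<bar> \<le> B" if x: "x \<in> ?K" and iw: "iw \<in> I \<times> W" for x iw
    proof -
      obtain i w where iw': "iw = (i, w)" "i \<in> I" "w \<in> W" using iw by auto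
      have "\<tau> i \<in> {t\<^sub>0..T}" using iw' d by (auto simp: I_def \<tau>_def)
      have "\<bar>x (\<tau> i) \<bullet> blinfun_apply j w\<bar> \<le> norm (x (\<tau> i)) * norm (blinfun_apply j w)"
          by (rule Cauchy_Schwarz_ineq2)
      also have "\<dots> \<le> R * (norm j * norm w)" using R'[OF x \<open>\<tau> i \<in> _\<close>] R(1) norm_blinfun by (intro mult_mono) auto
      also have "\<dots> \<le> B" unfolding B_def using R(1) N(2)[OF iw'(3)] by (intro mult_left_mono) auto
      finally show ?thesis using iw' by (simp add: \<Theta>_def)
    qed
    have \<theta>3: "\<theta> / 3 > 0" using \<theta> by simp
    have fIW: "finite (I \<times> W)" using fI W by simp
    obtain F where F: "finite F" "F \<subseteq> ?K" and Fx: "\<And>x. x \<in> ?K \<Longrightarrow> \<exists>y\<in>F. \<forall>iw\<in>I \<times> W. \<bar>\<Theta> x iw - \<Theta> y iw\<bar> \<le> \<theta> / 3"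
      by (rule finite_partition_by_bounded_functions[of "I \<times> W" ?K \<Theta>, OF fIW bd \<theta>3]) (assumption, assumption, rule
          that)
    show "\<exists>F. finite F \<and> F \<subseteq> ?K \<and> (\<forall>x\<in>?K. \<exists>y\<in>F. \<forall>t\<in>{0..T}. norm (x t - y t) \<le> e)"
    proof (intro exI[of _ F] conjI F ballI)
      fix x assume x: "x \<in> ?K"
      then obtain y where y: "y \<in> F" and yc': "\<forall>iw\<in>I \<times> W. \<bar>\<Theta> x iw - \<Theta> y iw\<bar> \<le> \<theta> / 3"
        using Fx by blast
      have yc: "\<bar>x (\<tau> i) \<bullet> blinfun_apply j w - y (\<tau> i) \<bullet> blinfun_apply j w\<bar> \<le> \<theta> / 3" if "i \<in> I" "w \<in> W" for i w
        using yc'[rule_format, of "(i, w)"] that by (simp add: \<Theta>_def)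
      have yK: "y \<in> ?K" using y F by blast
      have "\<bar>(x t - y t) \<bullet> blinfun_apply j w\<bar> \<le> \<theta>" if w: "w \<in> W" and t: "t \<in> {t\<^sub>0..T}" for w t
      proof -
        obtain i where i: "i \<in> I" "\<tau> i \<le> t" "t - \<tau> i < d" using grid[OF t] by blast
        have ti: "t\<^sub>0 \<le> \<tau> i" using d by (simp add: \<tau>_def)
        have "\<bar>(x t - x (\<tau> i)) \<bullet> blinfun_apply j w\<bar> \<le> \<theta> / 3" "\<bar>(y t - y (\<tau> i)) \<bullet> blinfun_apply j w\<bar> \<le> \<theta> / 3"
          using osc x yK w ti i t by auto
        moreover have "(x t - y t) \<bullet> blinfun_apply j w = (x t - x (\<tau> i)) \<bullet> blinfun_apply j w
           + (x (\<tau> i) \<bullet> blinfun_apply j w - y (\<tau> i) \<bullet> blinfun_apply j w) - (y t - y (\<tau> i)) \<bullet> blinfun_apply j w"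
          by (simp add: inner_diff_left)
        ultimately show ?thesis using yc[OF i(1) w] by linarith
      qed
      then show "\<exists>y\<in>F. \<forall>t\<in>{0..T}. norm (x t - y t) \<le> e" using cl' x yK y by blast
    qed
  qed
qed

end

section \<open>Doubling of variables\<close>

lemma d_inf_eq_on_past:
  assumes "T > 0" "0 \<le> t" "t \<le> T" "\<And>s. 0 \<le> s \<Longrightarrow> s \<le> t \<Longrightarrow> x s = y s"
  shows "d_inf T (t, x) (t, y) \<le> 0"
proof -
  have "d_inf T (t, x) (t, y) \<le> \<bar>t - t\<bar> + 0"
    using assms by (intro d_inf_le) auto
  then show ?thesis by simp
qed

lemma USC_nonanticipating:
  assumes u: "USC_wrt (d_inf T) ({0..T} \<times> S) (\<lambda>(t, x). u t x)"
    and t: "T > 0" "0 \<le> t" "t \<le> T" and xy: "x \<in> S" "y \<in> S" "\<And>s. 0 \<le> s \<Longrightarrow> s \<le> t \<Longrightarrow> x s = y s"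
  shows "u t x = u t y"
proof -
  have le: "u t y \<le> u t x" if xy: "x \<in> S" "y \<in> S" "\<And>s. 0 \<le> s \<Longrightarrow> s \<le> t \<Longrightarrow> x s = y s" for x y
  proof (rule field_le_epsilon)
    fix e :: real assume "e > 0"
    moreover have "(t, x) \<in> {0..T} \<times> S" "(t, y) \<in> {0..T} \<times> S" using t xy by auto
    ultimately obtain d where "d > 0" "d_inf T (t, x) (t, y) < d \<longrightarrow> u t y < u t x + e"
      using u unfolding USC_wrt_def by fastforce
    then show "u t y \<le> u t x + e" using d_inf_eq_on_past[OF t, of x y] xy(3) by simp
  qed
  show ?thesis using le[of x y] le[of y x] xy by fastforce
qed

lemma LSC_nonanticipating:
  assumes u: "LSC_wrt (d_inf T) ({0..T} \<times> S) (\<lambda>(t, x). u t x)"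
    and t: "T > 0" "0 \<le> t" "t \<le> T" and xy: "x \<in> S" "y \<in> S" "\<And>s. 0 \<le> s \<Longrightarrow> s \<le> t \<Longrightarrow> x s = y s"
  shows "u t x = u t y"
proof -
  have "USC_wrt (d_inf T) ({0..T} \<times> S) (\<lambda>(t, x). - u t x)"
    using u unfolding USC_wrt_def LSC_wrt_def by (force simp: split_beta algebra_simps)
  then have "- u t x = - u t y" by (rule USC_nonanticipating[OF _ t xy])
  then show ?thesis by simp
qed

lemma Hamiltonian_continuous_in_time:
  fixes F :: "real \<Rightarrow> (real \<Rightarrow> 'h::real_normed_vector) \<Rightarrow> 'h \<Rightarrow> real"
  assumes F: "continuous_wrt (d_inf_H T) ({0..T} \<times> C_paths T \<times> UNIV) (\<lambda>(t, x, z). F t x z)"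
    and T: "T > 0" and x: "x \<in> C_paths T"
  shows "continuous_on {0..T} (\<lambda>s. F s x z)"
  unfolding continuous_on_iff
proof (intro ballI allI impI)
  fix t and e :: real assume t: "t \<in> {0..T}" and e: "e > 0"
  have mem: "(t, x, z) \<in> {0..T} \<times> C_paths T \<times> UNIV" using t x by simp
  obtain d where d: "d > 0" and db: "\<forall>b\<in>{0..T} \<times> C_paths T \<times> UNIV. d_inf_H T (t, x, z) b < d \<longrightarrow>
        \<bar>(case b of (t, x, z) \<Rightarrow> F t x z) - (case (t, x, z) of (t, x, z) \<Rightarrow> F t x z)\<bar> < e"
    using bspec[OF F[unfolded continuous_wrt_def] mem] e by (auto simp only:)
  have "uniformly_continuous_on {0..T} x"
    using x by (intro compact_uniformly_continuous) (auto simp: C_paths_def)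
  moreover have "d / 2 > 0" using d by simp
  ultimately have "\<exists>d'>0. \<forall>r\<in>{0..T}. \<forall>s\<in>{0..T}. dist s r < d' \<longrightarrow> dist (x s) (x r) < d / 2"
    unfolding uniformly_continuous_on_def by blast
  then obtain d' where d': "d' > 0" and d'b: "\<forall>r\<in>{0..T}. \<forall>s\<in>{0..T}. dist s r < d' \<longrightarrow> dist (x s) (x r) < d / 2"
    by blast
  show "\<exists>d>0. \<forall>s\<in>{0..T}. dist s t < d \<longrightarrow> dist (F s x z) (F t x z) < e"
  proof (intro exI[of _ "min d' (d / 2)"] conjI ballI impI)
    show "min d' (d / 2) > 0" using d d' by simp
    fix s assume s: "s \<in> {0..T}" "dist s t < min d' (d / 2)"
    have ds: "\<bar>t - s\<bar> < d'" "\<bar>t - s\<bar> < d / 2" using s by (auto simp: dist_real_def abs_minus_commute)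
    have "d_inf T (t, x) (s, x) \<le> \<bar>t - s\<bar> + d / 2"
    proof (rule d_inf_le[OF T])
      fix r assume r: "r \<in> {0..T}"
      have m: "min r t \<in> {0..T}" "min r s \<in> {0..T}" using r s t by auto
      have "dist (min r t) (min r s) < d'" using ds d' by (auto simp: dist_real_def min_def)
      then have "dist (x (min r t)) (x (min r s)) < d / 2" using d'b m by blast
      then show "norm (x (min r t) - x (min r s)) \<le> d / 2" by (simp add: dist_norm)
    qed
    then have "d_inf_H T (t, x, z) (s, x, z) < d" using ds by (simp add: d_inf_H_def)
    then show "dist (F s x z) (F t x z) < e" using db[rule_format, of "(s, x, z)"] s x by (simp add: dist_real_def)
  qed
qed

text \<open>
  For equicontinuous paths that agree up to \<open>t\<^sub>0\<close>, a small integral of \<open>|x-y|\<^sup>2\<close> over \<open>[t\<^sub>0,t]\<close>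
  forces \<open>x\<close> and \<open>y\<close> to be uniformly close on \<open>[0,t]\<close>.
\<close>
lemma small_L2_imp_small_sup:
  fixes K :: "(real \<Rightarrow> 'h::real_normed_vector) set"
  assumes K: "totally_bounded_paths T K" and t0: "0 \<le> t\<^sub>0" and e: "e > 0"
    and init: "\<And>x y s. x \<in> K \<Longrightarrow> y \<in> K \<Longrightarrow> 0 \<le> s \<Longrightarrow> s \<le> t\<^sub>0 \<Longrightarrow> x s = y s"
  obtains \<omega> where "\<omega> > 0" "\<And>x y t s. \<lbrakk>x \<in> K; y \<in> K; t\<^sub>0 \<le> t; t \<le> T; integral {t\<^sub>0..t} (\<lambda>r. (norm (x r - y r))\<^sup>2)
      \<le> \<omega>; 0 \<le> s; s \<le> t\<rbrakk>
      \<Longrightarrow> norm (x s - y s) \<le> e"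
proof -
  have e4: "e / 4 > 0" using e by simp
  obtain d where d: "d > 0" and dK: "\<And>x s t. \<lbrakk>x \<in> K; s \<in> {0..T}; t \<in> {0..T}; \<bar>s - t\<bar> < d\<rbrakk> \<Longrightarrow>
      norm (x s - x t) < e / 4"
    by (rule totally_bounded_paths_equicontinuous[OF K e4]) (rule that)
  show thesis
  proof (rule that[of "d * e\<^sup>2 / 16"])
    show "d * e\<^sup>2 / 16 > 0" using d e by simp
    fix x y t s assume x: "x \<in> K" and y: "y \<in> K" and t: "t\<^sub>0 \<le> t" "t \<le> T" and s: "0 \<le> s" "s \<le> t"
      and int: "integral {t\<^sub>0..t} (\<lambda>r. (norm (x r - y r))\<^sup>2) \<le> d * e\<^sup>2 / 16"
    show "norm (x s - y s) \<le> e"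
    proof (rule ccontr)
      assume "\<not> norm (x s - y s) \<le> e"
      then have big: "norm (x s - y s) > e" by simp
      have low: "norm (x r - y r) \<ge> e / 2" if "r \<in> {0..T}" "\<bar>s - r\<bar> < d" for r
      proof -
        have "norm (x s - x r) < e / 4" "norm (y s - y r) < e / 4" using dK[OF x] dK[OF y] s t that by auto
        moreover have "norm (x s - y s) \<le> norm (x s - x r) + norm (x r - y r) + norm (y s - y r)"
        proof -
          have "x s - y s = (x s - x r) + (x r - y r) - (y s - y r)" by simp
          then show ?thesis by (smt (verit) norm_triangle_ineq norm_triangle_ineq4)
        qed
        ultimately show ?thesis using big by linarith
      qed
      have st: "s \<ge> t\<^sub>0 + d"
      proof (rule ccontr)
        assume h: "\<not> s \<ge> t\<^sub>0 + d"
        show False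
        proof (cases "s \<le> t\<^sub>0")
          case True
          then show False using init[OF x y, of s] s big e by simp
        next
          case False
          then have "norm (x t\<^sub>0 - y t\<^sub>0) \<ge> e / 2" using h s t t0 by (intro low) auto
          then show False using init[OF x y, of t\<^sub>0] t0 e by simp
        qed
      qed
      have cont: "continuous_on {t\<^sub>0..t} (\<lambda>r. (norm (x r - y r))\<^sup>2)"
      proof -
        have "continuous_on {0..T} x" "continuous_on {0..T} y" using x y K
            by (auto simp: totally_bounded_paths_def C_paths_def)
        then have "continuous_on {0..T} (\<lambda>r. (norm (x r - y r))\<^sup>2)" by (intro continuous_intros)
        then show ?thesis by (rule continuous_on_subset) (use t t0 in auto)
      qed
      have i: "(\<lambda>r. (norm (x r - y r))\<^sup>2) integrable_on {t\<^sub>0..t}" using cont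
          by (rule integrable_continuous_interval)
      have sub: "{s - d / 2..s} \<subseteq> {t\<^sub>0..t}" using st s d by auto
      have "d / 2 * (e\<^sup>2 / 4) = integral {s - d / 2..s} (\<lambda>r. e\<^sup>2 / 4)" using d by simp
      also have "\<dots> \<le> integral {s - d / 2..s} (\<lambda>r. (norm (x r - y r))\<^sup>2)"
      proof (rule integral_le)
        fix r assume r: "r \<in> {s - d / 2..s}"
        have "e / 2 \<le> norm (x r - y r)" using r sub t t0 d by (intro low) auto
        then have "(e / 2)\<^sup>2 \<le> (norm (x r - y r))\<^sup>2" using e by (intro power_mono) auto
        then show "e\<^sup>2 / 4 \<le> (norm (x r - y r))\<^sup>2" by (simp add: power_divide)
      qed (use integrable_on_subinterval[OF i sub] in auto)
      also have "\<dots> \<le> integral {t\<^sub>0..t} (\<lambda>r. (norm (x r - y r))\<^sup>2)"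
        using i integrable_on_subinterval[OF i sub] sub by (intro integral_subset_le) auto
      finally have "d * e\<^sup>2 / 8 \<le> d * e\<^sup>2 / 16" using int by simp
      moreover have "d * e\<^sup>2 > 0" using d e by simp
      ultimately show False by simp
    qed
  qed
qed

lemma decreasing_bounded_small_step:
  fixes M :: "nat \<Rightarrow> real"
  assumes "\<And>n. B \<le> M n" "\<eta> > 0"
  obtains n where "M n - M (Suc n) < \<eta>"
proof (rule ccontr)
  assume "\<not> thesis"
  then have step: "M (Suc n) \<le> M n - \<eta>" for n using that[of n] by argo
  have "M n \<le> M 0 - real n * \<eta>" for n
  proof (induction n)
    case (Suc n)
    then show ?case using step[of n] by (simp add: algebra_simps)
  qed simp
  moreover obtain n where "(M 0 - B) / \<eta> < real n" using reals_Archimedean2 by blast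
  ultimately show False using assms(1)[of n] assms(2) by (smt (verit) divide_less_eq mult.commute)
qed

text \<open>
  The data of the comparison theorem with a common growth constant \<open>L\<close> for both semisolutions, and
  a point \<open>(t\<^sub>0,x\<^sub>0)\<close> with \<open>t\<^sub>0 < T\<close>.
\<close>
locale comparison = evolution_problem T p q j A
  for T p q :: real
    and j :: "'v::{banach,second_countable_topology} \<Rightarrow>\<^sub>L 'h::{real_inner,banach}"
    and A :: "real \<Rightarrow> 'v \<Rightarrow> ('v \<Rightarrow>\<^sub>L real)" +
  fixes F :: "real \<Rightarrow> (real \<Rightarrow> 'h) \<Rightarrow> 'h \<Rightarrow> real" and h :: "(real \<Rightarrow> 'h) \<Rightarrow> real"
    and u v :: "real \<Rightarrow> (real \<Rightarrow> 'h) \<Rightarrow> real" and \<Omega>' :: "(real \<Rightarrow> 'h) set"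
    and L t\<^sub>0 :: real and x\<^sub>0 :: "real \<Rightarrow> 'h"
  assumes h: "continuous_wrt (d_sup T) (C_paths T) h"
    and F: "admissible_Hamiltonian T p q j A F"
    and \<Omega>': "\<Omega>' \<subseteq> C_paths T" and L: "L \<ge> 0"
    and u: "minimax_L_subsolution T p q j A F h \<Omega>' L u"
    and v: "minimax_L_supersolution T p q j A F h \<Omega>' L v"
    and t0: "0 \<le> t\<^sub>0" "t\<^sub>0 < T" and x0: "x\<^sub>0 \<in> \<Omega>'"
begin

abbreviation K :: "(real \<Rightarrow> 'h) set" where
  "K \<equiv> trajectories T p q j A L t\<^sub>0 x\<^sub>0"

lemma x0_path: "x\<^sub>0 \<in> C_paths T"
  using x0 \<Omega>' by blast

lemma K_totally_bounded: "totally_bounded_paths T K"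
  using L t0 x0_path by (rule trajectories_totally_bounded)

lemma F_continuous: "continuous_wrt (d_inf_H T) ({0..T} \<times> C_paths T \<times> UNIV) (\<lambda>(t, x, z). F t x z)"
  using F by (simp add: admissible_Hamiltonian_def)

lemma F_integrable:
  assumes "x \<in> C_paths T" "0 \<le> s" "t \<le> T"
  shows "(\<lambda>r. F r x z) absolutely_integrable_on {s..t}"
proof -
  have "continuous_on {s..t} (\<lambda>r. F r x z)"
    by (rule continuous_on_subset[OF Hamiltonian_continuous_in_time[OF F_continuous T assms(1)]]) (use assms in
        auto)
  then show ?thesis by (rule absolutely_integrable_continuous_real)
qed

lemma step_integral:
  assumes "evolves t\<^sub>1 x f X g" "x \<in> C_paths T" "0 \<le> t\<^sub>1" "t\<^sub>1 \<le> t" "t \<le> T"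
  shows "(\<lambda>s. f s \<bullet> z) absolutely_integrable_on {t\<^sub>1..t}"
    "(LINT s:{t\<^sub>1..t}|lebesgue. (- f s) \<bullet> z + F s x z) = integral {t\<^sub>1..t} (\<lambda>s. F s x z) - integral {t\<^sub>1..t} (\<lambda>s. f
        s \<bullet> z)"
proof -
  show 1: "(\<lambda>s. f s \<bullet> z) absolutely_integrable_on {t\<^sub>1..t}"
    using forcing_measurable[OF assms(1) order_refl assms(5)] by (intro inner_absolutely_integrable) auto
  have 2: "(\<lambda>r. F r x z) absolutely_integrable_on {t\<^sub>1..t}" using assms by (intro F_integrable) auto
  have "(\<lambda>s. F s x z - f s \<bullet> z) absolutely_integrable_on {t\<^sub>1..t}" using 2 1 by (rule set_integral_diff(1))
  then have "(LINT s:{t\<^sub>1..t}|lebesgue. F s x z - f s \<bullet> z) = integral {t\<^sub>1..t} (\<lambda>s. F s x z - f s \<bullet> z)"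
    by (rule set_lebesgue_integral_eq_integral)
  also have "\<dots> = integral {t\<^sub>1..t} (\<lambda>s. F s x z) - integral {t\<^sub>1..t} (\<lambda>s. f s \<bullet> z)"
    using 1 2 by (intro Henstock_Kurzweil_Integration.integral_diff absolutely_integrable_imp_HK)
  finally show "(LINT s:{t\<^sub>1..t}|lebesgue. (- f s) \<bullet> z + F s x z) = integral {t\<^sub>1..t} (\<lambda>s. F s x z)
      - integral {t\<^sub>1..t} (\<lambda>s. f s \<bullet> z)"
    by simp
qed

text \<open>
  A trajectory issuing from a path of \<open>K\<close> at time \<open>t\<^sub>1\<close> is again in \<open>K\<close>. This is what allows a single
  modulus of continuity of the Hamiltonian to be used throughout.
\<close>
lemma trajectory_step:
  assumes t1: "t\<^sub>0 \<le> t\<^sub>1" "t\<^sub>1 < T" and x1: "x\<^sub>1 \<in> K"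
    and x: "x \<in> trajectories T p q j A L t\<^sub>1 x\<^sub>1" and f: "is_forcing T p q j A t\<^sub>1 x f"
  obtains X g where "x \<in> K" "\<And>s. 0 \<le> s \<Longrightarrow> s \<le> t\<^sub>1 \<Longrightarrow> x s = x\<^sub>1 s" "evolves t\<^sub>1 x f X g"
    "\<And>t z. t\<^sub>1 \<le> t \<Longrightarrow> t \<le> T \<Longrightarrow> (LINT s:{t\<^sub>1..t}|lebesgue. (- f s) \<bullet> z + F s x z)
       = integral {t\<^sub>1..t} (\<lambda>s. F s x z) - integral {t\<^sub>1..t} (\<lambda>s. f s \<bullet> z)"
proof -
  note xC = trajectories_C_paths[OF x]
  have t10: "0 \<le> t\<^sub>1" using t1 t0 by simp
  obtain X g where e: "evolves t\<^sub>1 x f X g" using f is_forcing_iff_evolves[OF xC t10 t1(2)] by blast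
  show thesis
    by (rule that[OF trajectories_concat[OF t0(1) t1 x1 x] trajectories_initial[OF x] e step_integral(2)[OF e xC
        t10]])
qed

lemma subsolution_step:
  assumes t1: "t\<^sub>0 \<le> t\<^sub>1" "t\<^sub>1 < T" and x1: "x\<^sub>1 \<in> K" "x\<^sub>1 \<in> \<Omega>'"
  obtains x f X g where "x \<in> K" "x \<in> \<Omega>'" "\<And>s. 0 \<le> s \<Longrightarrow> s \<le> t\<^sub>1 \<Longrightarrow> x s = x\<^sub>1 s" "evolves t\<^sub>1 x f X g"
    "x \<in> trajectories T p q j A L t\<^sub>1 x\<^sub>1"
    "\<And>t. t\<^sub>1 \<le> t \<Longrightarrow> t \<le> T \<Longrightarrow> u t\<^sub>1 x\<^sub>1 \<le> integral {t\<^sub>1..t} (\<lambda>s. F s x z) - integral {t\<^sub>1..t} (\<lambda>s. f s \<bullet> z) + u t x"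
proof -
  have "t\<^sub>1 \<in> {0..<T}" using t1 t0 by simp
  then obtain x f where x: "x \<in> trajectories T p q j A L t\<^sub>1 x\<^sub>1" "x \<in> \<Omega>'" and f: "is_forcing T p q j A t\<^sub>1 x f"
    and le: "\<forall>t\<in>{t\<^sub>1..T}. u t\<^sub>1 x\<^sub>1 \<le> (LINT s:{t\<^sub>1..t}|lebesgue. (- f s) \<bullet> z + F s x z) + u t x"
    using u x1(2) unfolding minimax_L_subsolution_def by blast
  obtain X g where st: "x \<in> K" "\<And>s. 0 \<le> s \<Longrightarrow> s \<le> t\<^sub>1 \<Longrightarrow> x s = x\<^sub>1 s" "evolves t\<^sub>1 x f X g"
    and I: "\<And>t z. t\<^sub>1 \<le> t \<Longrightarrow> t \<le> T \<Longrightarrow> (LINT s:{t\<^sub>1..t}|lebesgue. (- f s) \<bullet> z + F s x z)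
       = integral {t\<^sub>1..t} (\<lambda>s. F s x z) - integral {t\<^sub>1..t} (\<lambda>s. f s \<bullet> z)"
    by (rule trajectory_step[OF t1 x1(1) x(1) f]) (rule that)
  show thesis
    by (rule that[OF st(1) x(2) st(2,3) x(1)]) (use le I in auto)
qed

lemma supersolution_step:
  assumes t1: "t\<^sub>0 \<le> t\<^sub>1" "t\<^sub>1 < T" and x1: "x\<^sub>1 \<in> K" "x\<^sub>1 \<in> \<Omega>'"
  obtains x f X g where "x \<in> K" "x \<in> \<Omega>'" "\<And>s. 0 \<le> s \<Longrightarrow> s \<le> t\<^sub>1 \<Longrightarrow> x s = x\<^sub>1 s" "evolves t\<^sub>1 x f X g"
    "x \<in> trajectories T p q j A L t\<^sub>1 x\<^sub>1"
    "\<And>t. t\<^sub>1 \<le> t \<Longrightarrow> t \<le> T \<Longrightarrow> v t\<^sub>1 x\<^sub>1 \<ge> integral {t\<^sub>1..t} (\<lambda>s. F s x z) - integral {t\<^sub>1..t} (\<lambda>s. f s \<bullet> z) + v t x"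
proof -
  have "t\<^sub>1 \<in> {0..<T}" using t1 t0 by simp
  then obtain x f where x: "x \<in> trajectories T p q j A L t\<^sub>1 x\<^sub>1" "x \<in> \<Omega>'" and f: "is_forcing T p q j A t\<^sub>1 x f"
    and le: "\<forall>t\<in>{t\<^sub>1..T}. v t\<^sub>1 x\<^sub>1 \<ge> (LINT s:{t\<^sub>1..t}|lebesgue. (- f s) \<bullet> z + F s x z) + v t x"
    using v x1(2) unfolding minimax_L_supersolution_def by blast
  obtain X g where st: "x \<in> K" "\<And>s. 0 \<le> s \<Longrightarrow> s \<le> t\<^sub>1 \<Longrightarrow> x s = x\<^sub>1 s" "evolves t\<^sub>1 x f X g"
    and I: "\<And>t z. t\<^sub>1 \<le> t \<Longrightarrow> t \<le> T \<Longrightarrow> (LINT s:{t\<^sub>1..t}|lebesgue. (- f s) \<bullet> z + F s x z)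
       = integral {t\<^sub>1..t} (\<lambda>s. F s x z) - integral {t\<^sub>1..t} (\<lambda>s. f s \<bullet> z)"
    by (rule trajectory_step[OF t1 x1(1) x(1) f]) (rule that)
  show thesis
    by (rule that[OF st(1) x(2) st(2,3) x(1)]) (use le I in auto)
qed

text \<open>
  Semicontinuity does not bound the semisolutions on \<open>K \<inter> \<Omega>'\<close>, which need not be compact. The
  minimax inequality with \<open>z = 0\<close> up to the terminal time does.
\<close>
lemma semisolutions_bounded:
  obtains B where "B \<ge> 0" "\<And>t x. \<lbrakk>t\<^sub>0 \<le> t; t \<le> T; x \<in> K; x \<in> \<Omega>'\<rbrakk> \<Longrightarrow> u t x \<le> B"
    "\<And>t x. \<lbrakk>t\<^sub>0 \<le> t; t \<le> T; x \<in> K; x \<in> \<Omega>'\<rbrakk> \<Longrightarrow> v t x \<ge> - B"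
proof -
  obtain Bh where Bh: "\<forall>x\<in>K. \<bar>h x\<bar> \<le> Bh"
    using continuous_functional_on_totally_bounded(1)[OF K_totally_bounded T h] by blast
  obtain BF where BF: "\<forall>x\<in>K. \<forall>t\<in>{0..T}. \<bar>F t x 0\<bar> \<le> BF"
    using continuous_Hamiltonian_on_totally_bounded[OF K_totally_bounded T F_continuous] by blast
  define B where "B = \<bar>BF\<bar> * T + \<bar>Bh\<bar>"
  have B: "B \<ge> 0" using T by (simp add: B_def)
  have int: "\<bar>integral {t..T} (\<lambda>s. F s x 0)\<bar> \<le> \<bar>BF\<bar> * T" if "x \<in> K" "t\<^sub>0 \<le> t" "t \<le> T" for x t
  proof -
    have "norm (integral {t..T} (\<lambda>s. F s x 0)) \<le> integral {t..T} (\<lambda>s. \<bar>BF\<bar>)"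
    proof (rule Henstock_Kurzweil_Integration.integral_norm_bound_integral)
      show "(\<lambda>s. F s x 0) integrable_on {t..T}"
        using F_integrable[OF trajectories_C_paths[OF that(1)], of t T] t0 that
            by (intro absolutely_integrable_imp_HK) auto
      fix s assume "s \<in> {t..T}"
      then have "\<bar>F s x 0\<bar> \<le> BF" using BF that t0 by auto
      then show "norm (F s x 0) \<le> \<bar>BF\<bar>" by simp
    qed auto
    also have "\<dots> = \<bar>BF\<bar> * (T - t)" using that by simp
    also have "\<dots> \<le> \<bar>BF\<bar> * T" using that t0 by (intro mult_left_mono) auto
    finally show ?thesis by simp
  qed
  show thesis
  proof (rule that[OF B])
    fix t x assume t: "t\<^sub>0 \<le> t" "t \<le> T" and x: "x \<in> K" "x \<in> \<Omega>'"
    show "u t x \<le> B"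
    proof (cases "t = T")
      case True
      have "u T x \<le> h x" using u x unfolding minimax_L_subsolution_def by blast
      also have "h x \<le> B" using Bh x T unfolding B_def by (smt (verit) mult_nonneg_nonneg)
      finally show ?thesis using True by simp
    next
      case False
      then have tT: "t < T" using t by simp
      obtain y f X g where y: "y \<in> K" "y \<in> \<Omega>'" and "\<And>s. 0 \<le> s \<Longrightarrow> s \<le> t \<Longrightarrow> y s = x s"
        and "evolves t y f X g" "y \<in> trajectories T p q j A L t x"
        and le: "\<And>s. t \<le> s \<Longrightarrow> s \<le> T \<Longrightarrow> u t x \<le> integral {t..s} (\<lambda>s. F s y 0) - integral {t..s} (\<lambda>s. f s \<bullet> 0) + u s y"
        by (rule subsolution_step[OF t(1) tT x, where z = 0]) (rule that)
      have "u T y \<le> h y" using u y unfolding minimax_L_subsolution_def by blast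
      moreover have "\<bar>h y\<bar> \<le> \<bar>Bh\<bar>" using Bh y(1) by fastforce
      ultimately show ?thesis using le[of T] int[OF y(1) t] t unfolding B_def by simp
    qed
    show "v t x \<ge> - B"
    proof (cases "t = T")
      case True
      have "v T x \<ge> h x" using v x unfolding minimax_L_supersolution_def by blast
      moreover have "h x \<ge> - B" using Bh x T unfolding B_def by (smt (verit) mult_nonneg_nonneg)
      ultimately show ?thesis using True by simp
    next
      case False
      then have tT: "t < T" using t by simp
      obtain y f X g where y: "y \<in> K" "y \<in> \<Omega>'" and "\<And>s. 0 \<le> s \<Longrightarrow> s \<le> t \<Longrightarrow> y s = x s"
        and "evolves t y f X g" "y \<in> trajectories T p q j A L t x"
        and le: "\<And>s. t \<le> s \<Longrightarrow> s \<le> T \<Longrightarrow> v t x \<ge> integral {t..s} (\<lambda>s. F s y 0) - integral {t..s} (\<lambda>s. f s \<bullet> 0) + v s y"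
        by (rule supersolution_step[OF t(1) tT x, where z = 0]) (rule that)
      have "v T y \<ge> h y" using v y unfolding minimax_L_supersolution_def by blast
      moreover have "\<bar>h y\<bar> \<le> \<bar>Bh\<bar>" using Bh y(1) by fastforce
      ultimately show ?thesis using le[of T] int[OF y(1) t] t unfolding B_def by simp
    qed
  qed
qed

text \<open>
  The penalty on the distance of two paths. The integral term is there to control their distance on
  the whole past, not only at time \<open>t\<close>.
\<close>
definition penalty :: "real \<Rightarrow> real \<Rightarrow> (real \<Rightarrow> 'h) \<Rightarrow> (real \<Rightarrow> 'h) \<Rightarrow> real" where
  "penalty \<epsilon> t x y = ((norm (x t - y t))\<^sup>2 + integral {t\<^sub>0..t} (\<lambda>s. (norm (x s - y s))\<^sup>2)) / (2 * \<epsilon>)"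

text \<open>
  The doubled and penalised difference of the semisolutions.
\<close>
definition \<Psi> :: "real \<Rightarrow> real \<Rightarrow> (real \<Rightarrow> 'h) \<Rightarrow> (real \<Rightarrow> 'h) \<Rightarrow> real" where
  "\<Psi> \<epsilon> t x y = u t x - v t y - penalty \<epsilon> t x y"

lemma norm_diff_continuous:
  assumes "x \<in> K" "y \<in> K" "0 \<le> s" "t \<le> T"
  shows "continuous_on {s..t} (\<lambda>r. (norm (x r - y r))\<^sup>2)"
  using C_paths_continuous[OF trajectories_C_paths[OF assms(1)] assms(3,4)]
    C_paths_continuous[OF trajectories_C_paths[OF assms(2)] assms(3,4)]
  by (intro continuous_intros)

text \<open>
  Moving both semisolutions forward from \<open>(t\<^sub>1,x\<^sub>1,y\<^sub>1)\<close> with the gradient of the penalty frozen at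
  \<open>t\<^sub>1\<close>, the penalised difference loses at most \<open>\<beta>\<close> per unit of time.
\<close>
lemma doubling_step:
  assumes t1: "t\<^sub>0 \<le> t\<^sub>1" "t\<^sub>1 \<le> T" and x1: "x\<^sub>1 \<in> K" "x\<^sub>1 \<in> \<Omega>'" and y1: "y\<^sub>1 \<in> K" "y\<^sub>1 \<in> \<Omega>'"
    and \<epsilon>: "\<epsilon> > 0" and C: "C \<ge> 0"
    and R: "\<And>x t. x \<in> K \<Longrightarrow> t \<in> {0..T} \<Longrightarrow> norm (x t) \<le> R" "L * (1 + R) \<le> C"
    and lip: "\<And>s x z z'. x \<in> K \<Longrightarrow> s \<in> {0..T} \<Longrightarrow> \<bar>F s x z - F s x z'\<bar> \<le> C * norm (z - z')"
    and osc: "\<And>x s. x \<in> K \<Longrightarrow> t\<^sub>1 \<le> s \<Longrightarrow> s \<le> t\<^sub>2 \<Longrightarrow> norm (x s - x t\<^sub>1) \<le> e"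
    and t2: "t\<^sub>2 \<le> T"
    and small: "8 * C * e / \<epsilon> \<le> \<beta> / 2"
    and modulus: "\<And>x y s. \<lbrakk>x \<in> K; y \<in> K; \<And>r. 0 \<le> r \<Longrightarrow> r \<le> t\<^sub>1 \<Longrightarrow> x r = x\<^sub>1 r; \<And>r. 0 \<le> r \<Longrightarrow> r \<le> t\<^sub>1 \<Longrightarrow> y r = y\<^sub>1 r;
        t\<^sub>1 \<le> s; s \<le> t\<^sub>2\<rbrakk> \<Longrightarrow>
      F s x ((1 / \<epsilon>) *\<^sub>R (x s - y s)) - F s y ((1 / \<epsilon>) *\<^sub>R (x s - y s)) + (norm (x s - y s))\<^sup>2 / (2 * \<epsilon>) \<le> \<beta> / 2"
  obtains x y where "x \<in> K" "x \<in> \<Omega>'" "y \<in> K" "y \<in> \<Omega>'" "\<And>r. 0 \<le> r \<Longrightarrow> r \<le> t\<^sub>1 \<Longrightarrow> x r = x\<^sub>1 r"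
    "\<And>r. 0 \<le> r \<Longrightarrow> r \<le> t\<^sub>1 \<Longrightarrow> y r = y\<^sub>1 r"
    "\<And>t. t\<^sub>1 \<le> t \<Longrightarrow> t \<le> t\<^sub>2 \<Longrightarrow> \<Psi> \<epsilon> t\<^sub>1 x\<^sub>1 y\<^sub>1 \<le> \<Psi> \<epsilon> t x y + \<beta> * (t - t\<^sub>1)"
proof (cases "t\<^sub>1 < T")
  case False
  then have "t\<^sub>1 = T" using t1 by simp
  show thesis
  proof (rule that[OF x1 y1])
    fix t assume "t\<^sub>1 \<le> t" "t \<le> t\<^sub>2"
    then have "t = t\<^sub>1" using t2 \<open>t\<^sub>1 = T\<close> by simp
    then show "\<Psi> \<epsilon> t\<^sub>1 x\<^sub>1 y\<^sub>1 \<le> \<Psi> \<epsilon> t x\<^sub>1 y\<^sub>1 + \<beta> * (t - t\<^sub>1)" by simp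
  qed auto
next
  case tT: True
  define z where "z = (1 / \<epsilon>) *\<^sub>R (x\<^sub>1 t\<^sub>1 - y\<^sub>1 t\<^sub>1)"
  obtain x f X g where x: "x \<in> K" "x \<in> \<Omega>'" and xx: "\<And>s. 0 \<le> s \<Longrightarrow> s \<le> t\<^sub>1 \<Longrightarrow> x s = x\<^sub>1 s" and ex: "evolves t\<^sub>1 x f X g"
    and xt: "x \<in> trajectories T p q j A L t\<^sub>1 x\<^sub>1"
    and ux: "\<And>t. t\<^sub>1 \<le> t \<Longrightarrow> t \<le> T \<Longrightarrow> u t\<^sub>1 x\<^sub>1 \<le> integral {t\<^sub>1..t} (\<lambda>s. F s x z) - integral {t\<^sub>1..t} (\<lambda>s. f s \<bullet> z)
        + u t x"
    by (rule subsolution_step[OF t1(1) tT x1, where z = z]) (rule that)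
  obtain y k Y m where y: "y \<in> K" "y \<in> \<Omega>'" and yy: "\<And>s. 0 \<le> s \<Longrightarrow> s \<le> t\<^sub>1 \<Longrightarrow> y s = y\<^sub>1 s" and ey: "evolves t\<^sub>1 y k Y m"
    and yt: "y \<in> trajectories T p q j A L t\<^sub>1 y\<^sub>1"
    and vy: "\<And>t. t\<^sub>1 \<le> t \<Longrightarrow> t \<le> T \<Longrightarrow> v t\<^sub>1 y\<^sub>1 \<ge> integral {t\<^sub>1..t} (\<lambda>s. F s y z) - integral {t\<^sub>1..t} (\<lambda>s. k s \<bullet> z)
        + v t y"
    by (rule supersolution_step[OF t1(1) tT y1, where z = z]) (rule that)
  have t10: "0 \<le> t\<^sub>1" using t1 t0 by simp
  have fC: "AE s in lebesgue_on {t\<^sub>1..T}. norm (f s) \<le> C"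
  proof -
    have "AE s in lebesgue_on {t\<^sub>1..T}. norm (f s) \<le> L * (1 + R)"
      by (rule forcing_bounded[OF L t10 tT xt _ ex]) (rule R(1)[OF x(1)])
    then show ?thesis by eventually_elim (use R(2) in linarith)
  qed
  have kC: "AE s in lebesgue_on {t\<^sub>1..T}. norm (k s) \<le> C"
  proof -
    have "AE s in lebesgue_on {t\<^sub>1..T}. norm (k s) \<le> L * (1 + R)"
      by (rule forcing_bounded[OF L t10 tT yt _ ey]) (rule R(1)[OF y(1)])
    then show ?thesis by eventually_elim (use R(2) in linarith)
  qed
  show thesis
  proof (rule that[OF x y xx yy])
    fix t assume t: "t\<^sub>1 \<le> t" "t \<le> t\<^sub>2"
    then have tT': "t \<le> T" using t2 by simp
    define d where "d s = x s - y s" for s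
    have pen1: "penalty \<epsilon> t\<^sub>1 x\<^sub>1 y\<^sub>1 = penalty \<epsilon> t\<^sub>1 x y"
    proof -
      have "integral {t\<^sub>0..t\<^sub>1} (\<lambda>s. (norm (x\<^sub>1 s - y\<^sub>1 s))\<^sup>2) = integral {t\<^sub>0..t\<^sub>1} (\<lambda>s. (norm (x s - y s))\<^sup>2)"
        using xx yy t0 by (intro Henstock_Kurzweil_Integration.integral_cong) auto
      then show ?thesis using xx[of t\<^sub>1] yy[of t\<^sub>1] t10 by (simp add: penalty_def)
    qed
    have int2: "(\<lambda>s. (norm (d s))\<^sup>2) absolutely_integrable_on {t\<^sub>1..t}"
      unfolding d_def using x y t10 tT' by (intro absolutely_integrable_continuous_real norm_diff_continuous) auto
    have comb: "integral {t\<^sub>0..t\<^sub>1} (\<lambda>s. (norm (d s))\<^sup>2) + integral {t\<^sub>1..t} (\<lambda>s. (norm (d s))\<^sup>2)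
        = integral {t\<^sub>0..t} (\<lambda>s. (norm (d s))\<^sup>2)"
      unfolding d_def using x y t0 t1 t tT'
      by (intro Henstock_Kurzweil_Integration.integral_combine integrable_continuous_interval norm_diff_continuous)
          auto
    have en_int: "(\<lambda>r. (f r - k r) \<bullet> d r) absolutely_integrable_on {t\<^sub>1..t}"
      and en: "(norm (d t))\<^sup>2 / 2 - (norm (d t\<^sub>1))\<^sup>2 / 2 \<le> integral {t\<^sub>1..t} (\<lambda>r. (f r - k r) \<bullet> d r)"
      using energy_difference[OF ex ey order_refl t(1) tT' t10] by (simp_all add: d_def)
    have fz: "(\<lambda>s. f s \<bullet> z) absolutely_integrable_on {t\<^sub>1..t}" "(\<lambda>s. k s \<bullet> z) absolutely_integrable_on {t\<^sub>1..t}"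
      using step_integral(1)[OF ex trajectories_C_paths[OF x(1)] t10 t(1) tT'] step_integral(1)[OF ey
          trajectories_C_paths[OF y(1)] t10 t(1) tT'] .
    have Fi: "(\<lambda>s. F s x z) absolutely_integrable_on {t\<^sub>1..t}" "(\<lambda>s. F s y z) absolutely_integrable_on {t\<^sub>1..t}"
      using F_integrable[OF trajectories_C_paths[OF x(1)] t10 tT'] F_integrable[OF trajectories_C_paths[OF y(1)] t10
          tT'] .
    let ?G = "\<lambda>s. ((F s x z - F s y z) - (f s \<bullet> z - k s \<bullet> z)) + (1 / \<epsilon> * ((f s - k s) \<bullet> d s) + 1 / (2 * \<epsilon>) * (norm
        (d s))\<^sup>2)"
    have Gi: "?G absolutely_integrable_on {t\<^sub>1..t}"
      by (intro set_integral_add(1) set_integral_diff(1) set_integrable_mult_right Fi fz en_int int2)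
    have "integral {t\<^sub>1..t} ?G \<le> integral {t\<^sub>1..t} (\<lambda>s. \<beta>)"
    proof (rule integral_mono_AE_lebesgue_on[OF Gi])
      show "(\<lambda>s. \<beta>) absolutely_integrable_on {t\<^sub>1..t}" by (rule absolutely_integrable_continuous_real) auto
      have b: "AE s in lebesgue_on {t\<^sub>1..t}. norm (f s) \<le> C" "AE s in lebesgue_on {t\<^sub>1..t}. norm (k s) \<le> C"
        by (rule AE_lebesgue_on_subset[OF fC] AE_lebesgue_on_subset[OF kC]; use tT' in auto)+
      show "AE s in lebesgue_on {t\<^sub>1..t}. ?G s \<le> \<beta>"
        using b AE_space
      proof eventually_elim
        case (elim s)
        have s: "t\<^sub>1 \<le> s" "s \<le> t\<^sub>2" "s \<in> {0..T}" using elim t tT' t10 by (auto simp: space_restrict_space)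
        define zs where "zs = (1 / \<epsilon>) *\<^sub>R d s"
        have zz: "norm (z - zs) \<le> 2 * e / \<epsilon>"
        proof -
          have "z - zs = (1 / \<epsilon>) *\<^sub>R ((y s - y t\<^sub>1) - (x s - x t\<^sub>1))"
            using xx[of t\<^sub>1] yy[of t\<^sub>1] t10 by (simp add: z_def zs_def d_def algebra_simps)
          moreover have "norm ((y s - y t\<^sub>1) - (x s - x t\<^sub>1)) \<le> e + e"
            using osc[OF x(1) s(1,2)] osc[OF y(1) s(1,2)] norm_triangle_ineq4[of "y s - y t\<^sub>1" "x s - x t\<^sub>1"]
                by linarith
          ultimately show ?thesis using \<epsilon> by (simp add: divide_right_mono)
        qed
        have 1: "F s x z - F s y z \<le> F s x zs - F s y zs + 2 * C * norm (z - zs)"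
          using lip[OF x(1) s(3), of z zs] lip[OF y(1) s(3), of z zs] by linarith
        have 2: "- (f s \<bullet> z - k s \<bullet> z) + 1 / \<epsilon> * ((f s - k s) \<bullet> d s) \<le> 2 * C * norm (z - zs)"
        proof -
          have "- (f s \<bullet> z - k s \<bullet> z) + 1 / \<epsilon> * ((f s - k s) \<bullet> d s) = (k s - f s) \<bullet> (z - zs)"
            by (simp add: zs_def inner_diff_left inner_diff_right algebra_simps)
          also have "\<dots> \<le> norm (k s - f s) * norm (z - zs)" by (rule norm_cauchy_schwarz)
          also have "\<dots> \<le> 2 * C * norm (z - zs)"
            using elim norm_triangle_ineq4[of "k s" "f s"] by (intro mult_right_mono) auto
          finally show ?thesis .
        qed
        have "4 * C * norm (z - zs) \<le> 4 * C * (2 * e / \<epsilon>)" using zz C by (intro mult_left_mono) auto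
        also have "\<dots> \<le> \<beta> / 2" using small by simp
        finally have 3: "4 * C * norm (z - zs) \<le> \<beta> / 2" .
        have "F s x zs - F s y zs + (norm (d s))\<^sup>2 / (2 * \<epsilon>) \<le> \<beta> / 2"
          unfolding zs_def d_def by (rule modulus[OF x(1) y(1) xx yy s(1,2)])
        then show ?case using 1 2 3 by (simp add: algebra_simps)
      qed
    qed
    also have "\<dots> = \<beta> * (t - t\<^sub>1)" using t by simp
    also have "integral {t\<^sub>1..t} ?G = (integral {t\<^sub>1..t} (\<lambda>s. F s x z) - integral {t\<^sub>1..t} (\<lambda>s. F s y z))
        - (integral {t\<^sub>1..t} (\<lambda>s. f s \<bullet> z) - integral {t\<^sub>1..t} (\<lambda>s. k s \<bullet> z))
        + (1 / \<epsilon> * integral {t\<^sub>1..t} (\<lambda>s. (f s - k s) \<bullet> d s) + 1 / (2 * \<epsilon>) * integral {t\<^sub>1..t} (\<lambda>s. (norm (d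
            s))\<^sup>2))"
    proof -
      note hk = absolutely_integrable_imp_HK
      show ?thesis
        by (subst Henstock_Kurzweil_Integration.integral_add, (intro hk set_integral_add(1) set_integral_diff(1)
            set_integrable_mult_right Fi fz en_int int2)+,
            subst Henstock_Kurzweil_Integration.integral_add, (intro hk set_integral_add(1) set_integral_diff(1)
                set_integrable_mult_right Fi fz en_int int2)+,
            subst Henstock_Kurzweil_Integration.integral_diff, (intro hk set_integral_add(1) set_integral_diff(1)
                set_integrable_mult_right Fi fz en_int int2)+,
            subst Henstock_Kurzweil_Integration.integral_diff, (intro hk Fi)+,
            subst Henstock_Kurzweil_Integration.integral_diff, (intro hk fz)+,
            simp only: integral_mult_right)
    qed
    finally have G: "(integral {t\<^sub>1..t} (\<lambda>s. F s x z) - integral {t\<^sub>1..t} (\<lambda>s. F s y z))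
        - (integral {t\<^sub>1..t} (\<lambda>s. f s \<bullet> z) - integral {t\<^sub>1..t} (\<lambda>s. k s \<bullet> z))
        + (1 / \<epsilon> * integral {t\<^sub>1..t} (\<lambda>s. (f s - k s) \<bullet> d s) + 1 / (2 * \<epsilon>) * integral {t\<^sub>1..t} (\<lambda>s. (norm (d s))\<^sup>2))
            \<le> \<beta> * (t - t\<^sub>1)" .
    have "penalty \<epsilon> t x y - penalty \<epsilon> t\<^sub>1 x y = 1 / \<epsilon> * ((norm (d t))\<^sup>2 / 2 - (norm (d t\<^sub>1))\<^sup>2 / 2)
        + 1 / (2 * \<epsilon>) * integral {t\<^sub>1..t} (\<lambda>s. (norm (d s))\<^sup>2)"
      unfolding penalty_def d_def[symmetric] comb[symmetric] using \<epsilon> by (simp add: field_simps)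
    also have "1 / \<epsilon> * ((norm (d t))\<^sup>2 / 2 - (norm (d t\<^sub>1))\<^sup>2 / 2) \<le> 1 / \<epsilon> * integral {t\<^sub>1..t} (\<lambda>s. (f s
        - k s) \<bullet> d s)"
      using en \<epsilon> by (intro mult_left_mono) auto
    finally show "\<Psi> \<epsilon> t\<^sub>1 x\<^sub>1 y\<^sub>1 \<le> \<Psi> \<epsilon> t x y + \<beta> * (t - t\<^sub>1)"
      unfolding \<Psi>_def pen1 using G ux[OF t(1) tT'] vy[OF t(1) tT'] by linarith
  qed
qed

lemma comparison_at_initial: "u t\<^sub>0 x\<^sub>0 \<le> v t\<^sub>0 x\<^sub>0"
proof (rule ccontr)
  assume "\<not> u t\<^sub>0 x\<^sub>0 \<le> v t\<^sub>0 x\<^sub>0"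
  define M\<^sub>0 where "M\<^sub>0 = u t\<^sub>0 x\<^sub>0 - v t\<^sub>0 x\<^sub>0"
  have M0: "M\<^sub>0 > 0" using \<open>\<not> _\<close> by (simp add: M\<^sub>0_def)
  obtain R where R0: "R \<ge> 0" and R: "\<And>x t. x \<in> K \<Longrightarrow> t \<in> {0..T} \<Longrightarrow> norm (x t) \<le> R"
    by (rule trajectories_bounded[OF L t0 x0_path]) (rule that)
  obtain L0 where L0: "L0 \<ge> 0" "\<forall>t\<in>{0..T}. \<forall>x\<in>C_paths T. \<forall>z z'. \<bar>F t x z - F t x z'\<bar>
      \<le> L0 * (1 + sup_upto t x) * norm (z - z')"
    using F unfolding admissible_Hamiltonian_def by blast
  define C where "C = (L + L0) * (1 + R)"
  have C0: "C \<ge> 0" and LC: "L * (1 + R) \<le> C" using L L0 R0 by (simp_all add: C_def algebra_simps)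
  have lip: "\<bar>F s x z - F s x z'\<bar> \<le> C * norm (z - z')" if x: "x \<in> K" and s: "s \<in> {0..T}" for s x z z'
  proof -
    have "sup_upto s x \<le> R" using s by (intro sup_upto_least R[OF x]) auto
    then have "L0 * (1 + sup_upto s x) \<le> L0 * (1 + R)" using L0 by (intro mult_left_mono) auto
    also have "\<dots> \<le> C" using L R0 by (simp add: C_def mult_right_mono)
    finally have "L0 * (1 + sup_upto s x) * norm (z - z') \<le> C * norm (z - z')" by (intro mult_right_mono) auto
    then show ?thesis using L0(2) s trajectories_C_paths[OF x] by (meson order_trans)
  qed
  obtain m where m: "modulus_of_continuity m" and Fm: "\<forall>\<epsilon>>0. \<forall>t\<in>{t\<^sub>0..T}. \<forall>x\<in>K. \<forall>y\<in>K.
           F t x ((1 / \<epsilon>) *\<^sub>R (x t - y t)) - F t y ((1 / \<epsilon>) *\<^sub>R (x t - y t))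
           \<le> m ((1 / \<epsilon>) * (norm (x t - y t))\<^sup>2 + (SUP s\<in>{0..t}. norm (x s - y s)))"
  proof -
    have "t\<^sub>0 \<in> {0..<T}" using t0 by simp
    then show thesis using F L x0_path that unfolding admissible_Hamiltonian_def by blast
  qed
  \<comment> \<open>The reward \<open>\<kappa>(t-t\<^sub>0)\<close> and the loss \<open>\<beta>(t-t\<^sub>1)\<close> never exceed \<open>M\<^sub>0/4\<close>.\<close>
  define \<kappa> where "\<kappa> = M\<^sub>0 / (4 * (T - t\<^sub>0))"
  define \<beta> where "\<beta> = \<kappa> / 2"
  have \<kappa>: "\<kappa> > 0" "\<beta> > 0" using M0 t0 by (simp_all add: \<kappa>_def \<beta>_def)
  have \<kappa>T: "\<kappa> * (T - t\<^sub>0) = M\<^sub>0 / 4" using t0 unfolding \<kappa>_def by (simp add: divide_simps)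
  obtain \<sigma> where \<sigma>: "\<sigma> > 0" "\<sigma> \<le> \<beta> / 2" "m \<sigma> < \<beta> / 4"
  proof -
    have "(m \<longlongrightarrow> 0) (at_right 0)" using m by (simp add: modulus_of_continuity_def)
    then have "\<forall>\<^sub>F s in at_right 0. m s < \<beta> / 4" using \<kappa> by (intro order_tendstoD) auto
    then obtain b where b: "b > 0" "\<And>s. s > 0 \<Longrightarrow> s < b \<Longrightarrow> m s < \<beta> / 4" by (auto simp: eventually_at_right_field)
    show thesis by (rule that[of "min (b / 2) (\<beta> / 2)"]) (use b \<kappa> in auto)
  qed
  have M04: "M\<^sub>0 / 4 > 0" using M0 by simp
  obtain \<rho> where \<rho>: "\<rho> > 0" "\<And>x y. x \<in> K \<Longrightarrow> y \<in> K \<Longrightarrow> (\<forall>t\<in>{0..T}. norm (x t - y t) \<le> \<rho>) \<Longrightarrow> \<bar>h x - h y\<bar> < M\<^sub>0 / 4"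
    using continuous_functional_on_totally_bounded(2)[OF K_totally_bounded T h M04] by blast
  define s\<^sub>0 where "s\<^sub>0 = min (\<sigma> / 4) (\<rho> / 2)"
  have s0: "s\<^sub>0 > 0" "s\<^sub>0 \<le> \<sigma> / 4" "s\<^sub>0 \<le> \<rho> / 2" using \<sigma> \<rho> by (auto simp: s\<^sub>0_def)
  have init: "x s = y s" if "x \<in> K" "y \<in> K" "0 \<le> s" "s \<le> t\<^sub>0" for x y s
    using trajectories_initial[OF that(1,3,4)] trajectories_initial[OF that(2,3,4)] by simp
  obtain \<omega> where \<omega>: "\<omega> > 0" and \<omega>s: "\<And>x y t s. \<lbrakk>x \<in> K; y \<in> K; t\<^sub>0 \<le> t; t \<le> T; integral {t\<^sub>0..t} (\<lambda>r. (norm (x r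
      - y r))\<^sup>2) \<le> \<omega>; 0 \<le> s; s \<le> t\<rbrakk>
      \<Longrightarrow> norm (x s - y s) \<le> s\<^sub>0"
    by (rule small_L2_imp_small_sup[OF K_totally_bounded t0(1) s0(1)]) (erule (3) init, rule that)
  define \<eta> where "\<eta> = min (\<omega> / 8) (min (\<sigma> / 64) (M\<^sub>0 / 8))"
  have \<eta>: "\<eta> > 0" "\<eta> \<le> \<omega> / 8" "\<eta> \<le> \<sigma> / 64" "\<eta> \<le> M\<^sub>0 / 8" using \<omega> \<sigma> M0 by (auto simp: \<eta>_def)
  define S where "S = {t\<^sub>0..T} \<times> (K \<inter> \<Omega>') \<times> (K \<inter> \<Omega>')"
  define \<Phi> where "\<Phi> \<epsilon> = (\<lambda>(t, x, y). \<Psi> \<epsilon> t x y + \<kappa> * (t - t\<^sub>0))" for \<epsilon>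
  obtain B where B: "B \<ge> 0" and uB: "\<And>t x. \<lbrakk>t\<^sub>0 \<le> t; t \<le> T; x \<in> K; x \<in> \<Omega>'\<rbrakk> \<Longrightarrow> u t x \<le> B"
    and vB: "\<And>t x. \<lbrakk>t\<^sub>0 \<le> t; t \<le> T; x \<in> K; x \<in> \<Omega>'\<rbrakk> \<Longrightarrow> v t x \<ge> - B"
    by (rule semisolutions_bounded) (rule that)
  have pen0: "penalty \<epsilon> t x y \<ge> 0" if "\<epsilon> > 0" for \<epsilon> t x y
    using that unfolding penalty_def by (intro divide_nonneg_pos add_nonneg_nonneg integral_nonneg_everywhere) auto
  have \<Phi>B: "\<Phi> \<epsilon> a \<le> 2 * B + M\<^sub>0 / 4" if "\<epsilon> > 0" "a \<in> S" for \<epsilon> a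
  proof -
    obtain t x y where a: "a = (t, x, y)" by (cases a)
    have "\<kappa> * (t - t\<^sub>0) \<le> \<kappa> * (T - t\<^sub>0)" using that a \<kappa> by (intro mult_left_mono) (auto simp: S_def)
    moreover have "u t x \<le> B" "v t y \<ge> - B" using that a uB vB by (auto simp: S_def)
    ultimately show ?thesis using pen0[OF that(1), of t x y] \<kappa>T by (simp add: a \<Phi>_def \<Psi>_def)
  qed
  have bdd: "bdd_above (\<Phi> \<epsilon> ` S)" if "\<epsilon> > 0" for \<epsilon>
    using \<Phi>B[OF that] by (rule bdd_aboveI2)
  have t0S: "t\<^sub>0 \<in> {0..<T}" using t0 by simp
  obtain x' where x': "x' \<in> K" "x' \<in> \<Omega>'"
    using u x0 t0S unfolding minimax_L_subsolution_def by blast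
  \<comment> \<open>\<open>x\<^sub>0\<close> itself need not lie in \<open>K\<close>, but \<open>x'\<close> has the same past and semicontinuous functions are
    nonanticipating.\<close>
  have ux': "u t\<^sub>0 x' = u t\<^sub>0 x\<^sub>0"
    by (rule USC_nonanticipating[of T \<Omega>'])
      (use u x' x0 T t0 trajectories_initial[OF x'(1)] in \<open>auto simp: minimax_L_subsolution_def\<close>)
  have vx': "v t\<^sub>0 x' = v t\<^sub>0 x\<^sub>0"
    by (rule LSC_nonanticipating[of T \<Omega>'])
      (use v x' x0 T t0 trajectories_initial[OF x'(1)] in \<open>auto simp: minimax_L_supersolution_def\<close>)
  have start: "(t\<^sub>0, x', x') \<in> S" "\<Phi> \<epsilon> (t\<^sub>0, x', x') = M\<^sub>0" for \<epsilon>
    using x' t0 by (auto simp: S_def \<Phi>_def \<Psi>_def penalty_def ux' vx' M\<^sub>0_def)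
  define M where "M \<epsilon> = (SUP a\<in>S. \<Phi> \<epsilon> a)" for \<epsilon>
  have MU: "\<Phi> \<epsilon> a \<le> M \<epsilon>" if "\<epsilon> > 0" "a \<in> S" for \<epsilon> a unfolding M_def using that bdd by (intro cSUP_upper) auto
  have MM0: "M\<^sub>0 \<le> M \<epsilon>" if "\<epsilon> > 0" for \<epsilon> using MU[OF that start(1)] start(2) by simp
  \<comment> \<open>Halving \<open>\<epsilon>\<close> doubles the penalty. As the suprema are bounded below by \<open>M\<^sub>0\<close>, some halving hardly
    lowers them, so that the penalty at nearly maximal points is small there.\<close>
  obtain n where n: "M ((1/2)^n) - M ((1/2)^(Suc n)) < \<eta>"
    by (rule decreasing_bounded_small_step[of M\<^sub>0 "\<lambda>n. M ((1/2)^n)" \<eta>]) (use MM0 \<eta> that in auto)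
  define \<epsilon> :: real where "\<epsilon> = (1/2)^(Suc n)"
  have \<epsilon>: "\<epsilon> > 0" "\<epsilon> \<le> 1" unfolding \<epsilon>_def by (simp, intro power_le_one) auto
  have M2: "M (2 * \<epsilon>) - M \<epsilon> < \<eta>" using n by (simp add: \<epsilon>_def)
  \<comment> \<open>The admissible oscillation in one step may depend on \<open>\<epsilon>\<close>, and the length \<open>\<tau>'\<close> of the step on both;
    the tolerance \<open>\<delta>\<close> of near maximality is chosen last.\<close>
  define e where "e = min 1 (min (s\<^sub>0 / 2) (min (\<epsilon> * \<sigma> / 32) (\<epsilon> * \<beta> / (16 * (C + 1)))))"
  have e: "e > 0" "e \<le> 1" "e \<le> s\<^sub>0 / 2" "e \<le> \<epsilon> * \<sigma> / 32" "e \<le> \<epsilon> * \<beta> / (16 * (C + 1))"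
  proof -
    have "0 < s\<^sub>0 / 2" "0 < \<epsilon> * \<sigma> / 32" "0 < \<epsilon> * \<beta> / (16 * (C + 1))" using \<epsilon> \<sigma> \<kappa> C0 s0 by simp_all
    then show "e > 0" by (simp only: e_def min_less_iff_conj zero_less_one simp_thms)
  qed (unfold e_def, (rule min.coboundedI1 min.coboundedI2 order_refl | simp only: min.cobounded1 min.cobounded2
      min.coboundedI1 min.coboundedI2)+)
  obtain \<tau> where \<tau>: "\<tau> > 0" and \<tau>K: "\<And>x s t. \<lbrakk>x \<in> K; s \<in> {0..T}; t \<in> {0..T}; \<bar>s - t\<bar> < \<tau>\<rbrakk> \<Longrightarrow> norm (x s - x t) < e"
    by (rule totally_bounded_paths_equicontinuous[OF K_totally_bounded e(1)]) (rule that)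
  define \<tau>' where "\<tau>' = \<tau> / 2"
  have \<tau>': "\<tau>' > 0" using \<tau> by (simp add: \<tau>'_def)
  define \<delta> where "\<delta> = min \<eta> (\<beta> * \<tau>')"
  have \<delta>: "\<delta> > 0" "\<delta> \<le> \<eta>" "\<delta> \<le> \<beta> * \<tau>'" using \<eta> \<kappa> \<tau>' by (auto simp: \<delta>_def)
  obtain a where a: "a \<in> S" "M \<epsilon> - \<delta> < \<Phi> \<epsilon> a"
  proof -
    have "S \<noteq> {}" using start(1) by blast
    then have "\<exists>a\<in>S. M \<epsilon> - \<delta> < \<Phi> \<epsilon> a"
      using less_cSUP_iff[of S "\<Phi> \<epsilon>" "M \<epsilon> - \<delta>"] bdd[OF \<epsilon>(1)] \<delta> by (simp add: M_def)
    then show thesis using that by blast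
  qed
  obtain t\<^sub>1 x\<^sub>1 y\<^sub>1 where a': "a = (t\<^sub>1, x\<^sub>1, y\<^sub>1)" by (cases a)
  have t1: "t\<^sub>0 \<le> t\<^sub>1" "t\<^sub>1 \<le> T" and x1: "x\<^sub>1 \<in> K" "x\<^sub>1 \<in> \<Omega>'" and y1: "y\<^sub>1 \<in> K" "y\<^sub>1 \<in> \<Omega>'"
    using a a' by (auto simp: S_def)
  have t10: "0 \<le> t\<^sub>1" using t1 t0 by simp
  have pen_small: "penalty \<epsilon> t\<^sub>1 x\<^sub>1 y\<^sub>1 \<le> 4 * \<eta>"
  proof -
    have "penalty (2 * \<epsilon>) t\<^sub>1 x\<^sub>1 y\<^sub>1 = penalty \<epsilon> t\<^sub>1 x\<^sub>1 y\<^sub>1 / 2" by (simp add: penalty_def)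
    then have "\<Phi> (2 * \<epsilon>) a = \<Phi> \<epsilon> a + penalty \<epsilon> t\<^sub>1 x\<^sub>1 y\<^sub>1 / 2" by (simp add: a' \<Phi>_def \<Psi>_def)
    moreover have "\<Phi> (2 * \<epsilon>) a \<le> M (2 * \<epsilon>)" using \<epsilon> a by (intro MU) auto
    ultimately show ?thesis using a(2) M2 \<delta> by linarith
  qed
  have I0: "0 \<le> integral {t\<^sub>0..t\<^sub>1} (\<lambda>s. (norm (x\<^sub>1 s - y\<^sub>1 s))\<^sup>2)" by (rule integral_nonneg_everywhere) simp
  have pen': "(norm (x\<^sub>1 t\<^sub>1 - y\<^sub>1 t\<^sub>1))\<^sup>2 + integral {t\<^sub>0..t\<^sub>1} (\<lambda>s. (norm (x\<^sub>1 s - y\<^sub>1 s))\<^sup>2) \<le> 8 * \<eta> * \<epsilon>"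
    using pen_small \<epsilon> by (simp add: penalty_def divide_le_eq algebra_simps)
  have d1: "(norm (x\<^sub>1 t\<^sub>1 - y\<^sub>1 t\<^sub>1))\<^sup>2 \<le> 8 * \<eta> * \<epsilon>" using pen' I0 by linarith
  have "8 * \<eta> * \<epsilon> \<le> 8 * \<eta> * 1" using \<epsilon> \<eta> by (intro mult_left_mono) auto
  then have "integral {t\<^sub>0..t\<^sub>1} (\<lambda>s. (norm (x\<^sub>1 s - y\<^sub>1 s))\<^sup>2) \<le> \<omega>"
    using pen' \<eta>(2) zero_le_power2[of "norm (x\<^sub>1 t\<^sub>1 - y\<^sub>1 t\<^sub>1)"] by linarith
  then have sup1: "norm (x\<^sub>1 s - y\<^sub>1 s) \<le> s\<^sub>0" if "0 \<le> s" "s \<le> t\<^sub>1" for s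
    using \<omega>s[OF x1(1) y1(1) t1] that by blast
  define t\<^sub>2 where "t\<^sub>2 = min T (t\<^sub>1 + \<tau>')"
  have t2: "t\<^sub>1 \<le> t\<^sub>2" "t\<^sub>2 \<le> T" "t\<^sub>2 \<le> t\<^sub>1 + \<tau>'" using t1 \<tau>' by (auto simp: t\<^sub>2_def)
  have osc: "norm (x s - x t\<^sub>1) \<le> e" if "x \<in> K" "t\<^sub>1 \<le> s" "s \<le> t\<^sub>2" for x s
    using \<tau>K[OF that(1), of s t\<^sub>1] that t2 t10 \<tau>' by (force simp: \<tau>'_def)
  have dist: "norm ((x s - y s) - (x t\<^sub>1 - y t\<^sub>1)) \<le> 2 * e" if "x \<in> K" "y \<in> K" "t\<^sub>1 \<le> s" "s \<le> t\<^sub>2" for x y s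
  proof -
    have eq: "(x s - y s) - (x t\<^sub>1 - y t\<^sub>1) = (x s - x t\<^sub>1) - (y s - y t\<^sub>1)" by simp
    show ?thesis
      unfolding eq using norm_triangle_ineq4[of "x s - x t\<^sub>1" "y s - y t\<^sub>1"] osc[OF that(1,3,4)] osc[OF that(2,3,4)]
      by linarith
  qed
  have near: "norm (x s - y s) \<le> 2 * s\<^sub>0"
    if xy: "x \<in> K" "y \<in> K" and past: "\<And>r. 0 \<le> r \<Longrightarrow> r \<le> t\<^sub>1 \<Longrightarrow> x r = x\<^sub>1 r" "\<And>r. 0 \<le> r \<Longrightarrow> r \<le> t\<^sub>1 \<Longrightarrow> y r = y\<^sub>1 r"
      and s: "0 \<le> s" "s \<le> t\<^sub>2" for x y s
  proof (cases "s \<le> t\<^sub>1")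
    case True
    then show ?thesis using sup1[OF s(1) True] past s(1) s0 by simp
  next
    case False
    have "norm (x t\<^sub>1 - y t\<^sub>1) \<le> s\<^sub>0" using sup1[of t\<^sub>1] past t10 by simp
    moreover have "norm (x s - y s) \<le> norm (x t\<^sub>1 - y t\<^sub>1) + norm ((x s - y s) - (x t\<^sub>1 - y t\<^sub>1))"
      by (metis add_diff_cancel_left' add.commute diff_add_cancel norm_triangle_ineq)
    ultimately show ?thesis using dist[OF xy, of s] False s e(3) by simp
  qed
  have modulus: "F s x ((1 / \<epsilon>) *\<^sub>R (x s - y s)) - F s y ((1 / \<epsilon>) *\<^sub>R (x s - y s)) + (norm (x s - y s))\<^sup>2 / (2 * \<epsilon>)
      \<le> \<beta> / 2"
    if xy: "x \<in> K" "y \<in> K" and past: "\<And>r. 0 \<le> r \<Longrightarrow> r \<le> t\<^sub>1 \<Longrightarrow> x r = x\<^sub>1 r" "\<And>r. 0 \<le> r \<Longrightarrow> r \<le> t\<^sub>1 \<Longrightarrow> y r = y\<^sub>1 r"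
      and s: "t\<^sub>1 \<le> s" "s \<le> t\<^sub>2" for x y s
  proof -
    let ?D = "(norm (x s - y s))\<^sup>2 / \<epsilon>"
    have D: "?D \<le> \<sigma> / 2"
    proof -
      have "norm (x s - y s) \<le> norm (x t\<^sub>1 - y t\<^sub>1) + norm ((x s - y s) - (x t\<^sub>1 - y t\<^sub>1))"
        by (metis add_diff_cancel_left' add.commute diff_add_cancel norm_triangle_ineq)
      also have "\<dots> \<le> norm (x\<^sub>1 t\<^sub>1 - y\<^sub>1 t\<^sub>1) + 2 * e" using dist[OF xy s] past[of t\<^sub>1] t10 by simp
      finally have "(norm (x s - y s))\<^sup>2 \<le> (norm (x\<^sub>1 t\<^sub>1 - y\<^sub>1 t\<^sub>1) + 2 * e)\<^sup>2" by (intro power_mono) auto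
      also have "\<dots> \<le> 2 * (norm (x\<^sub>1 t\<^sub>1 - y\<^sub>1 t\<^sub>1))\<^sup>2 + 2 * (2 * e)\<^sup>2"
        using zero_le_power2[of "norm (x\<^sub>1 t\<^sub>1 - y\<^sub>1 t\<^sub>1) - 2 * e"] by (simp add: power2_sum power2_diff)
      also have "\<dots> \<le> 16 * \<eta> * \<epsilon> + 8 * e"
      proof -
        have "e\<^sup>2 \<le> e" using e by (simp add: power2_eq_square mult_left_le)
        then show ?thesis using d1 by (simp add: power_mult_distrib)
      qed
      also have "\<dots> \<le> \<sigma> / 4 * \<epsilon> + \<sigma> / 4 * \<epsilon>"
      proof (rule add_mono)
        have "\<eta> * (16 * \<epsilon>) \<le> \<sigma> / 64 * (16 * \<epsilon>)" using \<eta>(3) \<epsilon> by (intro mult_right_mono) auto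
        then show "16 * \<eta> * \<epsilon> \<le> \<sigma> / 4 * \<epsilon>" by (simp add: algebra_simps)
        show "8 * e \<le> \<sigma> / 4 * \<epsilon>" using e(4) by (simp add: mult.commute)
      qed
      finally show ?thesis using \<epsilon> by (simp add: divide_le_eq mult.commute)
    qed
    have sup: "(SUP r\<in>{0..s}. norm (x r - y r)) \<le> \<sigma> / 2"
    proof (rule cSUP_least)
      show "{0..s} \<noteq> {}" using s t10 by simp
      fix r assume "r \<in> {0..s}"
      then have "norm (x r - y r) \<le> 2 * s\<^sub>0" using s by (intro near[OF xy past]) auto
      then show "norm (x r - y r) \<le> \<sigma> / 2" using s0 by simp
    qed
    have sup0: "0 \<le> (SUP r\<in>{0..s}. norm (x r - y r))"
    proof -
      have "bdd_above ((\<lambda>r. norm (x r - y r)) ` {0..s})"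
        by (rule bdd_aboveI2[of _ _ "2 * s\<^sub>0"]) (use s near[OF xy past] in auto)
      then have "norm (x 0 - y 0) \<le> (SUP r\<in>{0..s}. norm (x r - y r))" using s t10 by (intro cSUP_upper) auto
      then show ?thesis using norm_ge_zero order_trans by blast
    qed
    have D0: "0 \<le> ?D" using \<epsilon> by simp
    have "F s x ((1 / \<epsilon>) *\<^sub>R (x s - y s)) - F s y ((1 / \<epsilon>) *\<^sub>R (x s - y s)) \<le> m ((1 / \<epsilon>) * (norm (x s - y s))\<^sup>2
        + (SUP r\<in>{0..s}. norm (x r - y r)))"
      using Fm \<epsilon> xy s t1 t2 by simp
    also have "\<dots> \<le> m \<sigma>"
    proof -
      have "mono_on {0..} m" using m by (simp add: modulus_of_continuity_def)
      moreover have "?D + (SUP r\<in>{0..s}. norm (x r - y r)) \<le> \<sigma>" using D sup by linarith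
      moreover have "0 \<le> ?D + (SUP r\<in>{0..s}. norm (x r - y r))" using D0 sup0 by (rule add_nonneg_nonneg)
      ultimately have "m (?D + (SUP r\<in>{0..s}. norm (x r - y r))) \<le> m \<sigma>" using \<sigma>(1) by (intro mono_onD[of
          "{0..}" m]) auto
      then show ?thesis by simp
    qed
    finally have "F s x ((1 / \<epsilon>) *\<^sub>R (x s - y s)) - F s y ((1 / \<epsilon>) *\<^sub>R (x s - y s)) \<le> m \<sigma>" .
    moreover have "(norm (x s - y s))\<^sup>2 / (2 * \<epsilon>) = ?D / 2" by simp
    ultimately show ?thesis using D \<sigma> by linarith
  qed
  have small: "8 * C * e / \<epsilon> \<le> \<beta> / 2"
  proof -
    have "8 * C * e \<le> 8 * (C + 1) * e" using e by (intro mult_right_mono) auto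
    also have "\<dots> \<le> 8 * (C + 1) * (\<epsilon> * \<beta> / (16 * (C + 1)))" using e C0 by (intro mult_left_mono) auto
    also have "\<dots> = \<beta> / 2 * \<epsilon>" using C0 by (simp add: divide_simps)
    finally show ?thesis using \<epsilon> by (simp add: divide_le_eq)
  qed
  obtain x y where x: "x \<in> K" "x \<in> \<Omega>'" and y: "y \<in> K" "y \<in> \<Omega>'"
    and past: "\<And>r. 0 \<le> r \<Longrightarrow> r \<le> t\<^sub>1 \<Longrightarrow> x r = x\<^sub>1 r" "\<And>r. 0 \<le> r \<Longrightarrow> r \<le> t\<^sub>1 \<Longrightarrow> y r = y\<^sub>1 r"
    and step: "\<And>t. t\<^sub>1 \<le> t \<Longrightarrow> t \<le> t\<^sub>2 \<Longrightarrow> \<Psi> \<epsilon> t\<^sub>1 x\<^sub>1 y\<^sub>1 \<le> \<Psi> \<epsilon> t x y + \<beta> * (t - t\<^sub>1)"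
  proof (rule doubling_step[OF t1 x1 y1 \<epsilon>(1) C0 _ LC _ _ t2(2) small])
    show "norm (x t) \<le> R" if "x \<in> K" "t \<in> {0..T}" for x t using R[OF that] .
    show "\<bar>F s x z - F s x z'\<bar> \<le> C * norm (z - z')" if "x \<in> K" "s \<in> {0..T}" for s x z z' using lip[OF that] .
    show "norm (x s - x t\<^sub>1) \<le> e" if "x \<in> K" "t\<^sub>1 \<le> s" "s \<le> t\<^sub>2" for x s using osc[OF that] .
    show "F s x ((1 / \<epsilon>) *\<^sub>R (x s - y s)) - F s y ((1 / \<epsilon>) *\<^sub>R (x s - y s)) + (norm (x s - y s))\<^sup>2 / (2 * \<epsilon>)
        \<le> \<beta> / 2"
      if "x \<in> K" "y \<in> K" "\<And>r. 0 \<le> r \<Longrightarrow> r \<le> t\<^sub>1 \<Longrightarrow> x r = x\<^sub>1 r" "\<And>r. 0 \<le> r \<Longrightarrow> r \<le> t\<^sub>1 \<Longrightarrow> y r = y\<^sub>1 r" "t\<^sub>1 \<le> s" "s \<le> t\<^sub>2"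
          for x y s
      by (rule modulus) (use that in auto)
  qed (rule that)
  have \<Phi>1: "M \<epsilon> - \<delta> < \<Psi> \<epsilon> t\<^sub>1 x\<^sub>1 y\<^sub>1 + \<kappa> * (t\<^sub>1 - t\<^sub>0)" using a by (simp add: a' \<Phi>_def)
  show False
  proof (cases "t\<^sub>1 + \<tau>' \<le> T")
    case True
    then have t2e: "t\<^sub>2 = t\<^sub>1 + \<tau>'" by (simp add: t\<^sub>2_def)
    have "(t\<^sub>2, x, y) \<in> S" using x y t1 t2 by (simp add: S_def)
    then have "\<Psi> \<epsilon> t\<^sub>2 x y + \<kappa> * (t\<^sub>2 - t\<^sub>0) \<le> M \<epsilon>" using MU[OF \<epsilon>(1)] by (force simp: \<Phi>_def)
    moreover have "\<kappa> * (t\<^sub>2 - t\<^sub>0) = \<kappa> * (t\<^sub>1 - t\<^sub>0) + 2 * (\<beta> * \<tau>')" by (simp add: t2e \<beta>_def algebra_simps)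
    ultimately show False using step[OF t2(1) order_refl] \<Phi>1 \<delta>(3) by (simp add: t2e)
  next
    case False
    then have t2e: "t\<^sub>2 = T" by (simp add: t\<^sub>2_def)
    have "norm (x r - y r) \<le> \<rho>" if "r \<in> {0..T}" for r
      using near[OF x(1) y(1) past, of r] that t2e s0 by simp
    then have "\<bar>h x - h y\<bar> < M\<^sub>0 / 4" using \<rho>(2)[OF x(1) y(1)] by blast
    moreover have "u T x \<le> h x" using u x unfolding minimax_L_subsolution_def by blast
    moreover have "h y \<le> v T y" using v y unfolding minimax_L_supersolution_def by blast
    moreover have "\<Psi> \<epsilon> T x y \<le> u T x - v T y" using pen0[OF \<epsilon>(1)] by (simp add: \<Psi>_def)
    moreover have "\<beta> * (T - t\<^sub>1) \<le> \<kappa> * (T - t\<^sub>1)" using t1 \<kappa> by (intro mult_right_mono) (auto simp: \<beta>_def)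
    moreover have "\<kappa> * (T - t\<^sub>1) + \<kappa> * (t\<^sub>1 - t\<^sub>0) = M\<^sub>0 / 4" using \<kappa>T by (simp add: algebra_simps)
    ultimately show False using step[OF t2(1) order_refl] \<Phi>1 \<delta>(2) \<eta>(4) MM0[OF \<epsilon>(1)] M0 unfolding t2e by linarith
  qed
qed

end

section \<open>The comparison theorem\<close>

theorem theorem4p5:
  fixes j :: "'v::{banach,second_countable_topology} \<Rightarrow>\<^sub>L 'h::{real_inner,banach}"
    and A :: "real \<Rightarrow> 'v \<Rightarrow> ('v \<Rightarrow>\<^sub>L real)"
    and F :: "real \<Rightarrow> (real \<Rightarrow> 'h) \<Rightarrow> 'h \<Rightarrow> real"
    and h :: "(real \<Rightarrow> 'h) \<Rightarrow> real"
    and u v :: "real \<Rightarrow> (real \<Rightarrow> 'h) \<Rightarrow> real"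
    and \<Omega>' :: "(real \<Rightarrow> 'h) set"
    and xstar :: 'h
    and T p q :: real
  assumes "T > 0" and "p \<ge> 2" and "q > 1" and "1 / p + 1 / q = 1"
    and "evolution_triple j"
    and "admissible_operator T p q A"
    and "continuous_wrt (d_sup T) (C_paths T) h"
    and "admissible_Hamiltonian T p q j A F"
    and "Omega T p q j A xstar \<subseteq> \<Omega>'" and "\<Omega>' \<subseteq> C_paths T"
    and "minimax_subsolution T p q j A F h \<Omega>' u"
    and "minimax_supersolution T p q j A F h \<Omega>' v"
  shows "\<forall>t\<in>{0..T}. \<forall>x\<in>\<Omega>'. u t x \<le> v t x"
proof (intro ballI)
  fix t x assume t: "t \<in> {0..T}" and x: "x \<in> \<Omega>'"
  interpret evolution_problem T p q j A
    by unfold_locales (use assms in auto)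
  obtain L1 where L1: "L1 \<ge> 0" "minimax_L_subsolution T p q j A F h \<Omega>' L1 u"
    using assms(11) unfolding minimax_subsolution_def by blast
  obtain L2 where L2: "L2 \<ge> 0" "minimax_L_supersolution T p q j A F h \<Omega>' L2 v"
    using assms(12) unfolding minimax_supersolution_def by blast
  define L where "L = max L1 L2"
  have mono: "trajectories T p q j A L1 t\<^sub>0 x\<^sub>0 \<subseteq> trajectories T p q j A L t\<^sub>0 x\<^sub>0"
    "trajectories T p q j A L2 t\<^sub>0 x\<^sub>0 \<subseteq> trajectories T p q j A L t\<^sub>0 x\<^sub>0" if "t\<^sub>0 \<in> {0..<T}" for t\<^sub>0 x\<^sub>0
    using that by (intro trajectories_mono; simp add: L_def)+
  show "u t x \<le> v t x"
  proof (cases "t = T")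
    case True
    then show ?thesis
      using L1 L2 x unfolding minimax_L_subsolution_def minimax_L_supersolution_def by (meson order_trans)
  next
    case False
    interpret comparison T p q j A F h u v \<Omega>' L t x
    proof
      show "minimax_L_subsolution T p q j A F h \<Omega>' L u"
        unfolding minimax_L_subsolution_def
      proof (intro conjI ballI allI)
        fix t\<^sub>0 x\<^sub>0 z assume h: "t\<^sub>0 \<in> {0..<T}" "x\<^sub>0 \<in> \<Omega>'"
        then obtain x where "x \<in> trajectories T p q j A L1 t\<^sub>0 x\<^sub>0" "x \<in> \<Omega>'"
            and f: "\<exists>f. is_forcing T p q j A t\<^sub>0 x f \<and>
          (\<forall>t\<in>{t\<^sub>0..T}. u t\<^sub>0 x\<^sub>0 \<le> (LINT s:{t\<^sub>0..t}|lebesgue. (- f s) \<bullet> z + F s x z) + u t x)"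
          using L1(2) unfolding minimax_L_subsolution_def by blast
        then have x: "x \<in> trajectories T p q j A L t\<^sub>0 x\<^sub>0 \<inter> \<Omega>'" using mono(1)[OF h(1)] by blast
        from f x show "\<exists>x\<in>trajectories T p q j A L t\<^sub>0 x\<^sub>0 \<inter> \<Omega>'. \<exists>f. is_forcing T p q j A t\<^sub>0 x f \<and>
          (\<forall>t\<in>{t\<^sub>0..T}. u t\<^sub>0 x\<^sub>0 \<le> (LINT s:{t\<^sub>0..t}|lebesgue. (- f s) \<bullet> z + F s x z) + u t x)"
          by (rule bexI)
      qed (use L1(2) in \<open>auto simp: minimax_L_subsolution_def\<close>)
      show "minimax_L_supersolution T p q j A F h \<Omega>' L v"
        unfolding minimax_L_supersolution_def
      proof (intro conjI ballI allI)
        fix t\<^sub>0 x\<^sub>0 z assume h: "t\<^sub>0 \<in> {0..<T}" "x\<^sub>0 \<in> \<Omega>'"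
        then obtain x where "x \<in> trajectories T p q j A L2 t\<^sub>0 x\<^sub>0" "x \<in> \<Omega>'"
            and f: "\<exists>f. is_forcing T p q j A t\<^sub>0 x f \<and>
          (\<forall>t\<in>{t\<^sub>0..T}. v t\<^sub>0 x\<^sub>0 \<ge> (LINT s:{t\<^sub>0..t}|lebesgue. (- f s) \<bullet> z + F s x z) + v t x)"
          using L2(2) unfolding minimax_L_supersolution_def by blast
        then have x: "x \<in> trajectories T p q j A L t\<^sub>0 x\<^sub>0 \<inter> \<Omega>'" using mono(2)[OF h(1)] by blast
        from f x show "\<exists>x\<in>trajectories T p q j A L t\<^sub>0 x\<^sub>0 \<inter> \<Omega>'. \<exists>f. is_forcing T p q j A t\<^sub>0 x f \<and>
          (\<forall>t\<in>{t\<^sub>0..T}. v t\<^sub>0 x\<^sub>0 \<ge> (LINT s:{t\<^sub>0..t}|lebesgue. (- f s) \<bullet> z + F s x z) + v t x)"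
          by (rule bexI)
      qed (use L2(2) in \<open>auto simp: minimax_L_supersolution_def\<close>)
    qed (use assms L1(1) t x False in \<open>auto simp: L_def\<close>)
    show ?thesis by (rule comparison_at_initial)
  qed
qed

end
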